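(* Let $X(t)$, $t\ge 0$, be a symmetric $\alpha$-stable Lévy process in $\mathbb{R}^d$ with $\alpha>1$, and let $Z$ be the closed convex hull of $\{X(t):0\le t\le 1\}$. Then, for all $j=1,\dots,d$, $$\mathbf{E}\,V_j(Z)=\frac{\Gamma(1-1/\alpha)^j\,\Gamma(1/\alpha)^j}{\pi^j\,\Gamma(j/\alpha+1)}\,V_j(K),$$ where $K$ is the associated zonoid of $X(1)$ and $V_j$ denotes the $j$-th intrinsic volume.
   Context: Stability forces $\alpha\le 2$, so here $\alpha\in(1,2]$; the process starts at the origin. A convex body is a non-empty compact convex set in $\mathbb{R}^d$, with support function $h(K,u)=\sup\{\langle x,u\rangle:x\in K\}$. The associated zonoid of $X(1)$ is the convex body $K$ such that $\mathbf{E}\exp\{\imath\langle X(t),u\rangle\}=\exp\{-t\,h(K,u)^\alpha\}$ for all $u\in\mathbb{R}^d$, $t\ge 0$ (a zonoid is a limit, in the Hausdorff metric, of Minkowski sums of segments). The intrinsic volumes $V_0,\dots,V_d$ of a convex body $L$ are determined by the Steiner formula $V_d(L+tB^d)=\sum_{j=0}^d t^{d-j}\kappa_{d-j}V_j(L)$, $t\ge 0$, where $V_d$ is Lebesgue measure, $B^d$ is the centred closed unit ball in $\mathbb{R}^d$, the sum of sets is the Minkowski sum, and $\kappa_m$ is the $m$-dimensional volume of the unit ball $B^m$ (with $\kappa_0=1$). *)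

theory Defs
  imports "HOL-Probability.Probability"
begin

definition convex_body :: "'a::euclidean_space set \<Rightarrow> bool" where
  "convex_body K \<longleftrightarrow> K \<noteq> {} \<and> compact K \<and> convex K"

definition support_fun :: "'a::euclidean_space set \<Rightarrow> 'a \<Rightarrow> real" where
  "support_fun K u = (SUP x\<in>K. x \<bullet> u)"

(* L + cball 0 t is the Minkowski sum (HOL-Library.Set_Algebras). The second conjunct only
   fixes the values beyond the dimension, so that the sequence of coefficients is unique. *)
definition steiner_coeffs :: "'a::euclidean_space set \<Rightarrow> (nat \<Rightarrow> real) \<Rightarrow> bool" where
  "steiner_coeffs L v \<longleftrightarrow>
     (\<forall>t\<ge>0. measure lborel (L + cball 0 t) =
        (\<Sum>j\<le>DIM('a). t ^ (DIM('a) - j) * unit_ball_vol (real (DIM('a) - j)) * v j)) \<and>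
     (\<forall>j>DIM('a). v j = 0)"

(* Meaningful for convex bodies L, for which the Steiner formula determines the coefficients. *)
definition intrinsic_volume :: "nat \<Rightarrow> 'a::euclidean_space set \<Rightarrow> real" where
  "intrinsic_volume j L = (THE v. steiner_coeffs L v) j"

(* X t is only relevant for t >= 0. Stochastic continuity is not listed separately: it follows
   from right-continuity and stationarity of the increments. *)
locale levy_process = prob_space M for M :: "'w measure" +
  fixes X :: "real \<Rightarrow> 'w \<Rightarrow> 'a::euclidean_space"
  assumes random_variable_X: "\<And>t. 0 \<le> t \<Longrightarrow> random_variable borel (X t)"
    and starts_at_origin: "AE \<omega> in M. X 0 \<omega> = 0"
    and indep_increments: "\<And>(n::nat) \<tau>. 0 \<le> \<tau> 0 \<Longrightarrow> (\<And>i. i < n \<Longrightarrow> \<tau> i \<le> \<tau> (Suc i)) \<Longrightarrow>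
          indep_vars (\<lambda>_. borel) (\<lambda>i \<omega>. X (\<tau> (Suc i)) \<omega> - X (\<tau> i) \<omega>) {..<n}"
    and stationary_increments: "\<And>s h. 0 \<le> s \<Longrightarrow> 0 \<le> h \<Longrightarrow>
          distr M borel (\<lambda>\<omega>. X (s + h) \<omega> - X s \<omega>) = distr M borel (\<lambda>\<omega>. X h \<omega> - X 0 \<omega>)"
    and cadlag_paths: "AE \<omega> in M.
          (\<forall>t\<ge>0. continuous (at_right t) (\<lambda>s. X s \<omega>)) \<and>
          (\<forall>t>0. \<exists>l. ((\<lambda>s. X s \<omega>) \<longlongrightarrow> l) (at_left t))"

(* In terms of a random vector Y with law \<mu> and independent copies Y1, Y2 of it: -Y has the same
   law as Y, and a^(1/\<alpha>) Y1 + b^(1/\<alpha>) Y2 the same law as (a + b)^(1/\<alpha>) Y for all a, b > 0.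
   The range of \<alpha> is automatic unless \<mu> is the point mass at the origin. *)
definition symmetric_stable_law :: "real \<Rightarrow> 'a::euclidean_space measure \<Rightarrow> bool" where
  "symmetric_stable_law \<alpha> \<mu> \<longleftrightarrow>
     0 < \<alpha> \<and> \<alpha> \<le> 2 \<and> prob_space \<mu> \<and> sets \<mu> = sets borel \<and>
     distr \<mu> borel uminus = \<mu> \<and>
     (\<forall>a>0. \<forall>b>0.
        distr (\<mu> \<Otimes>\<^sub>M \<mu>) borel (\<lambda>(x, y). a powr (1/\<alpha>) *\<^sub>R x + b powr (1/\<alpha>) *\<^sub>R y) =
        distr \<mu> borel (\<lambda>x. (a + b) powr (1/\<alpha>) *\<^sub>R x))"

locale symmetric_stable_levy_process = levy_process M X
  for M :: "'w measure" and X :: "real \<Rightarrow> 'w \<Rightarrow> 'a::euclidean_space" +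
  fixes \<alpha> :: real
  assumes stable_law: "symmetric_stable_law \<alpha> (distr M borel (X 1))"

(* h(K,u)^\<alpha> presupposes h(K,u) >= 0, i.e. that K contains the origin. This has to be required
   explicitly because powr is also defined for negative bases, as x powr a = \<bar>x\<bar> powr a; without
   it, a singleton {p} and the segment from -p to p could not be told apart. With it, K is
   determined by the law of X 1, and it is automatically an origin-symmetric zonoid if \<alpha> > 1. *)
definition associated_zonoid ::
    "'w measure \<Rightarrow> (real \<Rightarrow> 'w \<Rightarrow> 'a::euclidean_space) \<Rightarrow> real \<Rightarrow> 'a set \<Rightarrow> bool" where
  "associated_zonoid M X \<alpha> K \<longleftrightarrow>
     convex_body K \<and> (\<forall>u. 0 \<le> support_fun K u) \<and>
     (\<forall>u. \<forall>t\<ge>0. (CLINT \<omega>|M. iexp (X t \<omega> \<bullet> u)) =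
        complex_of_real (exp (- t * support_fun K u powr \<alpha>)))"

end

theory Submission
  imports Defs "HOL-Real_Asymp.Real_Asymp"
begin

text \<open>Let \<open>\<beta> = 1 / \<alpha>\<close>. For a vector \<open>\<eta>\<close>, the volume of \<open>Q + [0, s \<eta>]\<close> is affine in \<open>s \<ge> 0\<close>, so the expectation of
\<open>vol (Q + [0, \<eta>])\<close> depends on the law of \<open>\<eta>\<close> only through the expectation \<open>L\<close> of the random segment
\<open>[0, \<eta>]\<close>, which is a zonoid: it is \<open>vol Q\<close> plus the derivative at \<open>0\<close> of the polynomial
\<open>vol (Q + s L)\<close>. If the convex hull of a walk with steps \<open>y\<^sub>1, \<dots>, y\<^sub>n\<close> is written as the linear image of
the order simplex \<open>1 \<ge> t\<^sub>1 \<ge> \<dots> \<ge> t\<^sub>n \<ge> 0\<close>, the Euler relation for the faces of these simplices,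
summed over all orderings of the steps, expresses the volume of the hull of an \<open>n\<close>-step walk through
hulls of shorter walks plus a segment \<open>[0, y\<^sub>B]\<close>, where \<open>y\<^sub>B\<close> is a sum of some of the steps. For
independent stable steps, \<open>y\<^sub>B\<close> is distributed as \<open>|B|\<^sup>\<beta>\<close> times a step, and the recursion for the
expected volumes of \<open>hull + Q\<close> is solved by polynomials in \<open>L\<close> with the coefficients
\<open>[z\<^sup>n] (1 - z)\<^sup>-\<^sup>1 (\<Sum>k. k\<^sup>\<beta>\<^sup>-\<^sup>1 z\<^sup>k)\<^sup>j / j!\<close>, which grow like
\<open>n\<^sup>j\<^sup>\<beta> \<Gamma>(\<beta>)\<^sup>j / (j! \<Gamma>(j \<beta> + 1))\<close>. Scaling the steps by \<open>n\<^sup>-\<^sup>\<beta>\<close>, refining dyadic partitions of \<open>[0, 1]\<close>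
and comparing the coefficients of the polynomials \<open>vol (Z + s B)\<close> and \<open>vol (K + s B)\<close> for the ball \<open>B\<close>
gives the theorem; the constant \<open>\<Gamma>(1 - \<beta>) / \<pi>\<close> is the ratio of \<open>L\<close> to \<open>K\<close>, that is, half the
first absolute moment of a stable variable with scale \<open>1\<close>. That \<open>vol (K + s B)\<close> is a polynomial for every convex body \<open>K\<close> follows
from the same argument, a ball being the zonoid of a Gaussian vector.\<close>

subsection \<open>Volumes and support functions of convex bodies\<close>

text \<open>Where the coefficients come from: let \<open>F\<close> be the generating function of the
  expected volumes and \<open>D\<close> the derivative in the direction of \<open>L\<close>. The
  recursion says \<open>z F' = z / (1 - z) F + (\<Sum>k. k powr \<beta> z^k) D F\<close>, with
  solution \<open>F = (1 - z)^(-1) exp ((\<Sum>k. k powr (\<beta> - 1) z^k) D) vol Q\<close>; the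
  exponential series stops because volumes of dilated sums are polynomials of degree at most the
  dimension. Two obstacles shape the rest. Hausdorff-close bodies have close volumes, with an
  elementary bound, once they contain a fixed ball around the origin; so each hull is added to a
  body \<open>Q\<close> containing such a ball, and balls \<open>Q\<close> of varying radius recover
  all intrinsic volumes. Moreover, neither general position of the steps nor integrability is known
  in advance: the combinatorial identity is therefore proved pointwise for arbitrary vectors,
  integrability is carried along the recursion, and dyadic hulls increase, so that monotone
  convergence yields integrability together with the value.\<close>

abbreviation vol :: "'a::euclidean_space set \<Rightarrow> real" where
  "vol \<equiv> measure lborel"

abbreviation seg :: "'a::real_vector \<Rightarrow> 'a set" where
  "seg \<equiv> closed_segment 0"

abbreviation dil :: "real \<Rightarrow> 'a::real_vector set \<Rightarrow> 'a set" where
  "dil c \<equiv> (`) ((*\<^sub>R) c)"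

lemma convex_body_plus: "convex_body A \<Longrightarrow> convex_body B \<Longrightarrow> convex_body (A + B)"
proof -
  assume A: "convex_body A" and B: "convex_body B"
  have "A + B = {x + y | x y. x \<in> A \<and> y \<in> B}" by (auto simp: set_plus_def)
  then show ?thesis
    using A B compact_sums[of A B] convex_set_plus[of A B] by (auto simp: convex_body_def)
qed

lemma convex_body_seg [simp]: "convex_body (seg y)"
  by (simp add: convex_body_def)

lemma convex_body_zero [simp]: "convex_body {0}"
  by (simp add: convex_body_def)

lemma convex_body_cball [simp]: "0 \<le> r \<Longrightarrow> convex_body (cball x r)"
  by (simp add: convex_body_def)

lemma convex_body_dil: "convex_body L \<Longrightarrow> convex_body (dil c L)"
  by (auto simp: convex_body_def compact_scaling convex_scaling)

lemma convex_body_sum: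
  "(\<And>i. i \<in> I \<Longrightarrow> convex_body (S i)) \<Longrightarrow> convex_body (\<Sum>i\<in>I. S i)"
  by (induction I rule: infinite_finite_induct) (simp_all add: convex_body_plus)

lemma convex_body_fmeasurable: "convex_body A \<Longrightarrow> A \<in> fmeasurable lborel"
  by (simp add: convex_body_def fmeasurable_compact)

lemma convex_body_borel: "convex_body A \<Longrightarrow> A \<in> sets borel"
  by (simp add: convex_body_def borel_compact)

lemma vol_mono: "convex_body A \<Longrightarrow> convex_body B \<Longrightarrow> A \<subseteq> B \<Longrightarrow> vol A \<le> vol B"
  by (intro measure_mono_fmeasurable) (auto simp: convex_body_fmeasurable convex_body_borel)

lemma vol_dil:
  fixes A :: "'a::euclidean_space set"
  assumes "convex_body A" "0 \<le> c"
  shows "vol (dil c A) = c ^ DIM('a) * vol A"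
proof -
  have "measure lebesgue (dil c A) = \<bar>c\<bar> ^ DIM('a) * measure lebesgue A"
    using measure_lebesgue_affine[of c 0 A] by simp
  then show ?thesis
    using assms convex_body_borel[OF assms(1)] convex_body_borel[OF convex_body_dil[OF assms(1), of c]]
    by simp
qed

lemma vol_translation:
  fixes A :: "'a::euclidean_space set"
  assumes "convex_body A"
  shows "vol ((+) a ` A) = vol A"
proof -
  have "convex_body ((+) a ` A)"
    using assms by (auto simp: convex_body_def compact_translation)
  then show ?thesis
    using measure_translation[of a A] convex_body_borel assms
    by (simp add: convex_body_borel)
qed

lemma dil_plus: "dil c (A + B) = dil c A + dil c (B :: 'a::real_vector set)"
proof (intro equalityI subsetI)
  fix x assume "x \<in> dil c A + dil c B"
  then obtain a b where "a \<in> A" "b \<in> B" "x = c *\<^sub>R (a + b)"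
    by (auto simp: set_plus_def scaleR_add_right)
  then show "x \<in> dil c (A + B)" by blast
qed (use scaleR_add_right in \<open>fastforce simp: set_plus_def\<close>)

lemma dil_add:
  assumes "convex L" "0 \<le> a" "0 \<le> b"
  shows "dil (a + b) L = dil a L + dil b L"
proof (intro equalityI subsetI)
  fix x assume "x \<in> dil a L + dil b L"
  then obtain p q where pq: "p \<in> L" "q \<in> L" "x = a *\<^sub>R p + b *\<^sub>R q"
    by (auto simp: set_plus_def)
  show "x \<in> dil (a + b) L"
  proof (cases "a + b = 0")
    case True
    then have "a = 0" "b = 0" using assms by linarith+
    then show ?thesis using pq by auto
  next
    case False
    then have pos: "0 < a + b" using assms by simp
    have "(a / (a+b)) *\<^sub>R p + (b / (a+b)) *\<^sub>R q \<in> L"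
      using assms pq pos by (intro convexD) (simp_all flip: add_divide_distrib)
    moreover have "x = (a + b) *\<^sub>R ((a / (a+b)) *\<^sub>R p + (b / (a+b)) *\<^sub>R q)"
      using pos pq by (simp add: scaleR_add_right)
    ultimately show ?thesis by (intro image_eqI)
  qed
next
  fix x assume "x \<in> dil (a + b) L"
  then obtain p where p: "p \<in> L" "x = a *\<^sub>R p + b *\<^sub>R p" by (auto simp: scaleR_add_left)
  show "x \<in> dil a L + dil b L" unfolding p(2) using p(1) by (intro set_plus_intro imageI)
qed

lemma dil_zero: "L \<noteq> {} \<Longrightarrow> dil 0 L = 0"
  by auto

lemma dil_seg: "dil c (seg y) = seg (c *\<^sub>R y)"
  using closed_segment_linear_image[OF linear_scaleR[of c], of 0 y] by simp

lemma dil_cball_0: "0 < c \<Longrightarrow> dil c (cball 0 r :: 'a::euclidean_space set) = cball 0 (c * r)"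
  using cball_scale[of c 0 r] by simp

lemma mem_seg: "x \<in> seg y \<longleftrightarrow> (\<exists>u. 0 \<le> u \<and> u \<le> 1 \<and> x = u *\<^sub>R y)"
  by (auto simp: in_segment)

lemma mem_segE:
  assumes "x \<in> seg y"
  obtains u where "0 \<le> u" "u \<le> 1" "x = u *\<^sub>R y"
  using assms by (auto simp: in_segment)

lemma seg_scale_eq:
  assumes "0 \<le> a"
  shows "seg (a *\<^sub>R y) = {u *\<^sub>R y | u. 0 \<le> u \<and> u \<le> a}"
proof (intro equalityI subsetI)
  fix x assume "x \<in> {u *\<^sub>R y | u. 0 \<le> u \<and> u \<le> a}"
  then obtain u where u: "0 \<le> u" "u \<le> a" "x = u *\<^sub>R y" by blast
  have "0 \<le> u / a" "u / a \<le> 1" "x = (u / a) *\<^sub>R a *\<^sub>R y"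
    using u by (auto simp: divide_le_eq_1)
  then show "x \<in> seg (a *\<^sub>R y)" unfolding mem_seg by blast
next
  fix x assume "x \<in> seg (a *\<^sub>R y)"
  then obtain u where u: "0 \<le> u" "u \<le> 1" "x = u *\<^sub>R a *\<^sub>R y" unfolding mem_seg by blast
  have "0 \<le> u * a" "u * a \<le> a" "x = (u * a) *\<^sub>R y"
    using u assms by (simp_all add: mult_left_le_one_le)
  then show "x \<in> {u *\<^sub>R y | u. 0 \<le> u \<and> u \<le> a}" by blast
qed

lemma mem_plus_seg:
  "0 \<le> a \<Longrightarrow> z \<in> Q + seg (a *\<^sub>R y) \<longleftrightarrow> (\<exists>q\<in>Q. \<exists>v. 0 \<le> v \<and> v \<le> a \<and> z = q + v *\<^sub>R y)"
  by (simp only: seg_scale_eq set_plus_def) blast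

lemma cball_plus:
  assumes "0 \<le> a" "0 \<le> b"
  shows "cball 0 a + cball 0 b = (cball 0 (a + b) :: 'a::euclidean_space set)"
proof -
  have c: "cball 0 r = dil r (cball 0 1 :: 'a set)" if "0 \<le> r" for r
  proof (cases "r = 0")
    case True
    then show ?thesis using dil_zero[of "cball 0 1 :: 'a set"] by simp
  next
    case False
    then show ?thesis using that by (simp add: dil_cball_0)
  qed
  have "dil (a + b) (cball 0 1 :: 'a set) = dil a (cball 0 1) + dil b (cball 0 1)"
    using assms by (intro dil_add) auto
  then show ?thesis
    unfolding c[OF assms(1), symmetric] c[OF assms(2), symmetric]
      c[OF add_nonneg_nonneg[OF assms], symmetric] by (rule sym)
qed

text \<open>Along every line parallel to \<open>y\<close>, the two translated pieces of \<open>Q + [0, (a + b) y]\<close> are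
  intervals overlapping in a translate of \<open>Q\<close>.\<close>

lemma vol_seg_add:
  fixes Q :: "'a::euclidean_space set"
  assumes Q: "convex_body Q" and "0 \<le> a" "0 \<le> b"
  shows "vol (Q + seg ((a + b) *\<^sub>R y)) = vol (Q + seg (a *\<^sub>R y)) + vol (Q + seg (b *\<^sub>R y)) - vol Q"
proof -
  let ?T = "(+) (a *\<^sub>R y)"
  have ab: "0 \<le> a + b" using assms by simp
  note seg = mem_plus_seg[OF \<open>0 \<le> a\<close>] mem_plus_seg[OF \<open>0 \<le> b\<close>] mem_plus_seg[OF ab]
  have T: "z \<in> ?T ` S \<longleftrightarrow> z - a *\<^sub>R y \<in> S" for z S
    by (auto intro: image_eqI[of _ _ "z - a *\<^sub>R y"])
  have un: "Q + seg ((a + b) *\<^sub>R y) = (Q + seg (a *\<^sub>R y)) \<union> ?T ` (Q + seg (b *\<^sub>R y))"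
  proof (intro equalityI subsetI)
    fix z assume "z \<in> Q + seg ((a + b) *\<^sub>R y)"
    then obtain q v where v: "q \<in> Q" "0 \<le> v" "v \<le> a + b" "z = q + v *\<^sub>R y"
      unfolding seg by auto
    show "z \<in> (Q + seg (a *\<^sub>R y)) \<union> ?T ` (Q + seg (b *\<^sub>R y))"
    proof (cases "v \<le> a")
      case True
      then show ?thesis using v unfolding seg Un_iff by blast
    next
      case False
      have "z - a *\<^sub>R y = q + (v - a) *\<^sub>R y" "0 \<le> v - a" "v - a \<le> b"
        using v False by (simp_all add: algebra_simps)
      then have "z - a *\<^sub>R y \<in> Q + seg (b *\<^sub>R y)"
        unfolding seg by (intro bexI[OF _ v(1)] exI[of _ "v - a"]) simp
      then show ?thesis unfolding T Un_iff by blast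
    qed
  next
    fix z assume z: "z \<in> (Q + seg (a *\<^sub>R y)) \<union> ?T ` (Q + seg (b *\<^sub>R y))"
    then consider "z \<in> Q + seg (a *\<^sub>R y)" | "z - a *\<^sub>R y \<in> Q + seg (b *\<^sub>R y)" unfolding T Un_iff by blast
    then show "z \<in> Q + seg ((a + b) *\<^sub>R y)"
    proof cases
      case 1
      then obtain q v where "q \<in> Q" "0 \<le> v" "v \<le> a" "z = q + v *\<^sub>R y"
        unfolding seg by auto
      moreover have "v \<le> a + b" using calculation assms by simp
      ultimately show ?thesis unfolding seg by blast
    next
      case 2
      then obtain q v where v: "q \<in> Q" "0 \<le> v" "v \<le> b" "z - a *\<^sub>R y = q + v *\<^sub>R y"
        unfolding seg by auto
      have "z = q + (a + v) *\<^sub>R y" using v(4) by (simp add: algebra_simps)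
      moreover have "0 \<le> a + v" "a + v \<le> a + b" using v assms by simp_all
      ultimately show ?thesis unfolding seg by (intro bexI[OF _ v(1)] exI[of _ "a + v"]) simp
    qed
  qed
  have int: "(Q + seg (a *\<^sub>R y)) \<inter> ?T ` (Q + seg (b *\<^sub>R y)) = ?T ` Q"
  proof (intro equalityI subsetI)
    fix z assume "z \<in> (Q + seg (a *\<^sub>R y)) \<inter> ?T ` (Q + seg (b *\<^sub>R y))"
    then obtain q v q' v' where v: "q \<in> Q" "0 \<le> v" "v \<le> a" "z = q + v *\<^sub>R y"
      "q' \<in> Q" "0 \<le> v'" "v' \<le> b" "z - a *\<^sub>R y = q' + v' *\<^sub>R y"
      unfolding Int_iff T seg by blast
    show "z \<in> ?T ` Q" unfolding T
    proof (cases "v' + (a - v) = 0")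
      case True
      then have "v' = 0" using v by linarith
      then show "z - a *\<^sub>R y \<in> Q" using v by simp
    next
      case False
      define s where "s = v' + (a - v)"
      have s: "0 < s" using False v s_def by linarith
      have s1: "v' / s + (a - v) / s = 1" using s by (simp add: s_def flip: add_divide_distrib)
      \<comment> \<open>In the direction of \<open>y\<close>, the point \<open>q\<close> lies
        \<open>a - v\<close> ahead of \<open>z - a *\<^sub>R y\<close> and \<open>q'\<close> lies
        \<open>v'\<close> behind it. The crossed weights cancel the \<open>y\<close> components, so
        the combination is that point itself.\<close>
      have e: "(v' / s) *\<^sub>R q + ((a - v) / s) *\<^sub>R q' \<in> Q"
        using v s Q s1 by (intro convexD) (auto simp: convex_body_def)
      have combo: "A *\<^sub>R (w + c *\<^sub>R y) + B *\<^sub>R (w - v *\<^sub>R y) = (A + B) *\<^sub>R w + (A * c - B * v) *\<^sub>R y"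
        for A B c v and w :: 'a by (simp add: algebra_simps)
      have q: "q = (z - a *\<^sub>R y) + (a - v) *\<^sub>R y" "q' = (z - a *\<^sub>R y) - v' *\<^sub>R y"
        using v(4,8) by (simp_all add: algebra_simps)
      have "(v' / s) *\<^sub>R q + ((a - v) / s) *\<^sub>R q' = (v' / s + (a - v) / s) *\<^sub>R (z - a *\<^sub>R y)"
        by (subst q(1), subst q(2), subst combo) simp
      then show "z - a *\<^sub>R y \<in> Q" using e s1 by simp
    qed
  next
    fix z assume "z \<in> ?T ` Q"
    then have q: "z - a *\<^sub>R y \<in> Q" unfolding T .
    have "z = (z - a *\<^sub>R y) + a *\<^sub>R y" by simp
    then have "z \<in> Q + seg (a *\<^sub>R y)"
      using \<open>0 \<le> a\<close> unfolding seg by (intro bexI[OF _ q] exI[of _ a]) simp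
    moreover have "z - a *\<^sub>R y = (z - a *\<^sub>R y) + 0 *\<^sub>R y" by simp
    then have "z - a *\<^sub>R y \<in> Q + seg (b *\<^sub>R y)"
      using \<open>0 \<le> b\<close> unfolding seg by (intro bexI[OF _ q] exI[of _ 0]) simp
    ultimately show "z \<in> (Q + seg (a *\<^sub>R y)) \<inter> ?T ` (Q + seg (b *\<^sub>R y))" unfolding T Int_iff by blast
  qed
  have cb: "convex_body (Q + seg (c *\<^sub>R y))" for c using Q by (simp add: convex_body_plus)
  have cbT: "convex_body (?T ` (Q + seg (b *\<^sub>R y)))"
    using cb[of b] by (auto simp: convex_body_def compact_translation)
  show ?thesis unfolding un
    by (subst measure_Un3) (simp_all add: int vol_translation cb Q convex_body_fmeasurable cbT)
qed

text \<open>Cauchy's functional equation on the half-line: nonnegativity makes \<open>g\<close>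
  monotone, which squeezes \<open>g a\<close> between the values at the fractions
  \<open>k / n\<close> and \<open>(k + 1) / n\<close> enclosing \<open>a\<close>.\<close>

lemma additive_nonneg_imp_linear:
  fixes g :: "real \<Rightarrow> real"
  assumes add: "\<And>a b. 0 \<le> a \<Longrightarrow> 0 \<le> b \<Longrightarrow> g (a + b) = g a + g b"
    and nonneg: "\<And>a. 0 \<le> a \<Longrightarrow> 0 \<le> g a" and a: "0 \<le> a"
  shows "g a = a * g 1"
proof -
  have g0: "g 0 = 0" using add[of 0 0] by simp
  have mult: "g (real n * b) = real n * g b" if "0 \<le> b" for n b
    using that by (induction n) (auto simp: g0 add algebra_simps)
  have mono: "g x \<le> g y" if "0 \<le> x" "x \<le> y" for x y
    using add[of x "y - x"] nonneg[of "y - x"] that by simp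
  have frac: "g (real k / real n) = real k / real n * g 1" if "0 < n" for k n :: nat
  proof -
    have "real n * g (real k / real n) = real k * g 1"
      using mult[of "real k / real n" n] mult[of 1 k] that by simp
    then show ?thesis using that by (simp add: field_simps)
  qed
  have bd: "\<bar>g a - a * g 1\<bar> \<le> g 1 / real n" if "0 < n" for n :: nat
  proof -
    define k where "k = nat \<lfloor>real n * a\<rfloor>"
    have "0 \<le> real n * a" using a by simp
    then have k: "real k \<le> real n * a" "real n * a \<le> real k + 1"
      unfolding k_def by linarith+
    have k': "real k / real n \<le> a" "a \<le> (real (Suc k)) / real n"
      using k that by (simp_all add: field_simps)
    have l: "real k / real n * g 1 \<le> g a" using mono[OF _ k'(1)] frac[OF that, of k] by simp
    have u: "g a \<le> real (Suc k) / real n * g 1" using mono[OF a k'(2)] frac[OF that, of "Suc k"] by simp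
    have l': "real k / real n * g 1 \<le> a * g 1" by (rule mult_right_mono[OF k'(1)]) (simp add: nonneg)
    have u': "a * g 1 \<le> real (Suc k) / real n * g 1" by (rule mult_right_mono[OF k'(2)]) (simp add: nonneg)
    have "real (Suc k) / real n * g 1 = real k / real n * g 1 + g 1 / real n"
      using that by (simp add: field_simps)
    then show ?thesis using l u l' u' by linarith
  qed
  have "(\<lambda>n. g 1 / real n) \<longlonglongrightarrow> 0" by (rule lim_const_over_n)
  then have "\<bar>g a - a * g 1\<bar> \<le> 0"
    by (rule tendsto_lowerbound) (auto intro!: bd eventually_sequentiallyI[of 1])
  then show ?thesis by simp
qed

lemma subset_plus_seg: "Q \<subseteq> Q + seg y"
proof
  fix x assume "x \<in> Q"
  then have "x + 0 \<in> Q + seg y" by (intro set_plus_intro) auto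
  then show "x \<in> Q + seg y" by simp
qed

text \<open>By \<open>vol_seg_add\<close> the excess over \<open>vol Q\<close> is additive in the
  factor \<open>s\<close>; being nonnegative as well, it is linear.\<close>

lemma vol_seg_scale:
  fixes Q :: "'a::euclidean_space set"
  assumes Q: "convex_body Q" and "0 \<le> s"
  shows "vol (Q + seg (s *\<^sub>R y)) = vol Q + s * (vol (Q + seg y) - vol Q)"
proof -
  define g where "g s = vol (Q + seg (s *\<^sub>R y)) - vol Q" for s
  have "g s = s * g 1"
  proof (rule additive_nonneg_imp_linear)
    show "g (a + b) = g a + g b" if "0 \<le> a" "0 \<le> b" for a b
      using vol_seg_add[OF Q that] by (simp add: g_def)
    show "0 \<le> g a" if "0 \<le> a" for a
      using vol_mono[OF Q convex_body_plus[OF Q], of "seg (a *\<^sub>R y)"]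
        subset_plus_seg[of Q "a *\<^sub>R y"] by (simp add: g_def)
  qed fact
  then show ?thesis by (simp add: g_def)
qed

text \<open>A ball of radius \<open>e\<close> lies in \<open>dil (e / t) P\<close>, and dilates of a
  convex set add up. An additive Hausdorff error thus becomes a dilation, whose effect on the volume
  is explicit.\<close>

lemma convex_plus_cball_subset:
  fixes P :: "'a::euclidean_space set"
  assumes "convex P" "cball 0 t \<subseteq> P" "0 < t" "0 \<le> e"
  shows "P + cball 0 e \<subseteq> dil (1 + e / t) P"
proof -
  have "cball 0 e \<subseteq> dil (e / t) P"
  proof (cases "e = 0")
    case True
    have "0 \<in> P" using assms by auto
    then show ?thesis using True by auto
  next
    case False
    then have "cball 0 e = dil (e / t) (cball 0 t :: 'a set)"
      using assms by (subst dil_cball_0) auto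
    then show ?thesis using assms by blast
  qed
  then have "P + cball 0 e \<subseteq> dil 1 P + dil (e / t) P" by (intro set_plus_mono2) auto
  then show ?thesis using dil_add[of P 1 "e / t"] assms by simp
qed

lemma vol_hausdorff_le:
  fixes A B :: "'a::euclidean_space set"
  assumes A: "convex_body A" and B: "convex_body B" and sub: "A \<subseteq> B + cball 0 e"
    and t: "cball 0 t \<subseteq> B" "0 < t" and e: "0 \<le> e"
  shows "vol A \<le> (1 + e / t) ^ DIM('a) * vol B"
proof -
  have "B + cball 0 e \<subseteq> dil (1 + e / t) B"
    using convex_plus_cball_subset[of B t e] B t e by (simp add: convex_body_def)
  then have "vol A \<le> vol (dil (1 + e / t) B)"
    using A B sub by (intro vol_mono convex_body_dil) auto
  then show ?thesis using vol_dil[OF B, of "1 + e / t"] t e by simp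
qed

text \<open>Continuity of volume in the Hausdorff distance. The inner ball of common radius
  \<open>t\<close> makes \<open>vol_hausdorff_le\<close> applicable in both directions with the same
  factor, which tends to 1.\<close>

lemma tendsto_vol_hausdorff:
  fixes A :: "'b \<Rightarrow> 'a::euclidean_space set"
  assumes A: "\<forall>\<^sub>F x in F. convex_body (A x) \<and> cball 0 t \<subseteq> A x \<and> A x \<subseteq> B + cball 0 (e x) \<and> B \<subseteq> A x + cball 0 (e x) \<and> 0 \<le> e x"
    and B: "convex_body B" "cball 0 t \<subseteq> B" "0 < t" and e: "(e \<longlongrightarrow> 0) F"
  shows "((\<lambda>x. vol (A x)) \<longlongrightarrow> vol B) F"
proof (rule tendsto_sandwich)
  show "\<forall>\<^sub>F x in F. vol B / (1 + e x / t) ^ DIM('a) \<le> vol (A x)"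
    using A
  proof eventually_elim
    case (elim x)
    then have "vol B \<le> (1 + e x / t) ^ DIM('a) * vol (A x)"
      using B by (intro vol_hausdorff_le) auto
    moreover have "0 < (1 + e x / t) ^ DIM('a)" using elim B by (intro zero_less_power add_pos_nonneg) auto
    ultimately show ?case by (simp add: field_simps)
  qed
  show "\<forall>\<^sub>F x in F. vol (A x) \<le> (1 + e x / t) ^ DIM('a) * vol B"
    using A by eventually_elim (intro vol_hausdorff_le B; auto)
  have "((\<lambda>x. vol B / (1 + e x / t) ^ DIM('a)) \<longlongrightarrow> vol B / (1 + 0 / t) ^ DIM('a)) F"
    using B by (intro tendsto_intros e) auto
  then show "((\<lambda>x. vol B / (1 + e x / t) ^ DIM('a)) \<longlongrightarrow> vol B) F" by simp
  have "((\<lambda>x. (1 + e x / t) ^ DIM('a) * vol B) \<longlongrightarrow> (1 + 0 / t) ^ DIM('a) * vol B) F"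
    using B by (intro tendsto_intros e) auto
  then show "((\<lambda>x. (1 + e x / t) ^ DIM('a) * vol B) \<longlongrightarrow> vol B) F" by simp
qed

section \<open>Support functions and inclusion of convex bodies\<close>

lemma bdd_above_inner: "compact A \<Longrightarrow> bdd_above ((\<lambda>x. x \<bullet> u) ` A)" for u :: "'a::euclidean_space"
  by (intro bounded_imp_bdd_above compact_imp_bounded compact_continuous_image continuous_intros)

lemma inner_le_support_fun: "convex_body A \<Longrightarrow> x \<in> A \<Longrightarrow> x \<bullet> u \<le> support_fun A u"
  unfolding support_fun_def convex_body_def by (intro cSUP_upper bdd_above_inner) auto

lemma support_fun_le: "convex_body A \<Longrightarrow> (\<And>x. x \<in> A \<Longrightarrow> x \<bullet> u \<le> c) \<Longrightarrow> support_fun A u \<le> c"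
  unfolding support_fun_def convex_body_def by (intro cSUP_least) auto

lemma support_fun_eqI: "convex_body A \<Longrightarrow> (\<And>x. x \<in> A \<Longrightarrow> x \<bullet> u \<le> c) \<Longrightarrow> (\<exists>x\<in>A. x \<bullet> u = c) \<Longrightarrow> support_fun A u = c"
  by (metis antisym inner_le_support_fun support_fun_le)

lemma support_fun_attained: "convex_body A \<Longrightarrow> \<exists>x\<in>A. x \<bullet> u = support_fun A u"
proof -
  assume A: "convex_body A"
  have "continuous_on A (\<lambda>x. x \<bullet> u)" by (intro continuous_intros)
  then obtain x where "x \<in> A" "\<forall>y\<in>A. y \<bullet> u \<le> x \<bullet> u"
    using continuous_attains_sup[of A "\<lambda>x. x \<bullet> u"] A by (auto simp: convex_body_def)
  moreover have "support_fun A u = x \<bullet> u"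
    by (rule support_fun_eqI[OF A]) (use calculation in auto)
  ultimately show ?thesis by auto
qed

lemma support_fun_plus:
  assumes "convex_body A" "convex_body B"
  shows "support_fun (A + B) u = support_fun A u + support_fun B u"
proof (rule support_fun_eqI)
  show "convex_body (A + B)" by (simp add: assms convex_body_plus)
  show "x \<bullet> u \<le> support_fun A u + support_fun B u" if "x \<in> A + B" for x
    using that inner_le_support_fun assms by (fastforce simp: set_plus_def inner_add_left intro: add_mono)
  obtain a b where "a \<in> A" "a \<bullet> u = support_fun A u" "b \<in> B" "b \<bullet> u = support_fun B u"
    using assms support_fun_attained by blast
  then show "\<exists>x\<in>A + B. x \<bullet> u = support_fun A u + support_fun B u"
    by (intro bexI[of _ "a + b"]) (auto simp: inner_add_left)
qed

lemma support_fun_zero: "support_fun {0} u = 0"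
  by (rule support_fun_eqI) auto

lemma support_fun_sum:
  assumes "finite I" "\<And>i. i \<in> I \<Longrightarrow> convex_body (S i)"
  shows "support_fun (\<Sum>i\<in>I. S i) u = (\<Sum>i\<in>I. support_fun (S i) u)"
  using assms by (induction I rule: finite_induct)
    (simp_all add: support_fun_zero support_fun_plus convex_body_sum)

lemma support_fun_seg: "support_fun (seg y) u = max 0 (y \<bullet> u)"
proof (rule support_fun_eqI)
  show "x \<bullet> u \<le> max 0 (y \<bullet> u)" if x: "x \<in> seg y" for x
  proof -
    obtain v where v: "0 \<le> v" "v \<le> 1" "x = v *\<^sub>R y" using x by (rule mem_segE)
    show ?thesis
    proof (cases "0 \<le> y \<bullet> u")
      case True
      then show ?thesis using v by (simp add: mult_left_le_one_le max_def)
    next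
      case False
      then show ?thesis using v by (simp add: mult_nonneg_nonpos max_def)
    qed
  qed
  show "\<exists>x\<in>seg y. x \<bullet> u = max 0 (y \<bullet> u)"
    by (cases "0 \<le> y \<bullet> u") (auto simp: max_def intro: bexI[of _ y] bexI[of _ 0])
qed simp

lemma support_fun_dil:
  assumes "convex_body L" "0 \<le> c"
  shows "support_fun (dil c L) u = c * support_fun L u"
proof (rule support_fun_eqI)
  show "convex_body (dil c L)" by (simp add: assms convex_body_dil)
  show "x \<bullet> u \<le> c * support_fun L u" if "x \<in> dil c L" for x
    using that assms by (auto intro!: mult_left_mono inner_le_support_fun)
  show "\<exists>x\<in>dil c L. x \<bullet> u = c * support_fun L u"
    using support_fun_attained[OF assms(1), of u] by auto
qed

lemma support_fun_scale:
  assumes "0 \<le> c" "convex_body L"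
  shows "support_fun L (c *\<^sub>R u) = c * support_fun L u"
proof (rule support_fun_eqI)
  show "x \<bullet> c *\<^sub>R u \<le> c * support_fun L u" if "x \<in> L" for x
    using that assms by (auto intro!: mult_left_mono inner_le_support_fun)
  show "\<exists>x\<in>L. x \<bullet> c *\<^sub>R u = c * support_fun L u"
    using support_fun_attained[OF assms(2), of u] by auto
qed fact

lemma support_fun_cball:
  fixes u :: "'a::euclidean_space"
  assumes "0 \<le> r"
  shows "support_fun (cball 0 r) u = r * norm u"
proof (rule support_fun_eqI)
  show "convex_body (cball 0 r :: 'a set)" using assms by simp
  show "x \<bullet> u \<le> r * norm u" if "x \<in> cball 0 r" for x
  proof -
    have "x \<bullet> u \<le> norm x * norm u" by (rule norm_cauchy_schwarz)
    also have "\<dots> \<le> r * norm u" using that by (intro mult_right_mono) auto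
    finally show ?thesis .
  qed
  have "r / norm u * (u \<bullet> u) = r * norm u"
    by (cases "u = 0") (simp_all add: power2_norm_eq_inner[symmetric] power2_eq_square)
  moreover have "norm (r / norm u * norm u) \<le> r" using assms by (cases "u = 0") auto
  ultimately show "\<exists>x\<in>cball 0 r. x \<bullet> u = r * norm u"
    using assms by (intro bexI[of _ "(r / norm u) *\<^sub>R u"]) auto
qed

text \<open>A point of \<open>A\<close> outside \<open>B\<close> is cut off by a hyperplane. The
  comparison is made at \<open>- a\<close> because the separation theorem leaves \<open>B\<close> on
  the upper side.\<close>

lemma subset_of_support_fun_le:
  fixes A B :: "'a::euclidean_space set"
  assumes A: "convex_body A" and B: "convex_body B"
    and le: "\<And>u. support_fun A u \<le> support_fun B u"
  shows "A \<subseteq> B"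
proof (rule ccontr)
  assume "\<not> A \<subseteq> B"
  then obtain x where x: "x \<in> A" "x \<notin> B" by blast
  have "convex B" "closed B" using B by (simp_all add: convex_body_def compact_imp_closed)
  from separating_hyperplane_closed_point[OF this x(2)]
  obtain a b where ab: "a \<bullet> x < b" "\<forall>y\<in>B. b < a \<bullet> y" by blast
  obtain y where y: "y \<in> B" "y \<bullet> (- a) = support_fun B (- a)"
    using support_fun_attained[OF B] by blast
  have "a \<bullet> x < a \<bullet> y" using ab y(1) by (meson less_trans)
  then have "support_fun B (- a) < x \<bullet> (- a)" by (simp add: inner_commute flip: y(2))
  also have "\<dots> \<le> support_fun A (- a)" using inner_le_support_fun[OF A x(1)] .
  finally show False using le[of "- a"] by simp
qed

lemma subset_plus_cball_of_support_fun_le: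
  fixes A B :: "'a::euclidean_space set"
  assumes A: "convex_body A" and B: "convex_body B" and e: "0 \<le> e"
    and le: "\<And>u. support_fun A u \<le> support_fun B u + e * norm u"
  shows "A \<subseteq> B + cball 0 e"
  using assms by (intro subset_of_support_fun_le) (auto simp: convex_body_plus support_fun_plus support_fun_cball)

lemma set_plus_zero_right: "Q + {0} = (Q :: 'a::comm_monoid_add set)"
  by (auto simp: set_plus_def)

subsection \<open>Volumes of sums with zonoids\<close>

text \<open>The Lagrange basis for the nodes \<open>0, ..., d\<close>. It makes each coefficient of
  a polynomial of degree at most \<open>d\<close> a fixed linear combination of values, and so
  carries derivatives at 0 through limits and integrals.\<close>

definition interp_basis :: "nat \<Rightarrow> nat \<Rightarrow> real poly" where
  "interp_basis d i = (\<Prod>j\<in>{..d} - {i}. smult (1 / (real i - real j)) [:- real j, 1:])"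

lemma poly_interp_basis:
  assumes "i \<le> d" "k \<le> d"
  shows "poly (interp_basis d i) (real k) = (if k = i then 1 else 0)"
proof (cases "k = i")
  case True
  then show ?thesis
    by (auto simp: interp_basis_def poly_prod diff_divide_distrib[symmetric] intro!: prod.neutral)
next
  case False
  then have "\<exists>j\<in>{..d} - {i}. poly (smult (1 / (real i - real j)) [:- real j, 1:]) (real k) = 0"
    using assms by (intro bexI[of _ k]) auto
  then show ?thesis using False unfolding interp_basis_def poly_prod
    by (subst prod_zero) auto
qed

lemma degree_interp_basis:
  assumes "i \<le> d"
  shows "degree (interp_basis d i) \<le> d"
proof -
  have "degree (interp_basis d i) \<le> (\<Sum>j\<in>{..d} - {i}. degree (smult (1 / (real i - real j)) [:- real j, 1:]))"
    unfolding interp_basis_def by (rule order_trans[OF degree_prod_sum_le]) (auto simp: o_def)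
  also have "\<dots> \<le> (\<Sum>j\<in>{..d} - {i}. 1)" by (intro sum_mono) auto
  also have "\<dots> = d" using assms by simp
  finally show ?thesis .
qed

lemma interpolation:
  assumes "degree p \<le> d"
  shows "p = (\<Sum>i\<le>d. smult (poly p (real i)) (interp_basis d i))"
proof (rule poly_eqI_degree[where A = "real ` {..d}"])
  have card: "card (real ` {..d}) = d + 1" by (subst card_image) auto
  show "degree p < card (real ` {..d})" using assms card by simp
  have "degree (\<Sum>i\<le>d. smult (poly p (real i)) (interp_basis d i)) \<le> d"
    by (intro degree_sum_le) (auto intro: degree_interp_basis)
  then show "degree (\<Sum>i\<le>d. smult (poly p (real i)) (interp_basis d i)) < card (real ` {..d})"
    using card by simp
  fix x assume "x \<in> real ` {..d}"
  then obtain k where k: "k \<le> d" "x = real k" by auto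
  have "poly (\<Sum>i\<le>d. smult (poly p (real i)) (interp_basis d i)) x
      = (\<Sum>i\<le>d. if k = i then poly p (real i) else 0)"
    unfolding poly_sum k(2) by (intro sum.cong) (auto simp: poly_interp_basis k(1))
  then show "poly p x = poly (\<Sum>i\<le>d. smult (poly p (real i)) (interp_basis d i)) x"
    using k by simp
qed

lemma coeff_interpolation:
  assumes "degree p \<le> d"
  shows "coeff p k = (\<Sum>i\<le>d. coeff (interp_basis d i) k * poly p (real i))"
proof -
  have "coeff p k = coeff (\<Sum>i\<le>d. smult (poly p (real i)) (interp_basis d i)) k"
    using interpolation[OF assms] by simp
  then show ?thesis by (simp add: coeff_sum mult.commute)
qed

lemma poly_interpolation:
  assumes "degree p \<le> d"
  shows "poly p x = (\<Sum>i\<le>d. poly (interp_basis d i) x * poly p (real i))"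
proof -
  have "poly p x = poly (\<Sum>i\<le>d. smult (poly p (real i)) (interp_basis d i)) x"
    using interpolation[OF assms] by simp
  then show ?thesis by (simp add: poly_sum mult.commute)
qed

text \<open>With a common degree bound, the values at \<open>d + 1\<close> nodes determine all
  values and all coefficients by fixed linear formulas, so convergence at the nodes is passed on to
  both.\<close>

lemma tendsto_polynomial:
  fixes p :: "nat \<Rightarrow> real poly"
  assumes deg: "\<And>m. degree (p m) \<le> d"
    and lim: "\<And>s. 0 \<le> s \<Longrightarrow> (\<lambda>m. poly (p m) s) \<longlonglongrightarrow> v s"
  obtains q where "degree q \<le> d" "\<And>s. 0 \<le> s \<Longrightarrow> v s = poly q s" "\<And>k. (\<lambda>m. coeff (p m) k) \<longlonglongrightarrow> coeff q k"
proof
  define q where "q = (\<Sum>i\<le>d. smult (v (real i)) (interp_basis d i))"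
  show "degree q \<le> d" unfolding q_def
    by (intro degree_sum_le) (auto intro: degree_interp_basis)
  show "v s = poly q s" if "0 \<le> s" for s
  proof (rule LIMSEQ_unique[OF lim[OF that]])
    have "(\<lambda>m. \<Sum>i\<le>d. poly (interp_basis d i) s * poly (p m) (real i)) \<longlonglongrightarrow>
        (\<Sum>i\<le>d. poly (interp_basis d i) s * v (real i))"
      by (intro tendsto_intros lim) auto
    then have "(\<lambda>m. poly (p m) s) \<longlonglongrightarrow> (\<Sum>i\<le>d. poly (interp_basis d i) s * v (real i))"
      by (simp only: poly_interpolation[OF deg, symmetric])
    then show "(\<lambda>m. poly (p m) s) \<longlonglongrightarrow> poly q s"
      by (simp add: q_def poly_sum mult.commute)
  qed
  show "(\<lambda>m. coeff (p m) k) \<longlonglongrightarrow> coeff q k" for k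
  proof -
    have "(\<lambda>m. \<Sum>i\<le>d. coeff (interp_basis d i) k * poly (p m) (real i)) \<longlonglongrightarrow>
        (\<Sum>i\<le>d. coeff (interp_basis d i) k * v (real i))"
      by (intro tendsto_intros lim) auto
    then have "(\<lambda>m. coeff (p m) k) \<longlonglongrightarrow> (\<Sum>i\<le>d. coeff (interp_basis d i) k * v (real i))"
      by (simp only: coeff_interpolation[OF deg, symmetric])
    then show ?thesis
      by (simp add: q_def coeff_sum mult.commute)
  qed
qed

text \<open>If the degree exceeded \<open>d\<close>, the quotient of \<open>(1 + s) ^ d\<close> by
  the polynomial would tend to 0, against the bound with constant \<open>C\<close>.\<close>

lemma degree_le_of_growth:
  fixes p :: "real poly"
  assumes "\<And>s. 0 \<le> s \<Longrightarrow> \<bar>poly p s\<bar> \<le> C * (1 + s) ^ d"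
  shows "degree p \<le> d"
proof (rule ccontr)
  assume "\<not> degree p \<le> d"
  then have d: "degree ([:1, 1:] ^ d :: real poly) < degree p"
    by (simp add: degree_power_eq)
  have lim: "((\<lambda>s. poly ([:1, 1:] ^ d) s / poly p s) \<longlongrightarrow> 0) at_top"
    using poly_divide_tendsto_0_at_infinity[OF d] at_top_le_at_infinity
    by (rule filterlim_mono[OF _ order_refl])
  have C: "0 \<le> C" using assms[of 0] by (simp add: order_trans[OF abs_ge_zero])
  have "\<forall>\<^sub>F s in at_top. poly p s \<noteq> 0"
  proof (rule eventually_mono[OF eventually_gt_at_top])
    fix s assume s: "Max (insert 0 {s. poly p s = 0}) < s"
    have "finite {s. poly p s = 0}" using d by (intro poly_roots_finite) auto
    then show "poly p s \<noteq> 0" using s Max_ge[of "insert 0 {s. poly p s = 0}" s] by force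
  qed
  moreover have "\<forall>\<^sub>F s in at_top. (0::real) \<le> s" by (rule eventually_ge_at_top)
  moreover have "\<forall>\<^sub>F s in at_top. \<bar>poly ([:1, 1:] ^ d) s / poly p s\<bar> < 1 / (C + 1)"
    using tendstoD[OF lim, of "1 / (C + 1)"] C by (simp add: dist_real_def)
  ultimately have "\<forall>\<^sub>F s::real in at_top. False"
  proof eventually_elim
    case (elim s)
    have "(1 + s) ^ d / \<bar>poly p s\<bar> < 1 / (C + 1)"
      using elim by (simp add: poly_power add.commute)
    then have "(C + 1) * (1 + s) ^ d < \<bar>poly p s\<bar>"
      using elim C by (simp add: field_simps)
    then have "(C + 1) * (1 + s) ^ d < C * (1 + s) ^ d"
      using assms[of s] elim by linarith
    moreover have "0 < (1 + s) ^ d" using elim by simp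
    ultimately show False by (simp only: distrib_right mult_1)
  qed
  then show False by simp
qed

text \<open>Induction on the number of segments with \<open>Q\<close> arbitrary: by
  \<open>vol_seg_scale\<close>, one more segment turns \<open>p\<close> into
  \<open>p + s (q - p)\<close>, where \<open>q\<close> is the polynomial for
  \<open>Q + seg (f i)\<close>. Hence the linear coefficient is additive over the segments, the
  discrete form of linearity of expectation.\<close>

lemma zonotope_polynomial:
  assumes "finite I" "convex_body Q"
  shows "\<exists>p. (\<forall>s\<ge>0. vol (Q + (\<Sum>i\<in>I. seg (s *\<^sub>R f i))) = poly p s) \<and>
    coeff p 1 = (\<Sum>i\<in>I. vol (Q + seg (f i)) - vol Q)"
  using assms
proof (induction I arbitrary: Q rule: finite_induct)
  case empty
  then show ?case by (intro exI[of _ "[:vol Q:]"]) (auto simp: set_plus_zero_right)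
next
  case (insert i I)
  obtain p where p: "\<And>s. 0 \<le> s \<Longrightarrow> vol (Q + (\<Sum>i\<in>I. seg (s *\<^sub>R f i))) = poly p s"
    "coeff p 1 = (\<Sum>i\<in>I. vol (Q + seg (f i)) - vol Q)"
    using insert.IH[OF insert.prems] by blast
  have Q': "convex_body (Q + seg (f i))" using insert.prems by (simp add: convex_body_plus)
  obtain q where q: "\<And>s. 0 \<le> s \<Longrightarrow> vol (Q + seg (f i) + (\<Sum>i\<in>I. seg (s *\<^sub>R f i))) = poly q s"
    using insert.IH[OF Q'] by blast
  show ?case
  proof (intro exI[of _ "p + pCons 0 (q - p)"] conjI allI impI)
    fix s :: real assume s: "0 \<le> s"
    let ?S = "\<Sum>i\<in>I. seg (s *\<^sub>R f i)"
    have cb: "convex_body (Q + ?S)" using insert.prems by (intro convex_body_plus convex_body_sum) auto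
    have "Q + (\<Sum>i\<in>insert i I. seg (s *\<^sub>R f i)) = Q + ?S + seg (s *\<^sub>R f i)"
      using insert.hyps by (simp add: ac_simps)
    then have "vol (Q + (\<Sum>i\<in>insert i I. seg (s *\<^sub>R f i))) =
        vol (Q + ?S) + s * (vol (Q + ?S + seg (f i)) - vol (Q + ?S))"
      using vol_seg_scale[OF cb s] by simp
    also have "Q + ?S + seg (f i) = Q + seg (f i) + ?S" by (simp add: ac_simps)
    finally show "vol (Q + (\<Sum>i\<in>insert i I. seg (s *\<^sub>R f i))) = poly (p + pCons 0 (q - p)) s"
      using p(1)[OF s] q[OF s] by simp
  next
    have z: "(\<Sum>i\<in>I. {0::'b}) = {0}"
      by (induction I rule: infinite_finite_induct) (auto simp: set_plus_zero_right)
    have "coeff p 0 = vol Q" "coeff q 0 = vol (Q + seg (f i))"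
      using p(1)[of 0] q[of 0] by (simp_all add: z set_plus_zero_right poly_0_coeff_0)
    then show "coeff (p + pCons 0 (q - p)) 1 = (\<Sum>i\<in>insert i I. vol (Q + seg (f i)) - vol Q)"
      using insert.hyps p(2) by simp
  qed
qed

section \<open>Growth and continuity of the volume of sums\<close>

lemma convex_body_subset_cball: "convex_body A \<Longrightarrow> \<exists>R\<ge>0. A \<subseteq> cball 0 R"
proof -
  assume "convex_body A"
  then have "bounded A" by (simp add: convex_body_def compact_imp_bounded)
  then show ?thesis by (auto simp: bounded_pos intro: less_imp_le)
qed

lemma dil_mono: "A \<subseteq> B \<Longrightarrow> dil s A \<subseteq> dil s B"
  by (rule image_mono)

lemma dil_sum_seg:
  fixes f :: "'i \<Rightarrow> 'a::euclidean_space"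
  shows "dil s (\<Sum>i\<in>I. seg (f i)) = (\<Sum>i\<in>I. seg (s *\<^sub>R f i))"
  by (induction I rule: infinite_finite_induct) (simp_all add: dil_plus dil_seg)

text \<open>Supplies the bound for \<open>degree_le_of_growth\<close>. The construction in
  \<open>zonotope_polynomial\<close> alone would bound the degree only by the number of segments,
  which is useless for limits of zonotopes.\<close>

lemma vol_plus_dil_growth:
  fixes Q L :: "'a::euclidean_space set"
  assumes "convex_body Q" "convex_body L"
  shows "\<exists>C\<ge>0. \<forall>s\<ge>0. vol (Q + dil s L) \<le> C * (1 + s) ^ DIM('a)"
proof -
  obtain R R' where R: "0 \<le> R" "Q \<subseteq> cball 0 R" "0 \<le> R'" "L \<subseteq> cball 0 R'"
    using convex_body_subset_cball assms by metis
  define r where "r = max R R'"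
  have r: "0 \<le> r" "Q \<subseteq> cball 0 r" "L \<subseteq> cball 0 r"
    using R unfolding r_def by (auto intro: order_trans)
  have "vol (Q + dil s L) \<le> vol (cball 0 r :: 'a set) * (1 + s) ^ DIM('a)" if s: "0 \<le> s" for s
  proof -
    have "Q + dil s L \<subseteq> dil 1 (cball 0 r) + dil s (cball 0 r)"
      using r by (intro set_plus_mono2 dil_mono) auto
    also have "\<dots> = dil (1 + s) (cball 0 r)" using s by (intro dil_add[symmetric]) auto
    finally have "vol (Q + dil s L) \<le> vol (dil (1 + s) (cball 0 r :: 'a set))"
      using assms r by (intro vol_mono convex_body_plus convex_body_dil) auto
    also have "\<dots> = (1 + s) ^ DIM('a) * vol (cball 0 r :: 'a set)" using r s by (intro vol_dil) auto
    finally show ?thesis by (simp add: mult.commute)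
  qed
  then show ?thesis by (intro exI[of _ "vol (cball 0 r :: 'a set)"]) auto
qed

lemma seg_subset_plus_cball: "seg y \<subseteq> seg z + cball 0 (dist y z)" for y z :: "'a::euclidean_space"
proof (rule subset_plus_cball_of_support_fun_le)
  show "support_fun (seg y) u \<le> support_fun (seg z) u + dist y z * norm u" for u
    using Cauchy_Schwarz_ineq2[of "y - z" u] by (auto simp: support_fun_seg dist_norm inner_diff_left)
qed auto

lemma set_plus_mono_left: "A \<subseteq> B + C \<Longrightarrow> Q + A \<subseteq> Q + B + C" for Q :: "'a::comm_monoid_add set"
  by (simp add: set_plus_mono2 add.assoc)

lemma zero_mem_seg [simp]: "0 \<in> seg y" by simp

lemma subset_plus_left: "0 \<in> B \<Longrightarrow> Q \<subseteq> A \<Longrightarrow> Q \<subseteq> A + B" for Q :: "'a::comm_monoid_add set"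
  using set_plus_intro[of _ A 0 B] by auto

lemma continuous_vol_seg:
  fixes Q :: "'a::euclidean_space set"
  assumes "convex_body Q" "cball 0 t \<subseteq> Q" "0 < t"
  shows "continuous_on UNIV (\<lambda>y. vol (Q + seg y))"
proof (rule continuous_at_imp_continuous_on, rule ballI)
  fix z :: 'a
  have "((\<lambda>y. vol (Q + seg y)) \<longlongrightarrow> vol (Q + seg z)) (at z)"
  proof (rule tendsto_vol_hausdorff[where e = "\<lambda>y. dist y z" and t = t])
    show "\<forall>\<^sub>F y in at z. convex_body (Q + seg y) \<and> cball 0 t \<subseteq> Q + seg y \<and>
        Q + seg y \<subseteq> Q + seg z + cball 0 (dist y z) \<and> Q + seg z \<subseteq> Q + seg y + cball 0 (dist y z) \<and> 0 \<le> dist y z"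
    proof (intro always_eventually allI conjI)
      fix y
      show "Q + seg y \<subseteq> Q + seg z + cball 0 (dist y z)" "Q + seg z \<subseteq> Q + seg y + cball 0 (dist y z)"
        using seg_subset_plus_cball[of y z] seg_subset_plus_cball[of z y]
        by (auto intro!: set_plus_mono_left simp: dist_commute simp del: subsetI)
    qed (intro convex_body_plus subset_plus_left assms convex_body_seg zero_mem_seg zero_le_dist)+
    show "((\<lambda>y. dist y z) \<longlongrightarrow> 0) (at z)"
      using tendsto_dist[OF tendsto_ident_at[of z UNIV] tendsto_const[of z]] by simp
  qed (intro convex_body_plus subset_plus_left assms convex_body_seg zero_mem_seg)+
  then show "isCont (\<lambda>y. vol (Q + seg y)) z" by (simp add: isCont_def)
qed

text \<open>Affine dependence on the length reduces the claim to a unit vector. Growth linear in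
  \<open>norm y\<close> is what lets an integrable vector dominate the volumes.\<close>

lemma vol_seg_le:
  fixes Q :: "'a::euclidean_space set"
  assumes "convex_body Q"
  shows "vol (Q + seg y) \<le> vol Q + norm y * vol (Q + cball 0 1)"
proof (cases "y = 0")
  case True
  then show ?thesis by (simp add: set_plus_zero_right)
next
  case False
  define z where "z = (1 / norm y) *\<^sub>R y"
  have y: "y = norm y *\<^sub>R z" using False by (simp add: z_def)
  have "norm z = 1" using False by (simp add: z_def)
  then have "seg z \<subseteq> cball 0 1" by (intro closed_segment_subset) auto
  then have "vol (Q + seg z) \<le> vol (Q + cball 0 1)"
    using assms by (intro vol_mono convex_body_plus set_plus_mono2) auto
  then have "norm y * (vol (Q + seg z) - vol Q) \<le> norm y * vol (Q + cball 0 1)"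
    by (intro mult_left_mono) (auto simp: le_diff_eq intro: order_trans[OF diff_le_self] measure_nonneg
      simp: algebra_simps add_increasing)
  moreover have "vol (Q + seg y) = vol Q + norm y * (vol (Q + seg z) - vol Q)"
    by (subst y) (rule vol_seg_scale[OF assms], simp)
  ultimately show ?thesis by simp
qed

lemma integral_simple_function_compose:
  fixes g :: "'b \<Rightarrow> real"
  assumes "prob_space N" "simple_function N F"
  shows "(\<integral>x. g (F x) \<partial>N) = (\<Sum>w\<in>F ` space N. measure N (F -` {w} \<inter> space N) * g w)"
proof -
  interpret prob_space N by fact
  have fin: "finite (F ` space N)" and meas: "\<And>w. w \<in> F ` space N \<Longrightarrow> F -` {w} \<inter> space N \<in> sets N"
    using assms(2) by (auto simp: simple_function_def)
  have "(\<integral>x. g (F x) \<partial>N) = (\<integral>x. (\<Sum>w\<in>F ` space N. indicator (F -` {w} \<inter> space N) x * g w) \<partial>N)"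
  proof (rule Bochner_Integration.integral_cong)
    fix x assume x: "x \<in> space N"
    have "(\<Sum>w\<in>F ` space N. indicator (F -` {w} \<inter> space N) x * g w) = (\<Sum>w\<in>F ` space N. if w = F x then g w else 0)"
      using x by (intro sum.cong) (auto simp: indicator_def)
    also have "\<dots> = g (F x)" using x fin by (subst sum.delta) auto
    finally show "g (F x) = (\<Sum>w\<in>F ` space N. indicator (F -` {w} \<inter> space N) x * g w)" ..
  qed simp
  also have "\<dots> = (\<Sum>w\<in>F ` space N. \<integral>x. indicator (F -` {w} \<inter> space N) x * g w \<partial>N)"
    by (rule Bochner_Integration.integral_sum) (auto intro!: meas integrable_mult_left integrable_real_indicator simp: emeasure_eq_measure)
  also have "\<dots> = (\<Sum>w\<in>F ` space N. measure N (F -` {w} \<inter> space N) * g w)"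
    by (intro sum.cong) (auto simp: meas)
  finally show ?thesis .
qed

text \<open>The expectation of the random segment \<open>seg (\<eta> x)\<close>, encoded by its
  support function: \<open>max 0 (\<eta> x \<bullet> u)\<close> is the support function of that
  segment.\<close>

definition zonoid_of :: "'w measure \<Rightarrow> ('w \<Rightarrow> 'a::euclidean_space) \<Rightarrow> 'a set \<Rightarrow> bool" where
  "zonoid_of N \<eta> L \<longleftrightarrow> prob_space N \<and> integrable N \<eta> \<and> convex_body L \<and>
     (\<forall>u. support_fun L u = (\<integral>x. max 0 (\<eta> x \<bullet> u) \<partial>N))"

text \<open>For simple \<open>\<eta>\<close> the body is a zonotope and
  \<open>zonotope_polynomial\<close> gives the claim. In general \<open>\<eta>\<close> is
  approximated in the mean by simple functions; polynomials, linear coefficients and expectations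
  all converge.\<close>

lemma vol_zonoid_of:
  fixes L Q :: "'a::euclidean_space set"
  assumes z: "zonoid_of N \<eta> L" and Q: "convex_body Q" "cball 0 t \<subseteq> Q" "0 < t"
  obtains p where "degree p \<le> DIM('a)" "\<And>s. 0 \<le> s \<Longrightarrow> vol (Q + dil s L) = poly p s"
    "integrable N (\<lambda>x. vol (Q + seg (\<eta> x)))" "(\<integral>x. vol (Q + seg (\<eta> x)) \<partial>N) = vol Q + coeff p 1"
proof -
  interpret prob_space N using z by (simp add: zonoid_of_def)
  have \<eta>: "integrable N \<eta>" and L: "convex_body L"
    and hL: "\<And>u. support_fun L u = (\<integral>x. max 0 (\<eta> x \<bullet> u) \<partial>N)"
    using z by (auto simp: zonoid_of_def)
  have [measurable]: "\<eta> \<in> borel_measurable N" using \<eta> by auto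
  have "\<exists>F. (\<forall>m. simple_function N (F m)) \<and> (\<forall>x\<in>space N. (\<lambda>m. F m x) \<longlonglongrightarrow> \<eta> x) \<and>
      (\<forall>m. \<forall>x\<in>space N. dist (F m x) 0 \<le> 2 * dist (\<eta> x) 0)"
    by (rule borel_measurable_implies_sequence_metric) measurable
  then obtain F where F: "\<And>m. simple_function N (F m)" "\<And>x. x \<in> space N \<Longrightarrow> (\<lambda>m. F m x) \<longlonglongrightarrow> \<eta> x"
    "\<And>m x. x \<in> space N \<Longrightarrow> norm (F m x) \<le> 2 * norm (\<eta> x)"
    by (metis norm_conv_dist)
  have [measurable]: "\<And>m. F m \<in> borel_measurable N" using F(1) by (rule borel_measurable_simple_function)
  have bd2: "integrable N (\<lambda>x. 2 * norm (\<eta> x))" "integrable N (\<lambda>x. 3 * norm (\<eta> x))"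
    using \<eta> by auto
  have Fint: "integrable N (F m)" for m
    by (rule Bochner_Integration.integrable_bound[OF bd2(1)]) (auto intro!: AE_I2 F(3))
  define P where "P m w = measure N (F m -` {w} \<inter> space N)" for m w
  \<comment> \<open>Each value \<open>w\<close> of \<open>F m\<close> contributes its segment shrunk
    by the probability of \<open>w\<close>, so \<open>Z m\<close> is exactly the expected segment of
    \<open>F m\<close>. Its Hausdorff distance from \<open>L\<close> is at most the mean distance
    \<open>e m\<close>.\<close>
  define Z where "Z m = (\<Sum>w\<in>F m ` space N. seg (P m w *\<^sub>R w))" for m
  define e where "e m = (\<integral>x. norm (F m x - \<eta> x) \<partial>N)" for m
  have fin: "finite (F m ` space N)" for m using F(1) by (simp add: simple_function_def)
  have Z: "convex_body (Z m)" for m unfolding Z_def by (intro convex_body_sum) simp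
  have e0: "0 \<le> e m" for m by (simp add: e_def)
  have "(\<lambda>m. \<integral>x. norm (F m x - \<eta> x) \<partial>N) \<longlonglongrightarrow> (\<integral>x. 0 \<partial>N)"
  proof (rule integral_dominated_convergence[where w = "\<lambda>x. 3 * norm (\<eta> x)"])
    show "AE x in N. (\<lambda>m. norm (F m x - \<eta> x)) \<longlonglongrightarrow> 0"
      using F(2) by (intro AE_I2) (simp add: LIM_zero_iff tendsto_norm_zero)
    show "AE x in N. norm (norm (F m x - \<eta> x)) \<le> 3 * norm (\<eta> x)" for m
    proof (rule AE_I2)
      fix x assume "x \<in> space N"
      then show "norm (norm (F m x - \<eta> x)) \<le> 3 * norm (\<eta> x)"
        using norm_triangle_ineq4[of "F m x" "\<eta> x"] F(3)[of x m] by simp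
    qed
  qed (use bd2 in auto)
  then have elim: "e \<longlonglongrightarrow> 0" unfolding e_def by simp
  have hZ: "support_fun (Z m) u = (\<integral>x. max 0 (F m x \<bullet> u) \<partial>N)" for m u
  proof -
    have "support_fun (Z m) u = (\<Sum>w\<in>F m ` space N. P m w * max 0 (w \<bullet> u))"
      unfolding Z_def using fin
      by (subst support_fun_sum) (auto simp: support_fun_seg max_mult_distrib_left P_def intro!: sum.cong)
    also have "\<dots> = (\<integral>x. max 0 (F m x \<bullet> u) \<partial>N)"
      using integral_simple_function_compose[OF prob_space_axioms F(1), of "\<lambda>w. max 0 (w \<bullet> u)"]
      by (simp add: P_def)
    finally show ?thesis .
  qed
  have close: "\<bar>support_fun (Z m) u - support_fun L u\<bar> \<le> e m * norm u" for m u
  proof -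
    have i: "integrable N (\<lambda>x. max 0 (F m x \<bullet> u))" "integrable N (\<lambda>x. max 0 (\<eta> x \<bullet> u))"
      using Fint \<eta> by (auto intro!: Bochner_Integration.integrable_max)
    have "support_fun (Z m) u - support_fun L u = (\<integral>x. max 0 (F m x \<bullet> u) - max 0 (\<eta> x \<bullet> u) \<partial>N)"
      using i by (simp add: hZ hL)
    also have "\<bar>\<dots>\<bar> \<le> (\<integral>x. norm (max 0 (F m x \<bullet> u) - max 0 (\<eta> x \<bullet> u)) \<partial>N)"
      using integral_norm_bound[of N "\<lambda>x. max 0 (F m x \<bullet> u) - max 0 (\<eta> x \<bullet> u)"] by simp
    also have "\<dots> \<le> (\<integral>x. norm (F m x - \<eta> x) * norm u \<partial>N)"
    proof (rule integral_mono)
      show "norm (max 0 (F m x \<bullet> u) - max 0 (\<eta> x \<bullet> u)) \<le> norm (F m x - \<eta> x) * norm u" for x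
        using Cauchy_Schwarz_ineq2[of "F m x - \<eta> x" u] by (auto simp: inner_diff_left max_def)
    qed (use i Fint \<eta> in auto)
    also have "\<dots> = e m * norm u" by (simp add: e_def)
    finally show ?thesis .
  qed
  have lim: "(\<lambda>m. vol (Q + dil s (Z m))) \<longlonglongrightarrow> vol (Q + dil s L)" if s: "0 \<le> s" for s
  proof (rule tendsto_vol_hausdorff[where e = "\<lambda>m. s * e m" and t = t])
    have 1: "dil s (Z m) \<subseteq> dil s L + cball 0 (s * e m)" "dil s L \<subseteq> dil s (Z m) + cball 0 (s * e m)" for m
    proof -
      have "s * support_fun (Z m) u \<le> s * support_fun L u + s * e m * norm u"
        "s * support_fun L u \<le> s * support_fun (Z m) u + s * e m * norm u" for u
      proof -
        have "s * support_fun (Z m) u \<le> s * (support_fun L u + e m * norm u)"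
          "s * support_fun L u \<le> s * (support_fun (Z m) u + e m * norm u)"
          using close[of m u] s by (auto intro!: mult_left_mono)
        then show "s * support_fun (Z m) u \<le> s * support_fun L u + s * e m * norm u"
          "s * support_fun L u \<le> s * support_fun (Z m) u + s * e m * norm u" by (simp_all add: algebra_simps)
      qed
      then show "dil s (Z m) \<subseteq> dil s L + cball 0 (s * e m)" "dil s L \<subseteq> dil s (Z m) + cball 0 (s * e m)"
        by (intro subset_plus_cball_of_support_fun_le convex_body_dil Z L mult_nonneg_nonneg s e0;
            simp add: support_fun_dil Z L s)+
    qed
    have 0: "0 \<in> dil s (Z m)" for m
    proof -
      have "{0} \<subseteq> Z m"
        by (rule subset_of_support_fun_le) (auto simp: Z support_fun_zero hZ)
      then show ?thesis by (auto intro: image_eqI[of _ _ 0])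
    qed
    show "\<forall>\<^sub>F m in sequentially. convex_body (Q + dil s (Z m)) \<and> cball 0 t \<subseteq> Q + dil s (Z m) \<and>
        Q + dil s (Z m) \<subseteq> Q + dil s L + cball 0 (s * e m) \<and>
        Q + dil s L \<subseteq> Q + dil s (Z m) + cball 0 (s * e m) \<and> 0 \<le> s * e m"
      by (intro always_eventually allI conjI convex_body_plus set_plus_mono_left[OF 1(1)]
        set_plus_mono_left[OF 1(2)] subset_plus_left[OF 0] convex_body_dil Q Z mult_nonneg_nonneg s e0)
    have "{0} \<subseteq> L"
      by (rule subset_of_support_fun_le) (auto simp: L support_fun_zero hL)
    then have "0 \<in> dil s L" by (auto intro: image_eqI[of _ _ 0])
    then show "cball 0 t \<subseteq> Q + dil s L" by (intro subset_plus_left Q)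
    show "(\<lambda>m. s * e m) \<longlonglongrightarrow> 0" using tendsto_mult_left[OF elim, of s] by simp
  qed (use Q L in \<open>auto intro: convex_body_plus convex_body_dil\<close>)
  have "\<exists>p. (\<forall>s\<ge>0. vol (Q + dil s (Z m)) = poly p s) \<and>
      coeff p 1 = (\<Sum>w\<in>F m ` space N. vol (Q + seg (P m w *\<^sub>R w)) - vol Q)" for m
    using zonotope_polynomial[OF fin[of m] Q(1), where f = "\<lambda>w. P m w *\<^sub>R w"] by (simp add: Z_def dil_sum_seg)
  then obtain p where p: "\<And>m s. 0 \<le> s \<Longrightarrow> vol (Q + dil s (Z m)) = poly (p m) s"
    "\<And>m. coeff (p m) 1 = (\<Sum>w\<in>F m ` space N. vol (Q + seg (P m w *\<^sub>R w)) - vol Q)"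
    by metis
  \<comment> \<open>A degree bound independent of \<open>m\<close>, although the number of segments
    of \<open>Z m\<close> may grow.\<close>
  have deg: "degree (p m) \<le> DIM('a)" for m
  proof -
    obtain C where "\<And>s. 0 \<le> s \<Longrightarrow> vol (Q + dil s (Z m)) \<le> C * (1 + s) ^ DIM('a)"
      using vol_plus_dil_growth[OF Q(1) Z] by blast
    then show ?thesis
      by (intro degree_le_of_growth[where C = C]) (simp add: measure_nonneg flip: p(1))
  qed
  have lim2: "(\<lambda>m. poly (p m) s) \<longlonglongrightarrow> vol (Q + dil s L)" if "0 \<le> s" for s
    using lim[OF that] that by (simp add: p(1))
  obtain q where q: "degree q \<le> DIM('a)" "\<And>s. 0 \<le> s \<Longrightarrow> vol (Q + dil s L) = poly q s"
    "\<And>k. (\<lambda>m. coeff (p m) k) \<longlonglongrightarrow> coeff q k"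
    using tendsto_polynomial[OF deg lim2] by blast
  have [measurable]: "(\<lambda>y. vol (Q + seg y)) \<in> borel_measurable borel"
    using continuous_vol_seg[OF Q] by (rule borel_measurable_continuous_onI)
  let ?w = "\<lambda>x. vol Q + 2 * norm (\<eta> x) * vol (Q + cball 0 1)"
  have wint: "integrable N ?w" using \<eta> by auto
  \<comment> \<open>\<open>vol_seg_scale\<close> pulls the probabilities out of the segments, so the
    sum over values becomes an expectation.\<close>
  have coeff1: "coeff (p m) 1 = (\<integral>x. vol (Q + seg (F m x)) \<partial>N) - vol Q" for m
  proof -
    have "coeff (p m) 1 = (\<Sum>w\<in>F m ` space N. P m w * (vol (Q + seg w) - vol Q))"
      unfolding p(2) using vol_seg_scale[OF Q(1)] by (intro sum.cong) (auto simp: P_def)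
    also have "\<dots> = (\<integral>x. vol (Q + seg (F m x)) - vol Q \<partial>N)"
      using integral_simple_function_compose[OF prob_space_axioms F(1), of "\<lambda>w. vol (Q + seg w) - vol Q"]
      by (simp add: P_def)
    also have "\<dots> = (\<integral>x. vol (Q + seg (F m x)) \<partial>N) - vol Q"
    proof (subst Bochner_Integration.integral_diff)
      show "integrable N (\<lambda>x. vol (Q + seg (F m x)))"
      proof (rule Bochner_Integration.integrable_bound[OF wint])
        show "AE x in N. norm (vol (Q + seg (F m x))) \<le> norm (?w x)"
        proof (rule AE_I2)
          fix x assume "x \<in> space N"
          then show "norm (vol (Q + seg (F m x))) \<le> norm (?w x)"
            using vol_seg_le[OF Q(1), of "F m x"] mult_right_mono[OF F(3)[of x m], of "vol (Q + cball 0 1)"] by simp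
        qed
      qed measurable
    qed (auto simp: prob_space)
    finally show ?thesis .
  qed
  have lim': "AE x in N. (\<lambda>m. vol (Q + seg (F m x))) \<longlonglongrightarrow> vol (Q + seg (\<eta> x))"
    using F(2) by (intro AE_I2 continuous_on_tendsto_compose[OF continuous_vol_seg[OF Q]]) auto
  have bd': "AE x in N. norm (vol (Q + seg (F m x))) \<le> ?w x" for m
  proof (rule AE_I2)
    fix x assume "x \<in> space N"
    then show "norm (vol (Q + seg (F m x))) \<le> ?w x"
      using vol_seg_le[OF Q(1), of "F m x"] mult_right_mono[OF F(3)[of x m], of "vol (Q + cball 0 1)"] by simp
  qed
  have "integrable N (\<lambda>x. vol (Q + seg (\<eta> x)))"
    by (rule integrable_dominated_convergence[OF _ _ wint lim' bd']) measurable
  moreover have "(\<lambda>m. \<integral>x. vol (Q + seg (F m x)) \<partial>N) \<longlonglongrightarrow> (\<integral>x. vol (Q + seg (\<eta> x)) \<partial>N)"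
    by (rule integral_dominated_convergence[OF _ _ wint lim' bd']) measurable
  then have "(\<lambda>m. coeff (p m) 1) \<longlonglongrightarrow> (\<integral>x. vol (Q + seg (\<eta> x)) \<partial>N) - vol Q"
    unfolding coeff1 by (intro tendsto_intros)
  then have "(\<integral>x. vol (Q + seg (\<eta> x)) \<partial>N) - vol Q = coeff q 1"
    using q(3) LIMSEQ_unique by blast
  ultimately show ?thesis using that q by fastforce
qed

subsection \<open>Segments spanned by stable vectors, and the Steiner formula\<close>

lemma nn_integral_FTC_Ioi:
  fixes f F :: "real \<Rightarrow> real"
  assumes F: "\<And>x. 0 < x \<Longrightarrow> DERIV F x :> f x" and f: "\<And>x. 0 < x \<Longrightarrow> isCont f x"
    and nonneg: "\<And>x. 0 < x \<Longrightarrow> 0 \<le> f x"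
    and A: "(F \<longlongrightarrow> A) (at_right 0)" and B: "(F \<longlongrightarrow> B) at_top"
  shows "(\<integral>\<^sup>+x. ennreal (indicator {0<..} x * f x) \<partial>lborel) = ennreal (B - A)"
proof -
  have e: "einterval 0 \<infinity> = {0<..}" by (auto simp: einterval_def zero_ereal_def)
  have A': "((F \<circ> real_of_ereal) \<longlongrightarrow> A) (at_right 0)"
    using A by (simp add: zero_ereal_def ereal_tendsto_simps1)
  have B': "((F \<circ> real_of_ereal) \<longlongrightarrow> B) (at_left \<infinity>)"
    using B by (simp add: ereal_tendsto_simps1)
  have F': "\<And>x. 0 < ereal x \<Longrightarrow> ereal x < \<infinity> \<Longrightarrow> DERIV F x :> f x"
    and f': "\<And>x. 0 < ereal x \<Longrightarrow> ereal x < \<infinity> \<Longrightarrow> isCont f x"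
    and n': "AE x in lborel. 0 < ereal x \<longrightarrow> ereal x < \<infinity> \<longrightarrow> 0 \<le> f x"
    using F f nonneg by (auto simp: zero_ereal_def)
  have lt: "(0::ereal) < \<infinity>" by simp
  note * = interval_integral_FTC_nonneg[OF lt F' f' n' A' B']
  have "(\<integral>\<^sup>+x. ennreal (indicator {0<..} x * f x) \<partial>lborel) = ennreal (\<integral>x. indicator {0<..} x * f x \<partial>lborel)"
    using *(1) nonneg by (intro nn_integral_eq_integral) (auto simp: e set_integrable_def split: split_indicator)
  also have "(\<integral>x. indicator {0<..} x * f x \<partial>lborel) = B - A"
    using *(2) by (simp add: interval_lebesgue_integral_def e set_lebesgue_integral_def)
  finally show ?thesis .
qed

text \<open>Expresses \<open>\<bar>x\<bar>\<close> through cosines, so that a first absolute moment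
  can be read off from the real part of a characteristic function. Integration by parts leads to the
  sine integral, whose limit at infinity is \<open>pi / 2\<close>.\<close>

lemma nn_integral_one_minus_cos:
  "(\<integral>\<^sup>+s. ennreal (indicator {0<..} s * ((1 - cos (s * x)) / s\<^sup>2)) \<partial>lborel) = ennreal (pi / 2 * \<bar>x\<bar>)"
proof -
  define y where "y = \<bar>x\<bar>"
  have y: "0 \<le> y" by (simp add: y_def)
  have cos: "cos (s * x) = cos (s * y)" for s by (auto simp: y_def abs_if)
  define F where "F s = y * Si (s * y) - (1 - cos (s * y)) / s" for s
  have "(\<integral>\<^sup>+s. ennreal (indicator {0<..} s * ((1 - cos (s * y)) / s\<^sup>2)) \<partial>lborel) = ennreal (pi / 2 * y - 0)"
  proof (rule nn_integral_FTC_Ioi[where F = F])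
    fix s :: real assume s: "0 < s"
    show "DERIV F s :> (1 - cos (s * y)) / s\<^sup>2"
      unfolding F_def using s
      by (auto intro!: derivative_eq_intros DERIV_chain2[OF DERIV_Si] simp: field_simps power2_eq_square)
    show "isCont (\<lambda>s. (1 - cos (s * y)) / s\<^sup>2) s" using s by (intro continuous_intros) auto
    show "0 \<le> (1 - cos (s * y)) / s\<^sup>2" by simp
  next
    have "((\<lambda>s. y * Si (s * y)) \<longlongrightarrow> y * Si (0 * y)) (at_right 0)"
      by (intro tendsto_intros isCont_tendsto_compose[OF isCont_Si])
    moreover have "((\<lambda>s. (1 - cos (s * y)) / s) \<longlongrightarrow> 0) (at_right 0)"
    proof -
      have "((\<lambda>s. 1 - cos (s * y)) has_real_derivative 0) (at 0)"
        by (auto intro!: derivative_eq_intros)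
      then have "((\<lambda>s. (1 - cos (s * y)) / s) \<longlongrightarrow> 0) (at 0)"
        by (simp add: DERIV_def)
      then show ?thesis by (rule filterlim_at_split[THEN iffD1, THEN conjunct2])
    qed
    ultimately have "(F \<longlongrightarrow> y * Si (0 * y) - 0) (at_right 0)" unfolding F_def by (rule tendsto_diff)
    moreover have "Si 0 = 0" by (simp add: Si_def flip: zero_ereal_def)
    ultimately show "(F \<longlongrightarrow> 0) (at_right 0)" by simp
  next
    have 1: "((\<lambda>s. y * Si (s * y)) \<longlongrightarrow> y * (pi / 2)) at_top"
    proof (cases "y = 0")
      case False
      then have "filterlim (\<lambda>s. s * y) at_top at_top"
        using filterlim_tendsto_pos_mult_at_top[OF tendsto_const[of y] _ filterlim_ident] y
        by (simp add: mult.commute)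
      then show ?thesis by (intro tendsto_intros filterlim_compose[OF Si_at_top])
    qed simp
    have 2: "((\<lambda>s. (1 - cos (s * y)) / s) \<longlongrightarrow> 0) at_top"
    proof (rule tendsto_sandwich[where f = "\<lambda>_. 0" and h = "\<lambda>s. 2 / s"])
      have "1 - cos (s * y) \<le> 2" for s using cos_ge_minus_one[of "s * y"] by linarith
      then show "\<forall>\<^sub>F s in at_top. (1 - cos (s * y)) / s \<le> 2 / s"
        by (intro eventually_mono[OF eventually_gt_at_top[of 0]] divide_right_mono) auto
      show "\<forall>\<^sub>F s in at_top. 0 \<le> (1 - cos (s * y)) / s"
        by (intro eventually_mono[OF eventually_gt_at_top[of 0]]) auto
      show "((\<lambda>s::real. 2 / s) \<longlongrightarrow> 0) at_top"
        by (intro tendsto_divide_0[OF tendsto_const] filterlim_at_top_imp_at_infinity filterlim_ident)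
    qed simp
    show "(F \<longlongrightarrow> pi / 2 * y) at_top"
      using tendsto_diff[OF 1 2] by (simp add: F_def[abs_def] mult.commute)
  qed
  then show ?thesis unfolding cos by (simp add: y_def)
qed

text \<open>Writing \<open>1 - exp (- c)\<close> as the integral of \<open>exp (- v)\<close> over \<open>0 \<le> v \<le> c\<close> and integrating over
  \<open>s\<close> first turns the integral into the one defining \<open>Gamma (1 - 1/\<alpha>)\<close>.\<close>

lemma nn_integral_one_minus_exp:
  fixes a \<alpha> :: real
  assumes a: "0 \<le> a" and \<alpha>: "1 < \<alpha>"
  shows "(\<integral>\<^sup>+s. ennreal (indicator {0<..} s * ((1 - exp (- ((s * a) powr \<alpha>))) / s\<^sup>2)) \<partial>lborel) =
    ennreal (a * Gamma (1 - 1 / \<alpha>))"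
proof (cases "a = 0")
  case True
  then show ?thesis by simp
next
  case False
  with a have a: "0 < a" by simp
  let ?g = "\<lambda>s v::real. ennreal (of_bool (0 < s \<and> 0 < v \<and> v \<le> (s * a) powr \<alpha>) * (exp (- v) / s\<^sup>2))"
  have 1: "ennreal (indicator {0<..} s * ((1 - exp (- ((s * a) powr \<alpha>))) / s\<^sup>2)) = (\<integral>\<^sup>+v. ?g s v \<partial>lborel)" for s
  proof (cases "0 < s")
    case True
    let ?c = "(s * a) powr \<alpha>"
    have "(\<integral>\<^sup>+v. ennreal (exp (- v) / s\<^sup>2) * indicator {0..?c} v \<partial>lborel) = - exp (- ?c) / s\<^sup>2 - (- exp (- 0) / s\<^sup>2)"
      by (rule nn_integral_FTC_Icc) (use True in \<open>auto intro!: derivative_eq_intros simp: field_simps eval_nat_numeral\<close>)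
    also have "(\<integral>\<^sup>+v. ennreal (exp (- v) / s\<^sup>2) * indicator {0..?c} v \<partial>lborel) = (\<integral>\<^sup>+v. ?g s v \<partial>lborel)"
      using True AE_lborel_singleton[of 0] by (intro nn_integral_cong_AE) (auto split: split_indicator)
    finally show ?thesis using True by (simp add: diff_divide_distrib)
  qed simp
  have 2: "(\<integral>\<^sup>+s. ?g s v \<partial>lborel) = ennreal (indicator {0..} v * (v powr ((1 - 1 / \<alpha>) - 1) / exp v) * a)"
    if v: "v \<noteq> 0" for v
  proof (cases "0 < v")
    case True
    \<comment> \<open>The least \<open>s\<close> with \<open>v \<le> (s * a) powr \<alpha>\<close>.
      Integrating \<open>1 / s\<^sup>2\<close> from there on gives \<open>1 / c\<close>, which
      produces the power of \<open>v\<close> in the Gamma integrand.\<close>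
    define c where "c = v powr (1 / \<alpha>) / a"
    have c: "0 < c" using True a by (simp add: c_def)
    have iff: "v \<le> (s * a) powr \<alpha> \<longleftrightarrow> c \<le> s" if "0 < s" for s
    proof -
      have "v \<le> (s * a) powr \<alpha> \<longleftrightarrow> v powr (1 / \<alpha>) \<le> s * a"
      proof
        assume "v \<le> (s * a) powr \<alpha>"
        then have "v powr (1 / \<alpha>) \<le> ((s * a) powr \<alpha>) powr (1 / \<alpha>)"
          using True \<alpha> by (intro powr_mono2) auto
        then show "v powr (1 / \<alpha>) \<le> s * a" using \<alpha> that a by (simp add: powr_powr)
      next
        assume "v powr (1 / \<alpha>) \<le> s * a"
        then have "(v powr (1 / \<alpha>)) powr \<alpha> \<le> (s * a) powr \<alpha>"
          using \<alpha> by (intro powr_mono2) auto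
        then show "v \<le> (s * a) powr \<alpha>" using \<alpha> True by (simp add: powr_powr)
      qed
      then show ?thesis using a by (simp add: c_def field_simps)
    qed
    have "(\<integral>\<^sup>+s. ennreal (exp (- v) / s\<^sup>2) * indicator {c..} s \<partial>lborel) = 0 - (- exp (- v) / c)"
    proof (rule nn_integral_FTC_atLeast)
      show "((\<lambda>s. - exp (- v) / s) \<longlongrightarrow> 0) at_top"
        by (intro tendsto_divide_0[OF tendsto_const] filterlim_at_top_imp_at_infinity filterlim_ident)
    qed (use c in \<open>auto intro!: derivative_eq_intros simp: power2_eq_square\<close>)
    also have "(\<integral>\<^sup>+s. ennreal (exp (- v) / s\<^sup>2) * indicator {c..} s \<partial>lborel) = (\<integral>\<^sup>+s. ?g s v \<partial>lborel)"
    proof (intro nn_integral_cong)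
      fix s :: real
      show "ennreal (exp (- v) / s\<^sup>2) * indicator {c..} s = ?g s v"
        using True c iff[of s] by (cases "0 < s") (auto split: split_indicator)
    qed
    also have "0 - (- exp (- v) / c) = v powr ((1 - 1 / \<alpha>) - 1) / exp v * a"
      using True a by (simp add: c_def powr_minus exp_minus field_simps)
    finally show ?thesis using True by simp
  qed (use v in auto)
  have "(\<integral>\<^sup>+s. ennreal (indicator {0<..} s * ((1 - exp (- ((s * a) powr \<alpha>))) / s\<^sup>2)) \<partial>lborel) =
      (\<integral>\<^sup>+s. (\<integral>\<^sup>+v. ?g s v \<partial>lborel) \<partial>lborel)"
    unfolding 1 ..
  also have "\<dots> = (\<integral>\<^sup>+v. (\<integral>\<^sup>+s. ?g s v \<partial>lborel) \<partial>lborel)"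
    by (rule lborel_pair.Fubini'[symmetric]) measurable
  also have "\<dots> = (\<integral>\<^sup>+v. ennreal (indicator {0..} v * (v powr ((1 - 1 / \<alpha>) - 1) / exp v) * a) \<partial>lborel)"
    using 2 AE_lborel_singleton[of 0] by (intro nn_integral_cong_AE) auto
  also have "\<dots> = (\<integral>\<^sup>+v. ennreal (indicator {0..} v * (v powr ((1 - 1 / \<alpha>) - 1) / exp v)) \<partial>lborel) * ennreal a"
    using a by (subst nn_integral_multc[symmetric]) (auto simp flip: ennreal_mult'' simp: ac_simps)
  also have "(\<integral>\<^sup>+v. ennreal (indicator {0..} v * (v powr ((1 - 1 / \<alpha>) - 1) / exp v)) \<partial>lborel) = ennreal (Gamma (1 - 1 / \<alpha>))"
    using \<alpha> nn_integral_has_integral_lebesgue[OF _ Gamma_integral_real[of "1 - 1 / \<alpha>"]] by simp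
  also have "\<dots> * ennreal a = ennreal (a * Gamma (1 - 1 / \<alpha>))"
    using a \<alpha> by (simp add: ennreal_mult'' mult.commute Gamma_real_pos less_imp_le)
  finally show ?thesis .
qed

lemma cnj_iexp: "cnj (iexp x) = iexp (- x)"
  by (simp add: exp_cnj)

text \<open>Integrating \<open>nn_integral_one_minus_cos\<close> over the law of \<open>Y\<close>
  and exchanging the integrals reduces \<open>pi / 2\<close> times the first absolute moment to
  \<open>nn_integral_one_minus_exp\<close>. With nonnegative integrals, integrability comes out as a
  result. Symmetry leaves half of the moment for the positive part.\<close>

lemma stable_positive_part:
  fixes Y :: "'w \<Rightarrow> real"
  assumes N: "prob_space N" and Y [measurable]: "Y \<in> borel_measurable N"
    and a: "0 \<le> a" and \<alpha>: "1 < \<alpha>"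
    and chf: "\<And>s. 0 \<le> s \<Longrightarrow> (CLINT x|N. iexp (s * Y x)) = complex_of_real (exp (- ((s * a) powr \<alpha>)))"
  shows "integrable N Y" "(\<integral>x. max 0 (Y x) \<partial>N) = a * Gamma (1 - 1 / \<alpha>) / pi"
proof -
  interpret prob_space N by fact
  interpret P: pair_sigma_finite N lborel ..
  have int: "integrable N (\<lambda>x. iexp (s * Y x))" for s
    using integrable_iexp[of "\<lambda>x. complex_of_real (s * Y x)"] by simp
  have cos: "(\<integral>\<^sup>+x. ennreal (indicator {0<..} s * ((1 - cos (s * Y x)) / s\<^sup>2)) \<partial>N) =
      ennreal (indicator {0<..} s * ((1 - exp (- ((s * a) powr \<alpha>))) / s\<^sup>2))" for s
  proof (cases "0 < s")
    case True
    have icos: "integrable N (\<lambda>x. cos (s * Y x))"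
      by (rule integrable_const_bound[of _ 1]) auto
    have "(\<integral>x. cos (s * Y x) \<partial>N) = Re (CLINT x|N. iexp (s * Y x))"
      by (subst integral_Re[symmetric, OF int]) (simp add: Re_exp)
    then have "(\<integral>x. (1 - cos (s * Y x)) / s\<^sup>2 \<partial>N) = (1 - exp (- ((s * a) powr \<alpha>))) / s\<^sup>2"
      using chf[of s] True icos by (simp add: prob_space)
    moreover have "(\<integral>\<^sup>+x. ennreal ((1 - cos (s * Y x)) / s\<^sup>2) \<partial>N) = ennreal (\<integral>x. (1 - cos (s * Y x)) / s\<^sup>2 \<partial>N)"
      using icos by (intro nn_integral_eq_integral) auto
    ultimately show ?thesis using True by simp
  qed simp
  have "(\<integral>\<^sup>+x. ennreal (pi / 2 * \<bar>Y x\<bar>) \<partial>N) =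
      (\<integral>\<^sup>+x. (\<integral>\<^sup>+s. ennreal (indicator {0<..} s * ((1 - cos (s * Y x)) / s\<^sup>2)) \<partial>lborel) \<partial>N)"
    by (simp only: nn_integral_one_minus_cos)
  also have "\<dots> = (\<integral>\<^sup>+s. (\<integral>\<^sup>+x. ennreal (indicator {0<..} s * ((1 - cos (s * Y x)) / s\<^sup>2)) \<partial>N) \<partial>lborel)"
    by (rule P.Fubini'[symmetric]) measurable
  also have "\<dots> = ennreal (a * Gamma (1 - 1 / \<alpha>))"
    unfolding cos using a \<alpha> by (rule nn_integral_one_minus_exp)
  finally have nn: "(\<integral>\<^sup>+x. ennreal (pi / 2 * \<bar>Y x\<bar>) \<partial>N) = ennreal (a * Gamma (1 - 1 / \<alpha>))" .
  have pos: "0 \<le> a * Gamma (1 - 1 / \<alpha>)" using a \<alpha> by (simp add: Gamma_real_pos less_imp_le)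
  have "integrable N (\<lambda>x. pi / 2 * \<bar>Y x\<bar>)" "(\<integral>x. pi / 2 * \<bar>Y x\<bar> \<partial>N) = a * Gamma (1 - 1 / \<alpha>)"
    using nn_integral_eq_integrable[of "\<lambda>x. pi / 2 * \<bar>Y x\<bar>" N "a * Gamma (1 - 1 / \<alpha>)"] pos nn by simp_all
  then have "integrable N (\<lambda>x. 2 / pi * (pi / 2 * \<bar>Y x\<bar>))" "pi / 2 * (\<integral>x. \<bar>Y x\<bar> \<partial>N) = a * Gamma (1 - 1 / \<alpha>)"
    by (simp_all only: integrable_mult_right integral_mult_right_zero)
  then have abs: "integrable N (\<lambda>x. \<bar>Y x\<bar>)" "pi / 2 * (\<integral>x. \<bar>Y x\<bar> \<partial>N) = a * Gamma (1 - 1 / \<alpha>)"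
    by simp_all
  show Yint: "integrable N Y" using abs(1) by (simp add: integrable_abs_iff)
  \<comment> \<open>The characteristic function is real, hence equal to its conjugate, which is the
    one of \<open>- Y\<close>. By uniqueness \<open>Y\<close> is symmetric, so its mean
    vanishes.\<close>
  have neg: "(CLINT x|N. iexp (s * Y x)) = (CLINT x|N. iexp (- s * Y x))" for s
  proof -
    have *: "(CLINT x|N. iexp (s * Y x)) = (CLINT x|N. iexp (- s * Y x))" if "0 \<le> s" for s
    proof -
      have "(CLINT x|N. iexp (- s * Y x)) = (CLINT x|N. cnj (iexp (s * Y x)))"
        by (intro Bochner_Integration.integral_cong) (simp_all only: cnj_iexp mult_minus_left)
      also have "\<dots> = cnj (CLINT x|N. iexp (s * Y x))" by (rule Bochner_Integration.integral_cnj)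
      finally show ?thesis using chf[OF that] by simp
    qed
    show ?thesis
    proof (cases "0 \<le> s")
      case False
      then show ?thesis using *[of "- s"] by simp
    qed (rule *)
  qed
  have "distr N borel Y = distr N borel (\<lambda>x. - Y x)"
  proof (rule Levy_uniqueness)
    show "real_distribution (distr N borel Y)" "real_distribution (distr N borel (\<lambda>x. - Y x))"
      by (auto intro!: real_distribution_distr)
    show "char (distr N borel Y) = char (distr N borel (\<lambda>x. - Y x))"
      using neg by (simp add: char_def fun_eq_iff integral_distr)
  qed
  then have "integral\<^sup>L (distr N borel Y) (\<lambda>x. x) = integral\<^sup>L (distr N borel (\<lambda>x. - Y x)) (\<lambda>x. x)" by simp
  then have Y0: "(\<integral>x. Y x \<partial>N) = 0" by (simp add: integral_distr)
  have "(\<integral>x. max 0 (Y x) \<partial>N) = (\<integral>x. (\<bar>Y x\<bar> + Y x) / 2 \<partial>N)"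
    by (intro Bochner_Integration.integral_cong) (auto simp: max_def)
  also have "\<dots> = (\<integral>x. \<bar>Y x\<bar> \<partial>N) / 2" using abs Yint Y0 by simp
  finally have half: "(\<integral>x. max 0 (Y x) \<partial>N) = (\<integral>x. \<bar>Y x\<bar> \<partial>N) / 2" .
  show "(\<integral>x. max 0 (Y x) \<partial>N) = a * Gamma (1 - 1 / \<alpha>) / pi"
    unfolding half using abs(2) by (simp add: field_simps)
qed

text \<open>By homogeneity of the support function, the projection onto \<open>u\<close> is a
  one-dimensional stable variable of scale \<open>c * support_fun L u\<close>, and its mean positive
  part is proportional to that scale. Serves for sums of steps and, with exponent 2, for Gaussian
  vectors.\<close>

lemma zonoid_of_stable:
  fixes \<eta> :: "'w \<Rightarrow> 'a::euclidean_space"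
  assumes N: "prob_space N" and \<eta> [measurable]: "\<eta> \<in> borel_measurable N"
    and L: "convex_body L" "\<And>u. 0 \<le> support_fun L u" and c: "0 \<le> c" and \<alpha>: "1 < \<alpha>"
    and chf: "\<And>u. (CLINT x|N. iexp (\<eta> x \<bullet> u)) = complex_of_real (exp (- ((c * support_fun L u) powr \<alpha>)))"
  shows "zonoid_of N \<eta> (dil (c * Gamma (1 - 1 / \<alpha>) / pi) L)"
proof -
  have *: "integrable N (\<lambda>x. \<eta> x \<bullet> u)" "(\<integral>x. max 0 (\<eta> x \<bullet> u) \<partial>N) = (c * support_fun L u) * Gamma (1 - 1 / \<alpha>) / pi" for u
  proof -
    have chf': "(CLINT x|N. iexp (s * (\<eta> x \<bullet> u))) = complex_of_real (exp (- ((s * (c * support_fun L u)) powr \<alpha>)))"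
      if "0 \<le> s" for s
      using chf[of "s *\<^sub>R u"] that by (simp add: support_fun_scale L mult.left_commute)
    have m: "(\<lambda>x. \<eta> x \<bullet> u) \<in> borel_measurable N" by measurable
    note * = stable_positive_part[OF N m _ \<alpha> chf']
    show "integrable N (\<lambda>x. \<eta> x \<bullet> u)" by (rule *(1)) (use c L in auto)
    show "(\<integral>x. max 0 (\<eta> x \<bullet> u) \<partial>N) = (c * support_fun L u) * Gamma (1 - 1 / \<alpha>) / pi"
      by (rule *(2)) (use c L in auto)
  qed
  have "integrable N \<eta>"
  proof (rule Bochner_Integration.integrable_bound)
    show "integrable N (\<lambda>x. \<Sum>b\<in>Basis. \<bar>\<eta> x \<bullet> b\<bar>)" using *(1) by auto
    show "AE x in N. norm (\<eta> x) \<le> norm (\<Sum>b\<in>Basis. \<bar>\<eta> x \<bullet> b\<bar>)"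
      using norm_le_l1 by (auto intro!: AE_I2 order_trans[OF norm_le_l1])
  qed measurable
  moreover have pos: "0 \<le> c * Gamma (1 - 1 / \<alpha>) / pi" using c \<alpha> by (simp add: Gamma_real_pos less_imp_le)
  ultimately show ?thesis
    unfolding zonoid_of_def using N L * by (simp add: convex_body_dil support_fun_dil)
qed

lemma chf_sum_PiM:
  fixes f :: "'i \<Rightarrow> 'b \<Rightarrow> real"
  assumes I: "finite I" and \<nu>: "prob_space \<nu>" and f: "\<And>i. i \<in> I \<Longrightarrow> f i \<in> borel_measurable \<nu>"
  shows "(CLINT y|(\<Pi>\<^sub>M i\<in>I. \<nu>). iexp (\<Sum>i\<in>I. f i (y i))) = (\<Prod>i\<in>I. CLINT x|\<nu>. iexp (f i x))"
proof -
  interpret prob_space \<nu> by fact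
  interpret product_sigma_finite "\<lambda>_. \<nu>" ..
  have "(CLINT y|(\<Pi>\<^sub>M i\<in>I. \<nu>). iexp (\<Sum>i\<in>I. f i (y i))) = (CLINT y|(\<Pi>\<^sub>M i\<in>I. \<nu>). (\<Prod>i\<in>I. iexp (f i (y i))))"
    using I by (simp add: exp_sum sum_distrib_left)
  also have "\<dots> = (\<Prod>i\<in>I. CLINT x|\<nu>. iexp (f i x))"
    using I f integrable_iexp by (intro product_integral_prod) auto
  finally show ?thesis .
qed

lemma cball_zonoid:
  obtains N :: "('a::euclidean_space \<Rightarrow> real) measure" and \<eta> :: "('a \<Rightarrow> real) \<Rightarrow> 'a" and c :: real
  where "0 < c" "zonoid_of N \<eta> (cball 0 c)"
proof -
  let ?\<nu> = "std_normal_distribution"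
  let ?N = "\<Pi>\<^sub>M b\<in>(Basis :: 'a set). ?\<nu>"
  let ?\<eta> = "\<lambda>g. \<Sum>b\<in>Basis. g b *\<^sub>R (b :: 'a)"
  interpret \<nu>: real_distribution ?\<nu> by (rule real_dist_normal_dist)
  have N: "prob_space ?N" by (intro prob_space_PiM \<nu>.prob_space_axioms)
  have meas: "?\<eta> \<in> borel_measurable ?N" by measurable
  \<comment> \<open>The factor \<open>1 / sqrt 2\<close> brings
    \<open>exp (- (norm u)\<^sup>2 / 2)\<close> into the stable form with exponent 2 and the unit
    ball as body.\<close>
  have chf: "(CLINT g|?N. iexp (?\<eta> g \<bullet> u)) =
      complex_of_real (exp (- ((1 / sqrt 2 * support_fun (cball 0 1) u) powr 2)))" for u
  proof -
    have "(CLINT g|?N. iexp (?\<eta> g \<bullet> u)) = (CLINT g|?N. iexp (\<Sum>b\<in>Basis. (b \<bullet> u) * g b))"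
      by (simp add: inner_sum_left mult.commute)
    also have "\<dots> = (\<Prod>b\<in>Basis. CLINT x|?\<nu>. iexp ((b \<bullet> u) * x))"
      by (rule chf_sum_PiM) (auto simp: \<nu>.prob_space_axioms)
    also have "\<dots> = (\<Prod>b\<in>Basis. complex_of_real (exp (- ((b \<bullet> u)\<^sup>2) / 2)))"
      using char_std_normal_distribution by (simp add: char_def fun_eq_iff)
    also have "\<dots> = complex_of_real (exp (\<Sum>b\<in>Basis. - ((b \<bullet> u)\<^sup>2) / 2))"
      by (simp only: exp_sum[OF finite_Basis] of_real_prod)
    also have "(\<Sum>b\<in>Basis. - ((b \<bullet> u)\<^sup>2) / 2) = - (\<Sum>b\<in>Basis. (b \<bullet> u)\<^sup>2) / 2"
      by (simp add: sum_negf flip: sum_divide_distrib)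
    also have "(\<Sum>b\<in>Basis. (b \<bullet> u)\<^sup>2) = (norm u)\<^sup>2"
      unfolding power2_norm_eq_inner euclidean_inner[of u u] by (simp add: power2_eq_square inner_commute)
    also have "- (norm u)\<^sup>2 / 2 = - ((1 / sqrt 2 * support_fun (cball 0 1) u) powr 2)"
      by (simp add: support_fun_cball powr_numeral power_divide)
    finally show ?thesis .
  qed
  have "zonoid_of ?N ?\<eta> (dil (1 / sqrt 2 * Gamma (1 - 1 / 2) / pi) (cball 0 1))"
    by (rule zonoid_of_stable[OF N meas _ _ _ _ chf]) (auto simp: support_fun_cball)
  moreover have "dil (1 / sqrt 2 * Gamma (1 - 1 / 2) / pi) (cball 0 1 :: 'a set) = cball 0 (1 / sqrt 2 * Gamma (1 - 1 / 2) / pi)"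
    by (subst dil_cball_0) (auto simp: Gamma_real_pos)
  ultimately show ?thesis using that[of "1 / sqrt 2 * Gamma (1 - 1 / 2) / pi" ?N ?\<eta>] by (simp add: Gamma_real_pos)
qed

section \<open>Steiner polynomials and intrinsic volumes of arbitrary convex bodies\<close>

lemma translation_eq_plus: "(+) a ` A = {a} + (A :: 'a::comm_monoid_add set)"
  by (auto simp: set_plus_def)

lemma vol_plus_cball_polynomial_interior:
  fixes Q :: "'a::euclidean_space set"
  assumes "convex_body Q" "cball 0 t \<subseteq> Q" "0 < t"
  shows "\<exists>p. degree p \<le> DIM('a) \<and> (\<forall>s\<ge>0. vol (Q + cball 0 s) = poly p s)"
proof -
  obtain N :: "('a \<Rightarrow> real) measure" and \<eta> :: "('a \<Rightarrow> real) \<Rightarrow> 'a" and c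
    where c: "0 < c" and z: "zonoid_of N \<eta> (cball 0 c)" by (rule cball_zonoid)
  obtain p where p: "degree p \<le> DIM('a)" "\<And>s. 0 \<le> s \<Longrightarrow> vol (Q + dil s (cball 0 c)) = poly p s"
    using vol_zonoid_of[OF z assms] by blast
  have "vol (Q + cball 0 s) = poly (pcompose p [:0, 1 / c:]) s" if "0 \<le> s" for s
  proof -
    have "cball 0 s = dil (s / c) (cball 0 c :: 'a set)"
    proof (cases "s = 0")
      case True
      then show ?thesis using c dil_zero[of "cball 0 c :: 'a set"] by simp
    next
      case False
      then show ?thesis using c that by (simp add: dil_cball_0)
    qed
    then show ?thesis using p(2)[of "s / c"] c that by (simp add: poly_pcompose)
  qed
  moreover have "degree (pcompose p [:0, 1 / c:]) \<le> DIM('a)"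
    using p(1) by (simp add: degree_pcompose)
  ultimately show ?thesis by blast
qed

lemma Inter_plus_cball:
  fixes Q :: "'a::euclidean_space set"
  assumes "closed Q"
  shows "(\<Inter>n. Q + cball 0 (1 / real (Suc n))) = Q"
proof (intro equalityI subsetI)
  fix x assume x: "x \<in> (\<Inter>n. Q + cball 0 (1 / real (Suc n)))"
  have "\<forall>n. \<exists>q\<in>Q. dist q x \<le> 1 / real (Suc n)"
  proof
    fix n
    have "x \<in> Q + cball 0 (1 / real (Suc n))" using x by blast
    then obtain q b where "x = q + b" "q \<in> Q" "b \<in> cball 0 (1 / real (Suc n))" by (rule set_plus_elim)
    then show "\<exists>q\<in>Q. dist q x \<le> 1 / real (Suc n)" by (intro bexI[of _ q]) (auto simp: dist_norm)
  qed
  then have "\<exists>q. \<forall>n. q n \<in> Q \<and> dist (q n) x \<le> 1 / real (Suc n)" by (intro choice) blast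
  then obtain q where q: "\<And>n. q n \<in> Q" "\<And>n. dist (q n) x \<le> 1 / real (Suc n)" by blast
  have "(\<lambda>n. dist (q n) x) \<longlonglongrightarrow> 0"
  proof (rule tendsto_sandwich[OF _ _ tendsto_const LIMSEQ_inverse_real_of_nat])
    show "\<forall>\<^sub>F n in sequentially. 0 \<le> dist (q n) x" by simp
    show "\<forall>\<^sub>F n in sequentially. dist (q n) x \<le> inverse (real (Suc n))"
      unfolding inverse_eq_divide using q(2) by (intro always_eventually allI)
  qed
  then have "q \<longlonglongrightarrow> x" by (rule tendsto_dist_iff[THEN iffD2])
  then show "x \<in> Q" by (rule closed_sequentially[OF assms q(1)])
next
  fix x assume "x \<in> Q"
  then have "x + 0 \<in> Q + cball 0 (1 / real (Suc n))" for n by (intro set_plus_intro) auto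
  then show "x \<in> (\<Inter>n. Q + cball 0 (1 / real (Suc n)))" by simp
qed

text \<open>Removes the interior ball: after a translation, \<open>Q + cball 0 e\<close> contains
  the ball of radius \<open>e\<close>, so the volume is polynomial in the radius beyond every
  \<open>e > 0\<close>. These polynomials are restrictions of a single one, and radius 0 is reached
  by continuity of measure from above.\<close>

lemma vol_plus_cball_polynomial:
  fixes Q :: "'a::euclidean_space set"
  assumes Q: "convex_body Q"
  shows "\<exists>p. degree p \<le> DIM('a) \<and> (\<forall>s\<ge>0. vol (Q + cball 0 s) = poly p s)"
proof -
  let ?d = "DIM('a)"
  have cb: "convex_body (Q + cball 0 r)" if "0 \<le> r" for r using Q that by (simp add: convex_body_plus)
  obtain q where q: "q \<in> Q" using Q by (auto simp: convex_body_def)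
  have "\<exists>p. degree p \<le> ?d \<and> (\<forall>s\<ge>0. vol (Q + cball 0 (e + s)) = poly p s)" if e: "0 < e" for e
  proof -
    let ?Q = "(+) (- q) ` Q + cball 0 e"
    have 1: "convex_body ((+) (- q) ` Q)"
      unfolding translation_eq_plus using Q by (intro convex_body_plus) (auto simp: convex_body_def)
    have 0: "0 \<in> (+) (- q) ` Q" using q by force
    have "convex_body ?Q" using 1 e by (simp add: convex_body_plus)
    moreover have "cball 0 e \<subseteq> ?Q"
      using subset_plus_left[OF 0, of "cball 0 e" "cball 0 e"] by (simp add: add.commute)
    ultimately obtain p where p: "degree p \<le> ?d" "\<And>s. 0 \<le> s \<Longrightarrow> vol (?Q + cball 0 s) = poly p s"
      using vol_plus_cball_polynomial_interior e by blast
    have "vol (Q + cball 0 (e + s)) = poly p s" if s: "0 \<le> s" for s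
    proof -
      have "?Q + cball 0 s = (+) (- q) ` (Q + cball 0 (e + s))"
        by (simp only: translation_eq_plus add.assoc cball_plus[OF less_imp_le[OF e] s])
      then show ?thesis using p(2)[OF s] vol_translation[OF cb, of "e + s" "- q"] e s by simp
    qed
    then show ?thesis using p(1) by blast
  qed
  then obtain P where P: "\<And>e. 0 < e \<Longrightarrow> degree (P e) \<le> ?d"
    "\<And>e s. 0 < e \<Longrightarrow> 0 \<le> s \<Longrightarrow> vol (Q + cball 0 (e + s)) = poly (P e) s"
    by metis
  \<comment> \<open>The polynomial for \<open>e = 1\<close>, rewritten in terms of the total
    radius.\<close>
  define p where "p = pcompose (P 1) [:- 1, 1:]"
  have p: "degree p \<le> ?d" using P(1)[of 1] by (simp add: p_def degree_pcompose)
  have pos: "vol (Q + cball 0 e) = poly p e" if e: "0 < e" for e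
  proof -
    \<comment> \<open>At the radii \<open>e + 1 + k\<close> both polynomials are valid, since these
      exceed \<open>e\<close> as well as 1; \<open>d + 1\<close> of them force equality.\<close>
    have "pcompose (P e) [:- e, 1:] = p"
    proof (rule poly_eqI_degree[where A = "(\<lambda>k. e + 1 + real k) ` {..?d}"])
      have card: "card ((\<lambda>k. e + 1 + real k) ` {..?d}) = ?d + 1" by (subst card_image) (auto simp: inj_on_def)
      show "degree p < card ((\<lambda>k. e + 1 + real k) ` {..?d})" using p card by simp
      show "degree (pcompose (P e) [:- e, 1:]) < card ((\<lambda>k. e + 1 + real k) ` {..?d})"
        using P(1)[OF e] card by (simp add: degree_pcompose)
      fix x assume "x \<in> (\<lambda>k. e + 1 + real k) ` {..?d}"
      then have x: "e \<le> x" "1 \<le> x" using e by auto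
      show "poly (pcompose (P e) [:- e, 1:]) x = poly p x"
        using P(2)[OF e, of "x - e"] P(2)[of 1 "x - 1"] x by (simp add: p_def poly_pcompose)
    qed
    then have "poly p e = poly (P e) 0" by (auto simp: poly_pcompose)
    then show ?thesis using P(2)[OF e, of 0] by simp
  qed
  have "(\<lambda>n. vol (Q + cball 0 (1 / real (Suc n)))) \<longlonglongrightarrow> vol (\<Inter>n. Q + cball 0 (1 / real (Suc n)))"
  proof (rule Lim_measure_decseq)
    show "range (\<lambda>n. Q + cball 0 (1 / real (Suc n))) \<subseteq> sets lborel"
      by (intro image_subsetI) (simp add: convex_body_borel cb)
    show "decseq (\<lambda>n. Q + cball 0 (1 / real (Suc n)))"
      by (intro decseq_SucI set_plus_mono2 subset_cball) (auto simp: field_simps)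
    show "emeasure lborel (Q + cball 0 (1 / real (Suc n))) \<noteq> \<infinity>" for n
      using fmeasurableD2[OF convex_body_fmeasurable[OF cb[of "1 / real (Suc n)"]]] by simp
  qed
  also have "(\<Inter>n. Q + cball 0 (1 / real (Suc n))) = Q"
    using Q by (intro Inter_plus_cball) (simp add: convex_body_def compact_imp_closed)
  finally have "(\<lambda>n. poly p (1 / real (Suc n))) \<longlonglongrightarrow> vol Q" by (simp add: pos)
  moreover have "(\<lambda>n. poly p (1 / real (Suc n))) \<longlonglongrightarrow> poly p 0"
    using LIMSEQ_inverse_real_of_nat by (intro tendsto_poly) (simp add: inverse_eq_divide)
  ultimately have "vol Q = poly p 0" by (rule LIMSEQ_unique)
  then have "vol (Q + cball 0 s) = poly p s" if "0 \<le> s" for s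
    using pos[of s] that by (cases "s = 0") (auto simp: set_plus_zero_right)
  then show ?thesis using p by blast
qed

lemma poly_sum_le: "degree p \<le> d \<Longrightarrow> poly p x = (\<Sum>i\<le>d. coeff p i * x ^ i)" for p :: "real poly"
  unfolding poly_altdef by (rule sum.mono_neutral_left) (auto simp: coeff_eq_0)

lemma steiner_coefficients_eq:
  fixes a b :: "nat \<Rightarrow> real"
  assumes eq: "\<And>t. 0 < t \<Longrightarrow> (\<Sum>j\<le>d. t ^ (d - j) * unit_ball_vol (real (d - j)) * a j) =
      (\<Sum>j\<le>d. t ^ (d - j) * unit_ball_vol (real (d - j)) * b j)"
    and j: "j \<le> d"
  shows "a j = b j"
proof -
  define p where "p a = (\<Sum>j\<le>d. monom (unit_ball_vol (real (d - j)) * a j) (d - j))" for a :: "nat \<Rightarrow> real"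
  have poly: "poly (p a) t = (\<Sum>j\<le>d. t ^ (d - j) * unit_ball_vol (real (d - j)) * a j)" for a t
    by (simp add: p_def poly_sum poly_monom mult_ac)
  have coeff: "coeff (p a) (d - j) = unit_ball_vol (real (d - j)) * a j" for a
  proof -
    have "coeff (p a) (d - j) = (\<Sum>i\<le>d. if i = j then unit_ball_vol (real (d - i)) * a i else 0)"
      unfolding p_def coeff_sum using j by (intro sum.cong) auto
    then show ?thesis using j by simp
  qed
  have "p a = p b"
  proof (rule ccontr)
    assume "p a \<noteq> p b"
    then have "finite {x. poly (p a - p b) x = 0}" by (intro poly_roots_finite) simp
    moreover have "{0::real<..} \<subseteq> {x. poly (p a - p b) x = 0}" using eq by (auto simp: poly)
    ultimately have "finite {0::real<..}" by (rule rev_finite_subset)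
    then show False using infinite_Ioi by blast
  qed
  then have "coeff (p a) (d - j) = coeff (p b) (d - j)" by simp
  then have "unit_ball_vol (real (d - j)) * a j = unit_ball_vol (real (d - j)) * b j"
    unfolding coeff .
  moreover have "unit_ball_vol (real (d - j)) \<noteq> 0" by (rule less_imp_neq[THEN not_sym]) simp
  ultimately show ?thesis 
    using mult_left_cancel[of "unit_ball_vol (real (d - j))" "a j" "b j"] by blast
qed

text \<open>Existence comes from the polynomial, uniqueness from comparing coefficients; so the
  definite description in \<open>intrinsic_volume\<close> denotes.\<close>

lemma steiner_coeffs_intrinsic_volume:
  fixes L :: "'a::euclidean_space set"
  assumes L: "convex_body L"
  shows "steiner_coeffs L (\<lambda>j. intrinsic_volume j L)"
proof -
  let ?d = "DIM('a)"
  obtain p where p: "degree p \<le> ?d" "\<And>s. 0 \<le> s \<Longrightarrow> vol (L + cball 0 s) = poly p s"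
    using vol_plus_cball_polynomial[OF L] by blast
  define v where "v j = (if j \<le> ?d then coeff p (?d - j) / unit_ball_vol (real (?d - j)) else 0)" for j
  have nz: "unit_ball_vol (real k) \<noteq> 0" for k by (rule less_imp_neq[THEN not_sym]) simp
  have v: "steiner_coeffs L v"
    unfolding steiner_coeffs_def
  proof (intro conjI allI impI)
    fix t :: real assume t: "0 \<le> t"
    have "vol (L + cball 0 t) = (\<Sum>i\<le>?d. coeff p i * t ^ i)"
      using p t by (simp add: poly_sum_le)
    also have "\<dots> = (\<Sum>j\<le>?d. coeff p (?d - j) * t ^ (?d - j))" 
      by (rule sum.reindex_bij_witness[of _ "\<lambda>i. ?d - i" "\<lambda>i. ?d - i"]) auto
    also have "\<dots> = (\<Sum>j\<le>?d. t ^ (?d - j) * unit_ball_vol (real (?d - j)) * v j)"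
      by (intro sum.cong) (auto simp: v_def nz simp del: of_nat_diff)
    finally show "vol (L + cball 0 t) = (\<Sum>j\<le>?d. t ^ (?d - j) * unit_ball_vol (real (?d - j)) * v j)" .
  qed (simp add: v_def)
  have "(THE v. steiner_coeffs L v) = v"
  proof (rule the_equality)
    show "steiner_coeffs L v" by (rule v)
    fix w assume w: "steiner_coeffs L w"
    show "w = v"
    proof
      fix j
      show "w j = v j"
      proof (cases "j \<le> ?d")
        case True
        then show ?thesis
          by (rule steiner_coefficients_eq[rotated]) (use v w in \<open>simp add: steiner_coeffs_def\<close>)
      next
        case False
        then show ?thesis using v w by (simp add: steiner_coeffs_def)
      qed
    qed
  qed
  then have "(\<lambda>j. intrinsic_volume j L) = v" by (simp add: intrinsic_volume_def fun_eq_iff)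
  then show ?thesis using v by simp
qed

lemma steiner:
  fixes L :: "'a::euclidean_space set"
  assumes "convex_body L" "0 \<le> t"
  shows "vol (L + cball 0 t) =
    (\<Sum>j\<le>DIM('a). t ^ (DIM('a) - j) * unit_ball_vol (real (DIM('a) - j)) * intrinsic_volume j L)"
  using steiner_coeffs_intrinsic_volume[OF assms(1)] assms(2) by (simp add: steiner_coeffs_def)

text \<open>Compare coefficients in \<open>vol (dil c L + cball 0 t) = c ^ d * vol (L + cball 0 (t /
  c))\<close>.\<close>

lemma intrinsic_volume_dil:
  fixes L :: "'a::euclidean_space set"
  assumes L: "convex_body L" and c: "0 < c" and j: "j \<le> DIM('a)"
  shows "intrinsic_volume j (dil c L) = c ^ j * intrinsic_volume j L"
proof (rule steiner_coefficients_eq[OF _ j])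
  fix t :: real assume t: "0 < t"
  let ?d = "DIM('a)" and ?\<kappa> = "\<lambda>j. unit_ball_vol (real (DIM('a) - j))"
  have "(\<Sum>j\<le>?d. t ^ (?d - j) * ?\<kappa> j * intrinsic_volume j (dil c L)) = vol (dil c L + cball 0 t)"
    using steiner[OF convex_body_dil[OF L], of t] t by simp
  also have "dil c L + cball 0 t = dil c (L + cball 0 (t / c))"
    using c by (simp add: dil_plus dil_cball_0)
  also have "vol \<dots> = c ^ ?d * vol (L + cball 0 (t / c))"
    using L c t by (intro vol_dil convex_body_plus) auto
  also have "\<dots> = (\<Sum>j\<le>?d. c ^ ?d * ((t / c) ^ (?d - j) * ?\<kappa> j * intrinsic_volume j L))"
    using steiner[OF L, of "t / c"] c t by (simp add: sum_distrib_left)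
  also have "\<dots> = (\<Sum>j\<le>?d. t ^ (?d - j) * ?\<kappa> j * (c ^ j * intrinsic_volume j L))"
  proof (intro sum.cong refl)
    fix j assume "j \<in> {..?d}"
    then have "c ^ ?d = c ^ (?d - j) * c ^ j" by (simp flip: power_add)
    then show "c ^ ?d * ((t / c) ^ (?d - j) * ?\<kappa> j * intrinsic_volume j L) =
        t ^ (?d - j) * ?\<kappa> j * (c ^ j * intrinsic_volume j L)"
      using c by (simp add: power_divide)
  qed
  finally show "(\<Sum>j\<le>?d. t ^ (?d - j) * ?\<kappa> j * intrinsic_volume j (dil c L)) =
      (\<Sum>j\<le>?d. t ^ (?d - j) * ?\<kappa> j * (c ^ j * intrinsic_volume j L))" .
qed

subsection \<open>The Euler relation for compact convex sets\<close>

lemma compact_convex_real_interval: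
  fixes J :: "real set"
  assumes "compact J" "convex J" "J \<noteq> {}"
  shows "\<exists>l u. l \<le> u \<and> J = {l..u}"
  using assms connected_compact_interval_1[of J] by (force simp: convex_connected cbox_interval)

text \<open>The Euler characteristic in dimension one. The jump of the vanishing combination
  immediately to the right of \<open>e\<close> is, up to sign, the sum of the \<open>a i\<close>
  over the intervals with right endpoint \<open>e\<close>; summing over all right endpoints counts
  each nonempty interval once.\<close>

lemma euler_interval:
  fixes J :: "'i \<Rightarrow> real set" and a :: "'i \<Rightarrow> real"
  assumes I: "finite I" and J: "\<And>i. i \<in> I \<Longrightarrow> compact (J i)" "\<And>i. i \<in> I \<Longrightarrow> convex (J i)"
    and zero: "\<And>s. (\<Sum>i\<in>I. a i * indicator (J i) s) = 0"
  shows "(\<Sum>i\<in>{i\<in>I. J i \<noteq> {}}. a i) = 0"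
proof -
  let ?I = "{i\<in>I. J i \<noteq> {}}"
  have fin: "finite ?I" using I by simp
  define l u where "l i = Inf (J i)" and "u i = Sup (J i)" for i
  have lu: "l i \<le> u i" "J i = {l i..u i}" if i: "i \<in> ?I" for i
  proof -
    obtain a b where "a \<le> b" "J i = {a..b}" using i J compact_convex_real_interval by blast
    then show "l i \<le> u i" "J i = {l i..u i}" by (simp_all add: l_def u_def)
  qed
  have zero': "(\<Sum>i\<in>?I. a i * indicator (J i) s) = 0" for s
    using zero[of s] by (subst sum.mono_neutral_left[OF I]) auto
  have "(\<Sum>i\<in>{i\<in>?I. u i = e}. a i) = 0" for e
  proof -
    \<comment> \<open>No endpoint lies strictly between \<open>e\<close> and \<open>m\<close>, so
      membership of the midpoint \<open>b\<close> differs from that of \<open>e\<close> exactly for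
      the intervals ending at \<open>e\<close>. The element \<open>e + 1\<close> merely keeps the
      set nonempty.\<close>
    let ?F = "insert (e + 1) {x \<in> l ` ?I \<union> u ` ?I. e < x}"
    define m where "m = Min ?F"
    have F: "finite ?F" using fin by simp
    have m: "e < m" unfolding m_def using F by (subst Min_gr_iff) auto
    have m': "m \<le> x" if "x \<in> l ` ?I \<union> u ` ?I" "e < x" for x
      unfolding m_def using that F by (intro Min_le) auto
    define b where "b = (e + m) / 2"
    have b: "e < b" "b < m" using m by (simp_all add: b_def)
    have "a i * indicator (J i) e - a i * indicator (J i) b = (if u i = e then a i else 0)" if i: "i \<in> ?I" for i
    proof -
      have "e \<in> J i \<longleftrightarrow> l i \<le> e \<and> e \<le> u i" "b \<in> J i \<longleftrightarrow> l i \<le> b \<and> b \<le> u i" using lu(2)[OF i] by auto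
      moreover have "l i \<le> e \<or> m \<le> l i" "u i \<le> e \<or> m \<le> u i" using m'[of "l i"] m'[of "u i"] i by force+
      ultimately show ?thesis using b lu(1)[OF i] by (auto simp: indicator_def)
    qed
    then have "(\<Sum>i\<in>?I. if u i = e then a i else 0) =
        (\<Sum>i\<in>?I. a i * indicator (J i) e - a i * indicator (J i) b)" by (intro sum.cong) auto
    also have "\<dots> = 0" using zero'[of e] zero'[of b] by (simp add: sum_subtractf)
    finally show ?thesis unfolding sum.inter_filter[OF fin] .
  qed
  then have "(\<Sum>e\<in>u ` ?I. \<Sum>i\<in>{i\<in>?I. u i = e}. a i) = 0" by simp
  moreover have "(\<Sum>e\<in>u ` ?I. \<Sum>i\<in>{i\<in>?I. u i = e}. a i) = (\<Sum>i\<in>?I. a i)"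
    by (rule sum.group) (use fin in auto)
  ultimately show ?thesis by simp
qed

text \<open>Convexity for pointwise operations. Parameter vectors are functions on
  \<open>nat\<close> with the product topology, so that walks of every length and every set of steps
  share one type.\<close>

definition fun_convex :: "(nat \<Rightarrow> real) set \<Rightarrow> bool" where
  "fun_convex P \<longleftrightarrow> (\<forall>x\<in>P. \<forall>y\<in>P. \<forall>s. 0 \<le> s \<and> s \<le> 1 \<longrightarrow> (\<lambda>k. (1 - s) * x k + s * y k) \<in> P)"

lemma fun_convexD:
  "fun_convex P \<Longrightarrow> x \<in> P \<Longrightarrow> y \<in> P \<Longrightarrow> 0 \<le> s \<Longrightarrow> s \<le> 1 \<Longrightarrow> (\<lambda>k. (1 - s) * x k + s * y k) \<in> P"
  by (simp add: fun_convex_def)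

lemma continuous_on_fun_upd_zero: "continuous_on S (\<lambda>x :: nat \<Rightarrow> real. x(k := 0))"
proof (rule continuous_on_coordinatewise_then_product)
  show "continuous_on S (\<lambda>x :: nat \<Rightarrow> real. (x(k := 0)) i)" for i
    using continuous_on_subset[OF continuous_on_product_coordinates[of i] subset_UNIV[of S]] by (cases "i = k") auto
qed

lemma continuous_on_fun_upd: "continuous_on S (\<lambda>s :: real. (y :: nat \<Rightarrow> real)(k := s))"
proof (rule continuous_on_coordinatewise_then_product)
  show "continuous_on S (\<lambda>s. (y(k := s)) i)" for i by (cases "i = k") auto
qed

text \<open>Induction on the set of coordinates: the fibres of a coordinate projection are compact
  intervals, so the one-dimensional relation shows that the projections satisfy the same relation.\<close>

lemma euler_relation:
  fixes P :: "'i \<Rightarrow> (nat \<Rightarrow> real) set" and a :: "'i \<Rightarrow> real"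
  assumes "finite A" "finite I"
    and "\<And>i. i \<in> I \<Longrightarrow> compact (P i)" "\<And>i. i \<in> I \<Longrightarrow> fun_convex (P i)"
    and "\<And>i x k. i \<in> I \<Longrightarrow> x \<in> P i \<Longrightarrow> k \<notin> A \<Longrightarrow> x k = 0"
    and "\<And>x. (\<Sum>i\<in>I. a i * indicator (P i) x) = 0"
  shows "(\<Sum>i\<in>{i\<in>I. P i \<noteq> {}}. a i) = 0"
  using assms
proof (induction A arbitrary: P rule: finite_induct)
  case empty
  have "P i \<noteq> {} \<longleftrightarrow> (\<lambda>_. 0) \<in> P i" if "i \<in> I" for i
  proof -
    have "x = (\<lambda>_. 0)" if "x \<in> P i" for x using empty.prems(4)[OF \<open>i \<in> I\<close> that] by auto
    then show ?thesis by auto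
  qed
  then have *: "{i\<in>I. P i \<noteq> {}} = {i\<in>I. (\<lambda>_. 0) \<in> P i}" by blast
  have "(\<Sum>i\<in>{i\<in>I. P i \<noteq> {}}. a i) = (\<Sum>i\<in>I. if (\<lambda>_. 0) \<in> P i then a i else 0)"
    unfolding * by (rule sum.inter_filter[OF \<open>finite I\<close>])
  also have "\<dots> = (\<Sum>i\<in>I. a i * indicator (P i) (\<lambda>_. 0))"
    by (intro sum.cong) (auto simp: indicator_def)
  finally show ?case using empty.prems(5) by simp
next
  case (insert k A)
  define P' where "P' i = (\<lambda>x. x(k := 0)) ` P i" for i
  have "(\<Sum>i\<in>{i\<in>I. P' i \<noteq> {}}. a i) = 0"
  proof (rule insert.IH)
    show "compact (P' i)" if "i \<in> I" for i
      unfolding P'_def using insert.prems(2)[OF that] by (intro compact_continuous_image continuous_on_fun_upd_zero)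
    show "fun_convex (P' i)" if "i \<in> I" for i
      unfolding fun_convex_def
    proof (intro ballI allI impI)
      fix x y and s :: real assume "x \<in> P' i" "y \<in> P' i" and s: "0 \<le> s \<and> s \<le> 1"
      then obtain x' y' where xy: "x' \<in> P i" "y' \<in> P i" "x = x'(k := 0)" "y = y'(k := 0)" by (auto simp: P'_def)
      have "(\<lambda>k. (1 - s) * x' k + s * y' k) \<in> P i" using insert.prems(3)[OF that] xy s by (auto simp: fun_convex_def)
      moreover have "(\<lambda>k. (1 - s) * x k + s * y k) = (\<lambda>k. (1 - s) * x' k + s * y' k)(k := 0)" using xy by auto
      ultimately show "(\<lambda>k. (1 - s) * x k + s * y k) \<in> P' i" unfolding P'_def by blast
    qed
    show "x l = 0" if "i \<in> I" "x \<in> P' i" "l \<notin> A" for i x l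
      using insert.prems(4)[OF that(1)] that by (auto simp: P'_def)
    show "(\<Sum>i\<in>I. a i * indicator (P' i) y) = 0" for y
    proof (cases "y k = 0")
      case False
      then have "y \<notin> P' i" for i by (auto simp: P'_def)
      then show ?thesis by simp
    next
      case True
      define J where "J i = {s. y(k := s) \<in> P i}" for i
      have J: "y \<in> P' i \<longleftrightarrow> J i \<noteq> {}" for i
      proof
        assume "y \<in> P' i"
        then obtain x where "x \<in> P i" "y = x(k := 0)" by (auto simp: P'_def)
        then have "x k \<in> J i" by (simp add: J_def)
        then show "J i \<noteq> {}" by auto
      next
        assume "J i \<noteq> {}"
        then obtain s where "y(k := s) \<in> P i" by (auto simp: J_def)
        moreover have "y = (y(k := s))(k := 0)" using True by auto
        ultimately show "y \<in> P' i" unfolding P'_def by blast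
      qed
      have "(\<Sum>i\<in>{i\<in>I. J i \<noteq> {}}. a i) = 0"
      proof (rule euler_interval)
        show "finite I" by fact
        show "compact (J i)" if "i \<in> I" for i
        proof -
          have "closed (P i)" using insert.prems(2)[OF that] by (rule compact_imp_closed)
          then have "closed (J i)"
            unfolding J_def using continuous_on_fun_upd[of UNIV y k]
            by (metis closed_vimage vimage_def)
          moreover have "compact ((\<lambda>x. x k) ` P i)"
            using insert.prems(2)[OF that] continuous_on_subset[OF continuous_on_product_coordinates[of k] subset_UNIV[of "P i"]]
            by (intro compact_continuous_image)
          moreover have "J i \<subseteq> (\<lambda>x. x k) ` P i"
          proof
            fix s assume "s \<in> J i"
            then have "y(k := s) \<in> P i" by (simp add: J_def)
            then have "(y(k := s)) k \<in> (\<lambda>x. x k) ` P i" by (rule imageI)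
            then show "s \<in> (\<lambda>x. x k) ` P i" by simp
          qed
          ultimately show ?thesis using closed_Int_compact[of "J i" "(\<lambda>x. x k) ` P i"] by (simp add: Int_absorb2)
        qed
        show "convex (J i)" if "i \<in> I" for i
        proof (rule convexI)
          fix x z u v :: real assume xz: "x \<in> J i" "z \<in> J i" and uv: "0 \<le> u" "0 \<le> v" "u + v = 1"
          then have u: "u = 1 - v" by simp
          have "(\<lambda>l. (1 - v) * (y(k := x)) l + v * (y(k := z)) l) \<in> P i"
            using xz uv unfolding J_def by (intro fun_convexD[OF insert.prems(3)[OF that], where x = "y(k := x)" and y = "y(k := z)"]) auto
          moreover have "(\<lambda>l. (1 - v) * (y(k := x)) l + v * (y(k := z)) l) = y(k := u * x + v * z)"
            unfolding u by (rule ext) (simp add: algebra_simps)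
          ultimately show "u *\<^sub>R x + v *\<^sub>R z \<in> J i" by (simp add: J_def)
        qed
        show "(\<Sum>i\<in>I. a i * indicator (J i) s) = 0" for s
          using insert.prems(5)[of "y(k := s)"] unfolding J_def indicator_def by (simp only: mem_Collect_eq)
      qed
      then have "(\<Sum>i\<in>I. if J i \<noteq> {} then a i else 0) = 0"
        unfolding sum.inter_filter[OF \<open>finite I\<close>] .
      moreover have "(\<Sum>i\<in>I. a i * indicator (P' i) y) = (\<Sum>i\<in>I. if J i \<noteq> {} then a i else 0)"
        by (intro sum.cong) (simp_all add: indicator_def J)
      ultimately show ?thesis by (simp only:)
    qed
  qed (use insert.prems in auto)
  then show ?case by (simp add: P'_def)
qed

subsection \<open>Counting orderings\<close>

definition desc :: "('b \<Rightarrow> real) \<Rightarrow> 'b list \<Rightarrow> bool" where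
  "desc t = sorted_wrt (\<lambda>i j. t j \<le> t i)"

text \<open>Counts the order simplices that contain \<open>t\<close>. Ties are allowed, so the
  number is the product of the factorials of the sizes of the level sets of \<open>t\<close> on
  \<open>A\<close>.\<close>

definition num_desc :: "'b set \<Rightarrow> ('b \<Rightarrow> real) \<Rightarrow> real" where
  "num_desc A t = real (card {xs \<in> permutations_of_set A. desc t xs})"

lemma num_desc_const:
  assumes "finite A" "\<And>i j. i \<in> A \<Longrightarrow> j \<in> A \<Longrightarrow> t i = t j"
  shows "num_desc A t = fact (card A)"
proof -
  have "desc t xs" if "set xs \<subseteq> A" for xs
    using that by (induction xs) (auto simp: desc_def intro!: eq_refl assms(2))
  then have "{xs \<in> permutations_of_set A. desc t xs} = permutations_of_set A"
    by (auto dest: permutations_of_setD)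
  then show ?thesis using assms(1) by (simp add: num_desc_def)
qed

lemma desc_filter:
  assumes "desc t xs" "set xs \<subseteq> U \<union> D" "\<And>u v. u \<in> U \<Longrightarrow> v \<in> D \<Longrightarrow> t v < t u"
  shows "filter (\<lambda>i. i \<in> U) xs @ filter (\<lambda>i. i \<in> D) xs = xs"
  using assms(1,2)
proof (induction xs)
  case (Cons x xs)
  then have IH: "filter (\<lambda>i. i \<in> U) xs @ filter (\<lambda>i. i \<in> D) xs = xs" by (auto simp: desc_def)
  show ?case
  proof (cases "x \<in> U")
    case True
    then have "x \<notin> D" using assms(3)[of x x] by auto
    then show ?thesis using True IH by simp
  next
    case False
    then have x: "x \<in> D" using Cons.prems by auto
    have "y \<notin> U" if "y \<in> set xs" for y
      using Cons.prems(1) that assms(3)[OF _ x, of y] by (auto simp: desc_def)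
    then have "filter (\<lambda>i. i \<in> U) xs = []" by (simp add: filter_empty_conv)
    then show ?thesis using False x IH by simp
  qed
qed simp

text \<open>If \<open>t\<close> is strictly larger on \<open>U\<close> than on \<open>D\<close>, a
  compatible list consists of one for \<open>U\<close> followed by one for \<open>D\<close>.\<close>

lemma num_desc_split:
  assumes "finite U" "finite D" and less: "\<And>u v. u \<in> U \<Longrightarrow> v \<in> D \<Longrightarrow> t v < t u"
  shows "num_desc (U \<union> D) t = num_desc U t * num_desc D t"
proof -
  let ?S = "\<lambda>A. {xs \<in> permutations_of_set A. desc t xs}"
  have disj: "U \<inter> D = {}" using less by fastforce
  have "bij_betw (\<lambda>(us, vs). us @ vs) (?S U \<times> ?S D) (?S (U \<union> D))"
  proof (rule bij_betw_byWitness[where f' = "\<lambda>xs. (filter (\<lambda>i. i \<in> U) xs, filter (\<lambda>i. i \<in> D) xs)"])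
    have 1: "filter (\<lambda>i. i \<in> U) us = us" "filter (\<lambda>i. i \<in> D) us = []" if "set us = U" for us
      using that disj by (auto simp: filter_id_conv filter_empty_conv)
    have 2: "filter (\<lambda>i. i \<in> U) vs = []" "filter (\<lambda>i. i \<in> D) vs = vs" if "set vs = D" for vs
      using that disj by (auto simp: filter_id_conv filter_empty_conv)
    show "\<forall>p\<in>?S U \<times> ?S D. (\<lambda>xs. (filter (\<lambda>i. i \<in> U) xs, filter (\<lambda>i. i \<in> D) xs)) (case p of (us, vs) \<Rightarrow> us @ vs) = p"
    proof
      fix p assume "p \<in> ?S U \<times> ?S D"
      then obtain us vs where p: "p = (us, vs)" "set us = U" "set vs = D" by (auto simp: permutations_of_set_def)
      show "(\<lambda>xs. (filter (\<lambda>i. i \<in> U) xs, filter (\<lambda>i. i \<in> D) xs)) (case p of (us, vs) \<Rightarrow> us @ vs) = p"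
        by (simp add: p(1) 1[OF p(2)] 2[OF p(3)])
    qed
    show "\<forall>xs\<in>?S (U \<union> D). (case (filter (\<lambda>i. i \<in> U) xs, filter (\<lambda>i. i \<in> D) xs) of (us, vs) \<Rightarrow> us @ vs) = xs"
    proof
      fix xs assume "xs \<in> ?S (U \<union> D)"
      then have "desc t xs" "set xs \<subseteq> U \<union> D" by (auto simp: permutations_of_set_def)
      from desc_filter[OF this less]
      show "(case (filter (\<lambda>i. i \<in> U) xs, filter (\<lambda>i. i \<in> D) xs) of (us, vs) \<Rightarrow> us @ vs) = xs" by simp
    qed
    show "(\<lambda>(us, vs). us @ vs) ` (?S U \<times> ?S D) \<subseteq> ?S (U \<union> D)"
    proof (rule image_subsetI)
      fix p assume "p \<in> ?S U \<times> ?S D"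
      then obtain us vs where p: "p = (us, vs)"
        and us: "us \<in> permutations_of_set U" "desc t us" and vs: "vs \<in> permutations_of_set D" "desc t vs" by blast
      have "desc t (us @ vs)" using us vs
        by (auto simp: desc_def sorted_wrt_append permutations_of_set_def intro!: less_imp_le less)
      moreover have "us @ vs \<in> permutations_of_set (U \<union> D)"
        using us vs disj by (simp add: permutations_of_set_def)
      ultimately show "(\<lambda>(us, vs). us @ vs) p \<in> ?S (U \<union> D)" by (simp add: p)
    qed
    show "(\<lambda>xs. (filter (\<lambda>i. i \<in> U) xs, filter (\<lambda>i. i \<in> D) xs)) ` ?S (U \<union> D) \<subseteq> ?S U \<times> ?S D"
    proof (rule image_subsetI)
      fix xs assume "xs \<in> ?S (U \<union> D)"
      then have xs: "xs \<in> permutations_of_set (U \<union> D)" "desc t xs" by auto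
      then have "desc t (filter P xs)" for P by (simp add: desc_def sorted_wrt_filter)
      then show "(filter (\<lambda>i. i \<in> U) xs, filter (\<lambda>i. i \<in> D) xs) \<in> ?S U \<times> ?S D"
        using xs by (auto simp: permutations_of_set_def)
    qed
  qed
  then have "card (?S (U \<union> D)) = card (?S U \<times> ?S D)" 
    by (rule bij_betw_same_card[symmetric])
  then show ?thesis by (simp add: num_desc_def card_cartesian_product)
qed

lemma sum_Pow_card:
  fixes g :: "nat \<Rightarrow> real"
  assumes "finite A"
  shows "(\<Sum>B\<in>Pow A. g (card B)) = (\<Sum>k\<le>card A. real (card A choose k) * g k)"
proof -
  have "(\<Sum>k\<le>card A. \<Sum>B\<in>{B\<in>Pow A. card B = k}. g (card B)) = (\<Sum>B\<in>Pow A. g (card B))"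
    using assms by (intro sum.group) (auto intro!: card_mono)
  moreover have "(\<Sum>B\<in>{B\<in>Pow A. card B = k}. g (card B)) = real (card A choose k) * g k" for k
  proof -
    have "(\<Sum>B\<in>{B\<in>Pow A. card B = k}. g (card B)) = real (card {B\<in>Pow A. card B = k}) * g k" by simp
    also have "{B\<in>Pow A. card B = k} = {B. B \<subseteq> A \<and> card B = k}" by auto
    finally show ?thesis using n_subsets[OF assms, of k] by simp
  qed
  ultimately show ?thesis by (simp only:)
qed

text \<open>The factorials cancel the number of subsets of each size, which leaves
  \<open>fact (card A)\<close> times a sum over sizes.\<close>

lemma sum_nonempty_Pow_card:
  fixes g :: "nat \<Rightarrow> real"
  assumes "finite A"
  shows "(\<Sum>B\<in>Pow A - {{}}. fact (card B) * fact (card A - card B) * g (card B)) = fact (card A) * (\<Sum>k=1..card A. g k)"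
proof -
  define h where "h k = (if k = 0 then 0 else fact k * fact (card A - k) * g k)" for k
  have "(\<Sum>B\<in>Pow A - {{}}. fact (card B) * fact (card A - card B) * g (card B)) = (\<Sum>B\<in>Pow A. h (card B))"
    using assms by (intro sum.mono_neutral_cong_left) (auto simp: h_def dest: finite_subset)
  also have "\<dots> = (\<Sum>k\<le>card A. real (card A choose k) * h k)" by (rule sum_Pow_card[OF assms])
  also have "\<dots> = (\<Sum>k=1..card A. real (card A choose k) * h k)"
    by (rule sum.mono_neutral_right) (auto simp: h_def)
  also have "\<dots> = (\<Sum>k=1..card A. fact (card A) * g k)"
  proof (rule sum.cong)
    fix k assume k: "k \<in> {1..card A}"
    then have "fact k * fact (card A - k) * real (card A choose k) = fact (card A)"
      by (intro binomial_fact_lemma[THEN arg_cong[where f = real], simplified]) simp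
    then show "real (card A choose k) * h k = fact (card A) * g k" using k by (simp add: h_def mult_ac)
  qed simp
  finally show ?thesis by (simp add: sum_distrib_left)
qed

text \<open>The pointwise identity behind the recursion for walks. A block \<open>B\<close> on which
  \<open>t\<close> is constant lies in one level set; for a level set of size \<open>m\<close> the
  blocks contribute \<open>m * fact m\<close> by \<open>sum_nonempty_Pow_card\<close>, times the
  count for the other levels. Summed over the levels, the factors \<open>m\<close> add up to
  \<open>card A\<close>. The induction splits off the lowest level \<open>T\<close>.\<close>

lemma num_desc_recursion:
  assumes "finite A"
  shows "real (card A) * num_desc A t =
    (\<Sum>B\<in>{B. B \<subseteq> A \<and> B \<noteq> {} \<and> (\<forall>i\<in>B. \<forall>j\<in>B. t i = t j)}. fact (card B) * num_desc (A - B) t)"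
  using assms
proof (induction A rule: finite_psubset_induct)
  case (psubset A)
  let ?CB = "\<lambda>A. {B. B \<subseteq> A \<and> B \<noteq> {} \<and> (\<forall>i\<in>B. \<forall>j\<in>B. t i = t j)}"
  show ?case
  proof (cases "A = {}")
    case True
    then have *: "?CB A = {}" by auto
    show ?thesis unfolding * using True by simp
  next
    case False
    define m where "m = Min (t ` A)"
    define T where "T = {i\<in>A. t i = m}"
    define U where "U = A - T"
    have "m \<in> t ` A" unfolding m_def using psubset.hyps False by (intro Min_in) auto
    then have T: "T \<noteq> {}" by (auto simp: T_def)
    have le: "m \<le> t i" if "i \<in> A" for i unfolding m_def using psubset.hyps that by (intro Min_le) auto
    have fin: "finite T" "finite U" using psubset.hyps by (auto simp: T_def U_def)
    have less: "t v < t u" if "u \<in> U" "v \<in> T" for u v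
      using that le[of u] by (auto simp: U_def T_def)
    have A: "A = U \<union> T" "U \<inter> T = {}" by (auto simp: U_def T_def)
    have cA: "card A = card U + card T" using fin A by (simp add: card_Un_disjoint)
    have numA: "num_desc A t = num_desc U t * fact (card T)"
      using num_desc_split[OF fin(2,1) less] num_desc_const[OF fin(1), of t] by (simp add: A(1)) (simp add: T_def)
    \<comment> \<open>Constancy of \<open>t\<close> forces a block that meets the lowest level to be
      contained in it.\<close>
    have CB: "?CB A = ?CB U \<union> (Pow T - {{}})"
    proof (intro equalityI subsetI)
      fix B assume B: "B \<in> ?CB A"
      show "B \<in> ?CB U \<union> (Pow T - {{}})"
      proof (cases "B \<inter> T = {}")
        case True
        then have "B \<subseteq> U" using B A by blast
        then show ?thesis using B by blast
      next
        case False
        then obtain i where i: "i \<in> B" "i \<in> T" by auto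
        have "B \<subseteq> T"
        proof
          fix j assume j: "j \<in> B"
          then have "t j = t i" using B i by blast
          also have "t i = m" using i by (simp add: T_def)
          finally have "t j = m" .
          moreover have "j \<in> A" using j B by blast
          ultimately show "j \<in> T" by (simp add: T_def)
        qed
        then show ?thesis using B by blast
      qed
    next
      fix B assume "B \<in> ?CB U \<union> (Pow T - {{}})"
      then consider "B \<in> ?CB U" | "B \<subseteq> T" "B \<noteq> {}" by blast
      then show "B \<in> ?CB A"
      proof cases
        case 1
        moreover have "U \<subseteq> A" by (simp add: U_def)
        ultimately show ?thesis by blast
      next
        case 2
        have "t i = m" if "i \<in> B" for i using that 2(1) by (auto simp: T_def)
        then have "\<forall>i\<in>B. \<forall>j\<in>B. t i = t j" by simp
        moreover have "B \<subseteq> A" using 2(1) by (auto simp: T_def)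
        ultimately show ?thesis using 2(2) by blast
      qed
    qed
    have disj: "?CB U \<inter> (Pow T - {{}}) = {}" using A(2) by blast
    have fCB: "finite (?CB U)" using fin by (auto intro: finite_subset[of _ "Pow U"])
    have 1: "(\<Sum>B\<in>Pow T - {{}}. fact (card B) * num_desc (A - B) t) = num_desc U t * (real (card T) * fact (card T))"
    proof -
      have "fact (card B) * num_desc (A - B) t = num_desc U t * (fact (card B) * fact (card T - card B) * 1)"
        if "B \<in> Pow T - {{}}" for B
      proof -
        have "A - B = U \<union> (T - B)" using that A by auto
        then have "num_desc (A - B) t = num_desc U t * num_desc (T - B) t"
          using num_desc_split[of U "T - B" t] fin less by simp
        also have "num_desc (T - B) t = fact (card (T - B))" using fin by (intro num_desc_const) (auto simp: T_def)
        also have "card (T - B) = card T - card B" using that fin by (intro card_Diff_subset) (auto dest: finite_subset)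
        finally show ?thesis by simp
      qed
      then have "(\<Sum>B\<in>Pow T - {{}}. fact (card B) * num_desc (A - B) t) =
          (\<Sum>B\<in>Pow T - {{}}. num_desc U t * (fact (card B) * fact (card T - card B) * 1))"
        by (intro sum.cong) auto
      also have "\<dots> = num_desc U t * (fact (card T) * (\<Sum>k=1..card T. 1))"
        using sum_nonempty_Pow_card[OF fin(1), of "\<lambda>_. 1"] by (simp flip: sum_distrib_left)
      finally show ?thesis by simp
    qed
    have 2: "(\<Sum>B\<in>?CB U. fact (card B) * num_desc (A - B) t) = fact (card T) * (real (card U) * num_desc U t)"
    proof -
      have *: "fact (card B) * num_desc (A - B) t = fact (card T) * (fact (card B) * num_desc (U - B) t)" if "B \<in> ?CB U" for B
      proof -
        have "A - B = (U - B) \<union> T" using that A by blast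
        then have "num_desc (A - B) t = num_desc (U - B) t * num_desc T t"
          using num_desc_split[of "U - B" T t] fin less by simp
        also have "num_desc T t = fact (card T)" using fin by (intro num_desc_const) (auto simp: T_def)
        finally show ?thesis by simp
      qed
      have "(\<Sum>B\<in>?CB U. fact (card B) * num_desc (A - B) t) =
          fact (card T) * (\<Sum>B\<in>?CB U. fact (card B) * num_desc (U - B) t)"
        unfolding sum_distrib_left by (rule sum.cong[OF refl *])
      also have "U \<subset> A" using T by (auto simp: U_def T_def)
      then have "(\<Sum>B\<in>?CB U. fact (card B) * num_desc (U - B) t) = real (card U) * num_desc U t"
        using psubset.IH[of U] by simp
      finally show ?thesis .
    qed
    show ?thesis unfolding CB
      using fin disj fCB 1 2 by (subst sum.union_disjoint) (auto simp: numA cA algebra_simps)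
  qed
qed

subsection \<open>Convex hulls of walks\<close>

definition cube :: "nat set \<Rightarrow> (nat \<Rightarrow> real) set" where
  "cube A = {t. (\<forall>i\<in>A. 0 \<le> t i \<and> t i \<le> 1) \<and> (\<forall>i. i \<notin> A \<longrightarrow> t i = 0)}"

definition walk_simplex :: "nat list \<Rightarrow> (nat \<Rightarrow> real) set" where
  "walk_simplex xs = {t \<in> cube (set xs). desc t xs}"

text \<open>The convex hull of the partial sums of the steps taken in the order \<open>xs\<close>,
  as \<open>walk_hull_upt\<close> confirms for \<open>[0..<N]\<close>. The form as a linear image of
  an order simplex places all orderings of the steps over the same cube.\<close>

definition walk_hull :: "nat list \<Rightarrow> (nat \<Rightarrow> 'a::euclidean_space) \<Rightarrow> 'a set" where
  "walk_hull xs y = (\<lambda>t. \<Sum>i\<in>set xs. t i *\<^sub>R y i) ` walk_simplex xs"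

lemma compact_cube: "compact (cube A)"
proof -
  have "cube A = PiE UNIV (\<lambda>i. if i \<in> A then {0..1} else {0})"
    by (auto simp: cube_def PiE_def Pi_def split: if_splits)
  moreover have "compactin (product_topology (\<lambda>i. euclidean) UNIV) (PiE UNIV (\<lambda>i. if i \<in> A then {0..1::real} else {0}))"
    by (subst compactin_PiE) auto
  ultimately show ?thesis by (simp add: euclidean_product_topology)
qed

lemma closed_coordinate_le: "closed {t :: nat \<Rightarrow> real. t i \<le> t j}"
  by (intro closed_Collect_le continuous_on_product_coordinates)

lemma closed_desc: "closed {t :: nat \<Rightarrow> real. desc t xs}"
proof (induction xs)
  case (Cons x xs)
  have "{t. desc t (x # xs)} = (\<Inter>y\<in>set xs. {t. t y \<le> t x}) \<inter> {t. desc t xs}"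
    by (auto simp: desc_def)
  then show ?case using Cons by (auto intro!: closed_Int closed_INT closed_coordinate_le)
qed (simp add: desc_def)

lemma closed_const_on: "closed {t :: nat \<Rightarrow> real. \<forall>i\<in>B. \<forall>j\<in>B. t i = t j}"
proof -
  have "(\<forall>i\<in>B. \<forall>j\<in>B. t i = t j) \<longleftrightarrow> (\<forall>i\<in>B. \<forall>j\<in>B. t i \<le> t j)" for t :: "nat \<Rightarrow> real"
  proof (intro iffI ballI)
    fix i j assume "\<forall>i\<in>B. \<forall>j\<in>B. t i = t j" "i \<in> B" "j \<in> B"
    then have "t i = t j" by blast
    then show "t i \<le> t j" by (rule eq_refl)
  next
    fix i j assume "\<forall>i\<in>B. \<forall>j\<in>B. t i \<le> t j" "i \<in> B" "j \<in> B"
    then show "t i = t j" by (intro antisym) auto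
  qed
  then have "{t :: nat \<Rightarrow> real. \<forall>i\<in>B. \<forall>j\<in>B. t i = t j} = (\<Inter>i\<in>B. \<Inter>j\<in>B. {t. t i \<le> t j})"
    by blast
  then show ?thesis by (auto intro!: closed_INT closed_coordinate_le)
qed

lemma convex_combination_le:
  fixes s x x' :: real
  assumes "0 \<le> s" "s \<le> 1" "x \<le> x'" "y \<le> y'"
  shows "(1 - s) * x + s * y \<le> (1 - s) * x' + s * y'"
  using assms by (intro add_mono mult_left_mono) auto

lemma fun_convex_cube: "fun_convex (cube A)"
  unfolding fun_convex_def cube_def
proof (intro ballI allI impI CollectI conjI)
  fix x y s i assume x: "x \<in> {t. (\<forall>i\<in>A. 0 \<le> t i \<and> t i \<le> 1) \<and> (\<forall>i. i \<notin> A \<longrightarrow> t i = (0::real))}"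
    and y: "y \<in> {t. (\<forall>i\<in>A. 0 \<le> t i \<and> t i \<le> 1) \<and> (\<forall>i. i \<notin> A \<longrightarrow> t i = (0::real))}" and s: "0 \<le> s \<and> s \<le> (1::real)"
  {
    assume i: "i \<in> A"
    show "0 \<le> (1 - s) * x i + s * y i" using x y s i by auto
    show "(1 - s) * x i + s * y i \<le> 1"
      using convex_combination_le[of s "x i" 1 "y i" 1] x y s i by auto
  }
  show "(1 - s) * x i + s * y i = 0" if "i \<notin> A" using x y that by auto
qed

lemma fun_convex_desc: "fun_convex {t. desc t xs}"
  unfolding fun_convex_def
proof (intro ballI allI impI CollectI)
  fix x y s assume "x \<in> {t. desc t xs}" "y \<in> {t. desc t xs}" "0 \<le> s \<and> s \<le> (1::real)"
  then show "desc (\<lambda>k. (1 - s) * x k + s * y k) xs"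
    by (induction xs) (auto simp: desc_def intro!: convex_combination_le)
qed

lemma fun_convex_const_on: "fun_convex {t. \<forall>i\<in>B. \<forall>j\<in>B. t i = t j}"
  unfolding fun_convex_def
proof (intro ballI allI impI CollectI)
  fix x y :: "nat \<Rightarrow> real" and s i j
  assume "x \<in> {t. \<forall>i\<in>B. \<forall>j\<in>B. t i = t j}" "y \<in> {t. \<forall>i\<in>B. \<forall>j\<in>B. t i = t j}" "i \<in> B" "j \<in> B"
  then have "x i = x j" "y i = y j" by blast+
  then show "(1 - s) * x i + s * y i = (1 - s) * x j + s * y j" by (simp only:)
qed

lemma fun_convex_Int: "fun_convex P \<Longrightarrow> fun_convex P' \<Longrightarrow> fun_convex (P \<inter> P')"
  by (simp add: fun_convex_def)

lemma walk_simplex_alt: "walk_simplex xs = cube (set xs) \<inter> {t. desc t xs}"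
  by (auto simp: walk_simplex_def)

lemma compact_walk_simplex: "compact (walk_simplex xs)"
  unfolding walk_simplex_alt by (intro compact_Int_closed compact_cube closed_desc)

lemma fun_convex_walk_simplex: "fun_convex (walk_simplex xs)"
  unfolding walk_simplex_alt by (intro fun_convex_Int fun_convex_cube fun_convex_desc)

lemma zero_mem_walk_simplex: "(\<lambda>_. 0) \<in> walk_simplex xs"
proof -
  have "desc (\<lambda>_. 0) xs" by (induction xs) (auto simp: desc_def)
  then show ?thesis by (simp add: walk_simplex_def cube_def)
qed

lemma continuous_on_linear_comb:
  fixes y :: "nat \<Rightarrow> 'a::euclidean_space"
  shows "continuous_on S (\<lambda>t. \<Sum>i\<in>A. t i *\<^sub>R y i)"
  by (intro continuous_intros continuous_on_subset[OF continuous_on_product_coordinates]) auto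

lemma convex_body_walk_hull: "convex_body (walk_hull xs y)"
  unfolding convex_body_def
proof (intro conjI)
  show "walk_hull xs y \<noteq> {}" using zero_mem_walk_simplex by (auto simp: walk_hull_def)
  show "compact (walk_hull xs y)" unfolding walk_hull_def
    by (intro compact_continuous_image continuous_on_linear_comb compact_walk_simplex)
  show "convex (walk_hull xs y)"
  proof (rule convexI)
    fix p q and u v :: real assume pq: "p \<in> walk_hull xs y" "q \<in> walk_hull xs y" and uv: "0 \<le> u" "0 \<le> v" "u + v = 1"
    then obtain t t' where t: "t \<in> walk_simplex xs" "p = (\<Sum>i\<in>set xs. t i *\<^sub>R y i)"
      "t' \<in> walk_simplex xs" "q = (\<Sum>i\<in>set xs. t' i *\<^sub>R y i)" by (auto simp: walk_hull_def)
    have u: "u = 1 - v" using uv by simp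
    have w: "(\<lambda>k. (1 - v) * t k + v * t' k) \<in> walk_simplex xs"
      using t uv by (intro fun_convexD[OF fun_convex_walk_simplex]) auto
    have e: "u *\<^sub>R p + v *\<^sub>R q = (\<Sum>i\<in>set xs. ((1 - v) * t i + v * t' i) *\<^sub>R y i)"
      by (simp add: t u scaleR_add_left sum.distrib scaleR_sum_right)
    show "u *\<^sub>R p + v *\<^sub>R q \<in> walk_hull xs y" unfolding walk_hull_def 
      by (rule image_eqI[OF _ w]) (rule e)
  qed
qed

lemma zero_mem_walk_hull: "0 \<in> walk_hull xs y"
  unfolding walk_hull_def by (rule image_eqI[OF _ zero_mem_walk_simplex]) simp

lemma mem_plus_iff_diff: "z \<in> S + Q \<longleftrightarrow> (\<exists>x\<in>S. z - x \<in> Q)" for z :: "'a::ab_group_add"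
proof
  assume "z \<in> S + Q"
  then obtain a b where "z = a + b" "a \<in> S" "b \<in> Q" by (rule set_plus_elim)
  then show "\<exists>x\<in>S. z - x \<in> Q" by (intro bexI[of _ a]) auto
next
  assume "\<exists>x\<in>S. z - x \<in> Q"
  then obtain x where x: "x \<in> S" "z - x \<in> Q" by blast
  have "x + (z - x) \<in> S + Q" using x by (rule set_plus_intro)
  then show "z \<in> S + Q" by simp
qed

text \<open>A point \<open>z\<close> lies in \<open>walk_hull xs y + Q\<close> iff the order simplex of \<open>xs\<close> meets the convex set of
  all \<open>t\<close> with \<open>z - (\<Sum>i. t i y i) \<in> Q\<close>. The Euler relation therefore transports the count
  of orderings from the cube to any linear image, whatever the vectors \<open>y i\<close> are.\<close>

lemma walk_hull_indicator:
  fixes y :: "nat \<Rightarrow> 'a::euclidean_space"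
  assumes A: "finite A" and Q: "convex_body Q"
  shows "real (card A) * (\<Sum>xs\<in>permutations_of_set A. indicator (walk_hull xs y + Q) z) =
    (\<Sum>B\<in>Pow A - {{}}. \<Sum>zs\<in>permutations_of_set (A - B).
      fact (card B) * indicator (walk_hull zs y + seg (\<Sum>i\<in>B. y i) + Q) z)"
proof -
  define lin where "lin t = (\<Sum>i\<in>A. t i *\<^sub>R y i)" for t :: "nat \<Rightarrow> real"
  define G where "G = {t. z - lin t \<in> Q}"
  \<comment> \<open>\<open>D (B, zs)\<close> ties the coordinates in \<open>B\<close> together and
    orders the others along \<open>zs\<close>, with no order between the two groups. Taken with
    weight \<open>- fact (card B)\<close>, these sets cancel the order simplices of weight
    \<open>card A\<close> at every point of the cube, by \<open>num_desc_recursion\<close>.\<close>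
  define D where "D = (\<lambda>(B, zs). cube A \<inter> {t. \<forall>i\<in>B. \<forall>j\<in>B. t i = t j} \<inter> {t. desc t zs})"
  define I where "I = permutations_of_set A <+> Sigma (Pow A - {{}}) (\<lambda>B. permutations_of_set (A - B))"
  define P where "P = case_sum (\<lambda>xs. walk_simplex xs \<inter> G) (\<lambda>p. D p \<inter> G)"
  define a where "a = case_sum (\<lambda>xs :: nat list. real (card A)) (\<lambda>(B :: nat set, zs :: nat list). - fact (card B))"
  have fin: "finite I" unfolding I_def using A by (intro finite_Plus finite_SigmaI) auto
  have sumI: "(\<Sum>i\<in>I. g i) = (\<Sum>xs\<in>permutations_of_set A. g (Inl xs)) +
      (\<Sum>B\<in>Pow A - {{}}. \<Sum>zs\<in>permutations_of_set (A - B). g (Inr (B, zs)))" for g :: "_ \<Rightarrow> real"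
    unfolding I_def using A by (subst sum.Plus) (auto simp: sum.Sigma intro!: finite_SigmaI)
  have G: "closed G"
  proof -
    have "continuous_on UNIV (\<lambda>t. z - lin t)"
      unfolding lin_def by (intro continuous_intros continuous_on_linear_comb)
    moreover have "closed Q" using Q by (simp add: convex_body_def compact_imp_closed)
    ultimately have "closed ((\<lambda>t. z - lin t) -` Q)" by (intro closed_vimage)
    then show ?thesis by (simp add: G_def vimage_def)
  qed
  have G': "fun_convex G"
    unfolding fun_convex_def
  proof (intro ballI allI impI)
    fix x x' s assume x: "x \<in> G" "x' \<in> G" and s: "0 \<le> s \<and> s \<le> (1::real)"
    have "z - lin (\<lambda>k. (1 - s) * x k + s * x' k) = (1 - s) *\<^sub>R (z - lin x) + s *\<^sub>R (z - lin x')"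
      by (simp add: lin_def scaleR_add_left sum.distrib sum_subtractf scaleR_sum_right algebra_simps)
    also have "\<dots> \<in> Q" using Q x s by (intro convexD) (auto simp: convex_body_def G_def)
    finally show "(\<lambda>k. (1 - s) * x k + s * x' k) \<in> G" by (simp add: G_def)
  qed
  have "(\<Sum>i\<in>{i\<in>I. P i \<noteq> {}}. a i) = 0"
  proof (rule euler_relation[OF A fin])
    fix i assume i: "i \<in> I"
    show "compact (P i)"
    proof (cases i)
      case (Inl xs)
      then show ?thesis by (simp add: P_def compact_Int_closed compact_walk_simplex G)
    next
      case (Inr p)
      then show ?thesis
        by (cases p) (auto simp: P_def D_def intro!: compact_Int_closed compact_cube closed_const_on closed_desc G)
    qed
    show "fun_convex (P i)"
    proof (cases i)
      case (Inl xs)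
      then show ?thesis by (simp add: P_def fun_convex_Int fun_convex_walk_simplex G')
    next
      case (Inr p)
      then show ?thesis
        by (cases p) (auto simp: P_def D_def intro!: fun_convex_Int fun_convex_cube fun_convex_const_on fun_convex_desc G')
    qed
    show "x k = 0" if x: "x \<in> P i" and k: "k \<notin> A" for x k
    proof (cases i)
      case (Inl xs)
      then have "set xs = A" using i by (auto simp: I_def permutations_of_set_def)
      then show ?thesis using x k Inl by (auto simp: P_def walk_simplex_def cube_def)
    next
      case (Inr p)
      then show ?thesis using x k by (cases p) (auto simp: P_def D_def cube_def)
    qed
  next
    fix t
    show "(\<Sum>i\<in>I. a i * indicator (P i) t) = 0"
    proof (cases "t \<in> G \<inter> cube A")
      case False
      have "t \<notin> P i" if "i \<in> I" for i
        using that False by (auto simp: I_def P_def D_def walk_simplex_def permutations_of_set_def split: sum.splits)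
      then show ?thesis by (intro sum.neutral) simp
    next
      case True
      have 1: "indicator (P (Inl xs)) t = (of_bool (desc t xs) :: real)" if "xs \<in> permutations_of_set A" for xs
        using that True by (auto simp: P_def walk_simplex_def indicator_def permutations_of_set_def)
      have 2: "indicator (P (Inr (B, zs))) t = (of_bool (\<forall>i\<in>B. \<forall>j\<in>B. t i = t j) * of_bool (desc t zs) :: real)" for B zs
      proof -
        have "t \<in> P (Inr (B, zs)) \<longleftrightarrow> (\<forall>i\<in>B. \<forall>j\<in>B. t i = t j) \<and> desc t zs"
          unfolding P_def D_def sum.case prod.case Int_iff mem_Collect_eq using True by blast
        then show ?thesis by (simp only: indicator_def of_bool_conj)
      qed
      have num: "(\<Sum>xs\<in>permutations_of_set S. of_bool (desc t xs)) = num_desc S t" for S :: "nat set"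
        by (simp add: num_desc_def Int_def)
      have "(\<Sum>i\<in>I. a i * indicator (P i) t) = (\<Sum>xs\<in>permutations_of_set A. real (card A) * of_bool (desc t xs))
          - (\<Sum>B\<in>Pow A - {{}}. \<Sum>zs\<in>permutations_of_set (A - B).
              (fact (card B) * of_bool (\<forall>i\<in>B. \<forall>j\<in>B. t i = t j)) * of_bool (desc t zs))"
        unfolding sumI 2 by (simp add: a_def 1 sum_negf mult.assoc)
      also have "\<dots> = real (card A) * num_desc A t -
          (\<Sum>B\<in>Pow A - {{}}. fact (card B) * of_bool (\<forall>i\<in>B. \<forall>j\<in>B. t i = t j) * num_desc (A - B) t)"
        by (simp only: num flip: sum_distrib_left)
      also have "(\<Sum>B\<in>Pow A - {{}}. fact (card B) * of_bool (\<forall>i\<in>B. \<forall>j\<in>B. t i = t j) * num_desc (A - B) t) =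
          (\<Sum>B\<in>{B. B \<subseteq> A \<and> B \<noteq> {} \<and> (\<forall>i\<in>B. \<forall>j\<in>B. t i = t j)}. fact (card B) * num_desc (A - B) t)"
      proof (rule sum.mono_neutral_cong_right)
        fix B assume "B \<in> {B. B \<subseteq> A \<and> B \<noteq> {} \<and> (\<forall>i\<in>B. \<forall>j\<in>B. t i = t j)}"
        then have "\<forall>i\<in>B. \<forall>j\<in>B. t i = t j" by blast
        then have "(of_bool (\<forall>i\<in>B. \<forall>j\<in>B. t i = t j) :: real) = 1" by (rule of_bool_eq_1_iff[THEN iffD2])
        then show "fact (card B) * of_bool (\<forall>i\<in>B. \<forall>j\<in>B. t i = t j) * num_desc (A - B) t = fact (card B) * num_desc (A - B) t"
          by (simp only: mult_1_right)
      qed (use A in auto)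
      finally show ?thesis using num_desc_recursion[OF A, of t] by simp
    qed
  qed
  then have zero: "(\<Sum>i\<in>I. if P i \<noteq> {} then a i else 0) = 0" unfolding sum.inter_filter[OF fin] .
  have L: "P (Inl xs) \<noteq> {} \<longleftrightarrow> z \<in> walk_hull xs y + Q" if "xs \<in> permutations_of_set A" for xs
    using permutations_of_setD(1)[OF that] unfolding mem_plus_iff_diff walk_hull_def
    by (auto simp: P_def G_def lin_def)
  \<comment> \<open>The common value of \<open>t\<close> on \<open>B\<close> parametrises
    \<open>seg (\<Sum>i\<in>B. y i)\<close> and the other coordinates parametrise
    \<open>walk_hull zs y\<close>. As \<open>D\<close> does not compare the two groups, both points
    vary independently, which yields a Minkowski sum.\<close>
  have R: "P (Inr (B, zs)) \<noteq> {} \<longleftrightarrow> z \<in> walk_hull zs y + seg (\<Sum>i\<in>B. y i) + Q"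
    if B: "B \<in> Pow A - {{}}" and zs: "zs \<in> permutations_of_set (A - B)" for B zs
  proof -
    have set: "set zs = A - B" using permutations_of_setD(1)[OF zs] .
    have split: "lin t = (\<Sum>i\<in>set zs. t i *\<^sub>R y i) + (\<Sum>i\<in>B. t i *\<^sub>R y i)" for t
      unfolding lin_def set using A B by (subst sum.subset_diff[of B A]) auto
    show ?thesis
    proof
      assume "P (Inr (B, zs)) \<noteq> {}"
      then obtain t where t: "t \<in> cube A" "\<forall>i\<in>B. \<forall>j\<in>B. t i = t j" "desc t zs" "z - lin t \<in> Q"
        unfolding P_def D_def G_def sum.case prod.case by blast
      obtain b where b: "b \<in> B" using B by auto
      define t' where "t' i = (if i \<in> A - B then t i else 0)" for i
      have "desc t' zs"
        using t(3) set unfolding desc_def t'_def by (rule_tac sorted_wrt_mono_rel[rotated]) auto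
      then have "t' \<in> walk_simplex zs" using t(1) by (auto simp: walk_simplex_def cube_def set t'_def)
      then have "(\<Sum>i\<in>set zs. t' i *\<^sub>R y i) \<in> walk_hull zs y" by (auto simp: walk_hull_def)
      also have "(\<Sum>i\<in>set zs. t' i *\<^sub>R y i) = (\<Sum>i\<in>set zs. t i *\<^sub>R y i)"
        by (intro sum.cong) (auto simp: t'_def set)
      finally have 1: "(\<Sum>i\<in>set zs. t i *\<^sub>R y i) \<in> walk_hull zs y" .
      have "(\<Sum>i\<in>B. t i *\<^sub>R y i) = (\<Sum>i\<in>B. t b *\<^sub>R y i)"
      proof (intro sum.cong refl)
        fix i assume "i \<in> B"
        then have "t i = t b" using t(2) b by blast
        then show "t i *\<^sub>R y i = t b *\<^sub>R y i" by (simp only:)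
      qed
      then have "(\<Sum>i\<in>B. t i *\<^sub>R y i) = t b *\<^sub>R (\<Sum>i\<in>B. y i)" by (simp add: scaleR_sum_right)
      moreover have "0 \<le> t b" "t b \<le> 1" using t(1) b B by (auto simp: cube_def)
      ultimately have "(\<Sum>i\<in>B. t i *\<^sub>R y i) \<in> seg (\<Sum>i\<in>B. y i)" unfolding mem_seg by blast
      with 1 have "lin t \<in> walk_hull zs y + seg (\<Sum>i\<in>B. y i)" unfolding split by (rule set_plus_intro)
      then show "z \<in> walk_hull zs y + seg (\<Sum>i\<in>B. y i) + Q" unfolding mem_plus_iff_diff[of z _ Q] using t(4) by blast
    next
      assume "z \<in> walk_hull zs y + seg (\<Sum>i\<in>B. y i) + Q"
      then obtain w where w: "w \<in> walk_hull zs y + seg (\<Sum>i\<in>B. y i)" "z - w \<in> Q"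
        unfolding mem_plus_iff_diff[of z _ Q] by blast
      obtain p q where pq: "w = p + q" "p \<in> walk_hull zs y" "q \<in> seg (\<Sum>i\<in>B. y i)"
        using w(1) by (rule set_plus_elim)
      obtain t where t: "t \<in> walk_simplex zs" "p = (\<Sum>i\<in>set zs. t i *\<^sub>R y i)" using pq(2) by (auto simp: walk_hull_def)
      obtain u where u: "0 \<le> u" "u \<le> 1" "q = u *\<^sub>R (\<Sum>i\<in>B. y i)" using pq(3) by (rule mem_segE)
      define t' where "t' i = (if i \<in> B then u else t i)" for i
      have "desc t' zs"
        using t(1) set unfolding walk_simplex_def desc_def t'_def mem_Collect_eq
        by (rule_tac sorted_wrt_mono_rel[rotated, OF conjunct2]) auto
      moreover have "t' \<in> cube A" using t(1) u B by (auto simp: walk_simplex_def cube_def set t'_def)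
      moreover have "\<forall>i\<in>B. \<forall>j\<in>B. t' i = t' j" by (simp add: t'_def)
      moreover have "lin t' = w"
      proof -
        have "(\<Sum>i\<in>set zs. t' i *\<^sub>R y i) = p" unfolding t by (intro sum.cong) (auto simp: t'_def set)
        moreover have "(\<Sum>i\<in>B. t' i *\<^sub>R y i) = q" unfolding u scaleR_sum_right by (intro sum.cong) (auto simp: t'_def)
        ultimately show ?thesis by (simp add: split pq)
      qed
      ultimately have "t' \<in> P (Inr (B, zs))" using w(2)
        unfolding P_def D_def G_def sum.case prod.case Int_iff mem_Collect_eq by (simp only: simp_thms)
      then show "P (Inr (B, zs)) \<noteq> {}" by blast
    qed
  qed
  have "(\<Sum>xs\<in>permutations_of_set A. if P (Inl xs) \<noteq> {} then a (Inl xs) else 0) =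
      (\<Sum>xs\<in>permutations_of_set A. real (card A) * indicator (walk_hull xs y + Q) z)"
  proof (intro sum.cong refl)
    fix xs assume "xs \<in> permutations_of_set A"
    then show "(if P (Inl xs) \<noteq> {} then a (Inl xs) else 0) = real (card A) * indicator (walk_hull xs y + Q) z"
      by (simp only: L) (simp add: a_def)
  qed
  moreover have "(\<Sum>B\<in>Pow A - {{}}. \<Sum>zs\<in>permutations_of_set (A - B). if P (Inr (B, zs)) \<noteq> {} then a (Inr (B, zs)) else 0) =
      (\<Sum>B\<in>Pow A - {{}}. \<Sum>zs\<in>permutations_of_set (A - B).
        - (fact (card B) * indicator (walk_hull zs y + seg (\<Sum>i\<in>B. y i) + Q) z))"
  proof (intro sum.cong refl)
    fix B zs assume "B \<in> Pow A - {{}}" "zs \<in> permutations_of_set (A - B)"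
    from R[OF this]
    show "(if P (Inr (B, zs)) \<noteq> {} then a (Inr (B, zs)) else 0) =
        - (fact (card B) * indicator (walk_hull zs y + seg (\<Sum>i\<in>B. y i) + Q) z)"
      by (simp only:) (simp add: a_def)
  qed
  ultimately show ?thesis using zero unfolding sumI by (simp only: sum_negf sum_distrib_left)
qed

text \<open>Integrates \<open>walk_hull_indicator\<close> over \<open>z\<close>.\<close>

lemma walk_hull_vol:
  fixes y :: "nat \<Rightarrow> 'a::euclidean_space"
  assumes A: "finite A" and Q: "convex_body Q"
  shows "real (card A) * (\<Sum>xs\<in>permutations_of_set A. vol (walk_hull xs y + Q)) =
    (\<Sum>B\<in>Pow A - {{}}. \<Sum>zs\<in>permutations_of_set (A - B).
      fact (card B) * vol (walk_hull zs y + seg (\<Sum>i\<in>B. y i) + Q))"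
proof -
  have i: "integrable lborel (indicator S :: 'a \<Rightarrow> real)" "integral\<^sup>L lborel (indicator S) = vol S" if "convex_body S" for S :: "'a set"
    using convex_body_fmeasurable[OF that] by (auto simp: fmeasurable_def intro!: integrable_real_indicator)
  have cb: "convex_body (walk_hull xs y + Q)" "convex_body (walk_hull xs y + seg w + Q)" for xs w
    by (intro convex_body_plus convex_body_walk_hull Q convex_body_seg)+
  have "real (card A) * (\<Sum>xs\<in>permutations_of_set A. vol (walk_hull xs y + Q)) =
      (\<integral>z. real (card A) * (\<Sum>xs\<in>permutations_of_set A. indicator (walk_hull xs y + Q) z) \<partial>lborel)"
    by (simp add: i cb)
  also have "\<dots> = (\<integral>z. (\<Sum>B\<in>Pow A - {{}}. \<Sum>zs\<in>permutations_of_set (A - B).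
      fact (card B) * indicator (walk_hull zs y + seg (\<Sum>i\<in>B. y i) + Q) z) \<partial>lborel)"
    by (simp only: walk_hull_indicator[OF A Q])
  also have "\<dots> = (\<Sum>B\<in>Pow A - {{}}. \<Sum>zs\<in>permutations_of_set (A - B).
      fact (card B) * vol (walk_hull zs y + seg (\<Sum>i\<in>B. y i) + Q))"
    by (simp only: Bochner_Integration.integral_sum Bochner_Integration.integrable_sum integrable_mult_right i cb)
      (simp add: i cb)
  finally show ?thesis .
qed

text \<open>The indicators of initial segments are mapped to the partial sums, which gives one
  inclusion; Abel summation gives the other.\<close>

lemma walk_hull_upt:
  fixes y :: "nat \<Rightarrow> 'a::euclidean_space"
  shows "walk_hull [0..<N] y = convex hull ((\<lambda>k. \<Sum>i<k. y i) ` {..N})"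
proof
  define S where "S k = (\<Sum>i<k. y i)" for k
  have conv: "convex (walk_hull [0..<N] y)" using convex_body_walk_hull[of "[0..<N]" y] by (simp add: convex_body_def)
  have "S k \<in> walk_hull [0..<N] y" if k: "k \<le> N" for k
  proof -
    have "desc (indicator {..<k}) [0..<N]"
      by (auto simp: desc_def sorted_wrt_iff_nth_less indicator_def)
    then have "indicator {..<k} \<in> walk_simplex [0..<N]" using k by (auto simp: walk_simplex_def cube_def indicator_def)
    moreover have "S k = (\<Sum>i\<in>set [0..<N]. indicator {..<k} i *\<^sub>R y i)"
      unfolding S_def using k by (intro sum.mono_neutral_cong_left) (auto simp: indicator_def)
    ultimately show ?thesis unfolding walk_hull_def by blast
  qed
  then show "convex hull ((\<lambda>k. \<Sum>i<k. y i) ` {..N}) \<subseteq> walk_hull [0..<N] y"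
    by (intro hull_minimal conv) (auto simp: S_def)
  show "walk_hull [0..<N] y \<subseteq> convex hull ((\<lambda>k. \<Sum>i<k. y i) ` {..N})"
  proof
    fix z assume "z \<in> walk_hull [0..<N] y"
    then obtain t where t: "t \<in> walk_simplex [0..<N]" "z = (\<Sum>i<N. t i *\<^sub>R y i)"
      by (auto simp: walk_hull_def lessThan_atLeast0)
    \<comment> \<open>The sequence \<open>t\<close> delayed by one place, with the value 1 in front.
      Together with \<open>t N = 0\<close> this makes the differences \<open>t' k - t k\<close>
      nonnegative with sum 1: they are the barycentric weights of the partial sums.\<close>
    define t' where "t' k = (if k = 0 then 1 else t (k - 1))" for k
    have tN: "t N = 0" using t(1) by (simp add: walk_simplex_def cube_def)
    have mono: "t j \<le> t i" if "i < j" "j < N" for i j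
      using t(1) that by (auto simp: walk_simplex_def desc_def sorted_wrt_iff_nth_less)
    have c: "t k \<le> t' k" if "k \<le> N" for k
    proof (cases k)
      case 0
      then show ?thesis using t(1) by (auto simp: t'_def walk_simplex_def cube_def)
    next
      case (Suc m)
      then show ?thesis using that mono[of m k] t(1) tN by (cases "k = N") (auto simp: t'_def walk_simplex_def cube_def)
    qed
    have abel: "(\<Sum>k\<le>n. (t' k - t k) *\<^sub>R S k) = (\<Sum>i<n. t i *\<^sub>R y i) - t n *\<^sub>R S n" for n
      by (induction n) (auto simp: S_def t'_def algebra_simps)
    have one: "(\<Sum>k\<le>n. t' k - t k) = 1 - t n" for n by (induction n) (auto simp: t'_def)
    have "(\<Sum>k\<le>N. (t' k - t k) *\<^sub>R S k) \<in> convex hull (S ` {..N})"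
      by (intro convex_sum) (auto simp: one tN c intro: hull_inc)
    then show "z \<in> convex hull ((\<lambda>k. \<Sum>i<k. y i) ` {..N})"
      unfolding abel by (simp add: tN t(2) S_def[abs_def])
  qed
qed

subsection \<open>Coefficient asymptotics of products of power series\<close>

text \<open>The coefficients of \<open>(1 - z)\<close> to the power \<open>- \<beta>\<close>, as a scale of comparison for powers of \<open>n\<close> that
is closed under convolution.\<close>

definition neg_binomial :: "real \<Rightarrow> nat \<Rightarrow> real" where
  "neg_binomial \<beta> n = pochhammer \<beta> n / fact n"

lemma neg_binomial_pos: "0 < \<beta> \<Longrightarrow> 0 < neg_binomial \<beta> n"
  by (simp add: neg_binomial_def pochhammer_pos)

lemma neg_binomial_one: "neg_binomial 1 n = 1"
  by (simp add: neg_binomial_def flip: pochhammer_fact)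

text \<open>For positive \<open>n\<close> the quotient is the reciprocal of
  \<open>Gamma_series' \<beta> n\<close>, an approximant of \<open>Gamma \<beta>\<close>.\<close>

lemma neg_binomial_asymp:
  assumes "0 < \<beta>"
  shows "(\<lambda>n. neg_binomial \<beta> n / real n powr (\<beta> - 1)) \<longlonglongrightarrow> 1 / Gamma \<beta>"
proof -
  have nz: "Gamma \<beta> \<noteq> 0" using Gamma_real_pos[OF assms] by simp
  have "(\<lambda>n. inverse (Gamma_series' \<beta> n)) \<longlonglongrightarrow> inverse (Gamma \<beta>)"
    by (intro tendsto_inverse Gamma_series'_LIMSEQ nz)
  moreover have "\<forall>\<^sub>F n in sequentially. inverse (Gamma_series' \<beta> n) = neg_binomial \<beta> n / real n powr (\<beta> - 1)"
    using eventually_gt_at_top[of 0]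
  proof eventually_elim
    case (elim n)
    then have "fact n = real n * fact (n - 1)" by (simp add: fact_reduce)
    moreover have "real n powr \<beta> = real n * real n powr (\<beta> - 1)"
      using elim by (simp add: powr_diff)
    moreover have "exp (\<beta> * ln (real n)) = real n powr \<beta>" using elim by (simp add: powr_def)
    ultimately show ?case using elim by (simp add: Gamma_series'_def neg_binomial_def field_simps)
  qed
  ultimately show ?thesis by (simp add: tendsto_cong inverse_eq_divide)
qed

text \<open>The quotient has order \<open>n powr (- \<beta>)\<close>, so finitely many initial terms
  of a convolution are negligible.\<close>

lemma neg_binomial_shift_tendsto_0:
  assumes "0 < \<beta>" "0 < \<gamma>"
  shows "(\<lambda>n. neg_binomial \<gamma> (n - k) / neg_binomial (\<beta> + \<gamma>) n) \<longlonglongrightarrow> 0"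
proof -
  have G: "Gamma (\<beta> + \<gamma>) \<noteq> 0"
    by (rule less_imp_neq[THEN not_sym]) (simp add: Gamma_real_pos assms add_pos_pos)
  have 1: "(\<lambda>n. neg_binomial \<gamma> (n - k) / real (n - k) powr (\<gamma> - 1)) \<longlonglongrightarrow> 1 / Gamma \<gamma>"
    by (rule filterlim_compose[OF neg_binomial_asymp[OF assms(2)]]) (rule filterlim_minus_const_nat_at_top)
  have 2: "(\<lambda>n. neg_binomial (\<beta> + \<gamma>) n / real n powr (\<beta> + \<gamma> - 1)) \<longlonglongrightarrow> 1 / Gamma (\<beta> + \<gamma>)"
    using assms by (intro neg_binomial_asymp) simp
  have 3: "(\<lambda>n. real (n - k) powr (\<gamma> - 1) / real n powr (\<beta> + \<gamma> - 1)) \<longlonglongrightarrow> 0"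
  proof -
    have "(\<lambda>n. (real n - real k) powr (\<gamma> - 1) / real n powr (\<beta> + \<gamma> - 1)) \<longlonglongrightarrow> 0"
      using assms by real_asymp
    then show ?thesis
      by (rule Lim_transform_eventually) (use eventually_ge_at_top[of k] in eventually_elim, simp add: of_nat_diff)
  qed
  have "(\<lambda>n. (neg_binomial \<gamma> (n - k) / real (n - k) powr (\<gamma> - 1)) * (real (n - k) powr (\<gamma> - 1) / real n powr (\<beta> + \<gamma> - 1))
      / (neg_binomial (\<beta> + \<gamma>) n / real n powr (\<beta> + \<gamma> - 1))) \<longlonglongrightarrow> (1 / Gamma \<gamma>) * 0 / (1 / Gamma (\<beta> + \<gamma>))"
    using G by (intro tendsto_intros 1 2 3) simp
  moreover have "\<forall>\<^sub>F n in sequentially. (neg_binomial \<gamma> (n - k) / real (n - k) powr (\<gamma> - 1)) * (real (n - k) powr (\<gamma> - 1) / real n powr (\<beta> + \<gamma> - 1))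
      / (neg_binomial (\<beta> + \<gamma>) n / real n powr (\<beta> + \<gamma> - 1)) = neg_binomial \<gamma> (n - k) / neg_binomial (\<beta> + \<gamma>) n"
    using eventually_gt_at_top[of k] by eventually_elim auto
  ultimately have "(\<lambda>n. neg_binomial \<gamma> (n - k) / neg_binomial (\<beta> + \<gamma>) n) \<longlonglongrightarrow> (1 / Gamma \<gamma>) * 0 / (1 / Gamma (\<beta> + \<gamma>))"
    by (rule Lim_transform_eventually)
  then show ?thesis by simp
qed

definition neg_binomial_fps :: "real \<Rightarrow> real fps" where
  "neg_binomial_fps \<beta> = Abs_fps (neg_binomial \<beta>)"

text \<open>Vandermonde's identity for rising factorials: exponents of \<open>1 - z\<close>
  add.\<close>

lemma neg_binomial_fps_mult: "neg_binomial_fps \<beta> * neg_binomial_fps \<gamma> = neg_binomial_fps (\<beta> + \<gamma>)"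
proof (rule fps_ext)
  fix n
  have "neg_binomial (\<beta> + \<gamma>) n = (\<Sum>k\<le>n. real (n choose k) * pochhammer \<beta> k * pochhammer \<gamma> (n - k) / fact n)"
    by (simp add: neg_binomial_def pochhammer_binomial_sum sum_divide_distrib)
  also have "\<dots> = (\<Sum>k\<le>n. neg_binomial \<beta> k * neg_binomial \<gamma> (n - k))"
    by (intro sum.cong) (auto simp: neg_binomial_def binomial_fact)
  finally show "fps_nth (neg_binomial_fps \<beta> * neg_binomial_fps \<gamma>) n = fps_nth (neg_binomial_fps (\<beta> + \<gamma>)) n"
    by (simp add: neg_binomial_fps_def fps_mult_nth atLeast0AtMost)
qed

text \<open>The convolution is split at an index \<open>M\<close>. Below it
  \<open>neg_binomial_shift_tendsto_0\<close> applies; from it on the coefficients of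
  \<open>f\<close> are at most \<open>e\<close> times the comparison sequence, whose convolution is
  exact by \<open>neg_binomial_fps_mult\<close>.\<close>

lemma fps_mult_tendsto_0:
  fixes f g :: "real fps"
  assumes \<beta>: "0 < \<beta>" and \<gamma>: "0 < \<gamma>"
    and f: "(\<lambda>n. fps_nth f n / neg_binomial \<beta> n) \<longlonglongrightarrow> 0" and g: "\<And>n. \<bar>fps_nth g n\<bar> \<le> C * neg_binomial \<gamma> n"
  shows "(\<lambda>n. fps_nth (f * g) n / neg_binomial (\<beta> + \<gamma>) n) \<longlonglongrightarrow> 0"
proof (rule LIMSEQ_I)
  fix r :: real assume r: "0 < r"
  have "0 \<le> \<bar>fps_nth g 0\<bar>" by simp
  also have "\<dots> \<le> C * neg_binomial \<gamma> 0" by (rule g)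
  finally have C: "0 \<le> C" using neg_binomial_pos[OF \<gamma>, of 0] by (simp add: zero_le_mult_iff)
  \<comment> \<open>\<open>C + 1\<close> avoids a zero denominator. The tail then costs at most
    \<open>r / 2\<close>, and the head \<open>S n\<close> may cost \<open>r / 4\<close>.\<close>
  define e where "e = r / (2 * (C + 1))"
  have e: "0 < e" "C * e < r / 2 + r / 4"
  proof -
    show "0 < e" using r C by (simp add: e_def)
    have "C * e \<le> (C + 1) * e" using \<open>0 < e\<close> by (simp add: mult_right_mono)
    also have "\<dots> = r / 2" using C by (simp add: e_def field_simps)
    finally show "C * e < r / 2 + r / 4" using r by simp
  qed
  obtain M where M: "\<And>k. M \<le> k \<Longrightarrow> \<bar>fps_nth f k / neg_binomial \<beta> k\<bar> < e"
    using LIMSEQ_D[OF f e(1)] by auto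
  have M': "\<bar>fps_nth f k\<bar> \<le> e * neg_binomial \<beta> k" if "M \<le> k" for k
  proof -
    have "\<bar>fps_nth f k\<bar> / neg_binomial \<beta> k < e" using M[OF that] neg_binomial_pos[OF \<beta>, of k] by (simp add: abs_divide)
    then show ?thesis using neg_binomial_pos[OF \<beta>, of k] by (simp add: field_simps)
  qed
  define S where "S n = (\<Sum>k<M. \<bar>fps_nth f k\<bar> * (C * (neg_binomial \<gamma> (n - k) / neg_binomial (\<beta> + \<gamma>) n)))" for n
  have "S \<longlonglongrightarrow> (\<Sum>k<M. \<bar>fps_nth f k\<bar> * (C * 0))"
    unfolding S_def by (intro tendsto_intros neg_binomial_shift_tendsto_0 \<beta> \<gamma>)
  then have "S \<longlonglongrightarrow> 0" by simp
  then obtain N where N: "\<And>n. N \<le> n \<Longrightarrow> \<bar>S n\<bar> < r / 4" using LIMSEQ_D[of S 0 "r / 4"] r by auto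
  show "\<exists>no. \<forall>n\<ge>no. norm (fps_nth (f * g) n / neg_binomial (\<beta> + \<gamma>) n - 0) < r"
  proof (intro exI[of _ "max M N"] allI impI)
    fix n assume n: "max M N \<le> n"
    have p: "0 < neg_binomial (\<beta> + \<gamma>) n" using \<beta> \<gamma> by (intro neg_binomial_pos) simp
    have "\<bar>fps_nth (f * g) n\<bar> \<le> (\<Sum>k\<le>n. \<bar>fps_nth f k\<bar> * \<bar>fps_nth g (n - k)\<bar>)"
      by (simp add: fps_mult_nth atLeast0AtMost abs_mult[symmetric] sum_abs)
    also have "\<dots> \<le> (\<Sum>k\<le>n. (if k < M then \<bar>fps_nth f k\<bar> * (C * neg_binomial \<gamma> (n - k)) else 0) + C * e * (neg_binomial \<beta> k * neg_binomial \<gamma> (n - k)))"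
    proof (intro sum_mono)
      fix k
      have gk: "0 \<le> C * neg_binomial \<gamma> (n - k)" "0 \<le> C * e * (neg_binomial \<beta> k * neg_binomial \<gamma> (n - k))"
        using C e(1) neg_binomial_pos[OF \<gamma>] neg_binomial_pos[OF \<beta>] by (simp_all add: less_imp_le)
      have 1: "\<bar>fps_nth f k\<bar> * \<bar>fps_nth g (n - k)\<bar> \<le> \<bar>fps_nth f k\<bar> * (C * neg_binomial \<gamma> (n - k))"
        by (intro mult_left_mono g) simp
      show "\<bar>fps_nth f k\<bar> * \<bar>fps_nth g (n - k)\<bar> \<le>
        (if k < M then \<bar>fps_nth f k\<bar> * (C * neg_binomial \<gamma> (n - k)) else 0) + C * e * (neg_binomial \<beta> k * neg_binomial \<gamma> (n - k))"
      proof (cases "k < M")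
        case True
        then show ?thesis using 1 gk(2) by simp
      next
        case False
        then have "\<bar>fps_nth f k\<bar> * (C * neg_binomial \<gamma> (n - k)) \<le> e * neg_binomial \<beta> k * (C * neg_binomial \<gamma> (n - k))"
          by (intro mult_right_mono M' gk) simp
        then show ?thesis using False 1 by (simp add: mult_ac)
      qed
    qed
    also have "\<dots> = (\<Sum>k<M. \<bar>fps_nth f k\<bar> * (C * neg_binomial \<gamma> (n - k))) + C * e * neg_binomial (\<beta> + \<gamma>) n"
    proof -
      have "(\<Sum>k\<le>n. neg_binomial \<beta> k * neg_binomial \<gamma> (n - k)) = neg_binomial (\<beta> + \<gamma>) n"
        using arg_cong[OF neg_binomial_fps_mult[of \<beta> \<gamma>], of "\<lambda>F. fps_nth F n"]
        by (simp add: neg_binomial_fps_def fps_mult_nth atLeast0AtMost)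
      moreover have "(\<Sum>k\<le>n. if k < M then \<bar>fps_nth f k\<bar> * (C * neg_binomial \<gamma> (n - k)) else 0) =
          (\<Sum>k<M. \<bar>fps_nth f k\<bar> * (C * neg_binomial \<gamma> (n - k)))"
        using n by (intro sum.mono_neutral_cong_right) auto
      ultimately show ?thesis by (simp add: sum.distrib flip: sum_distrib_left)
    qed
    finally have "\<bar>fps_nth (f * g) n\<bar> / neg_binomial (\<beta> + \<gamma>) n \<le> S n + C * e"
      using p by (simp add: S_def divide_le_eq distrib_right sum_distrib_right)
    also have "\<dots> < r" using N[of n] n e(2) r by simp
    finally show "norm (fps_nth (f * g) n / neg_binomial (\<beta> + \<gamma>) n - 0) < r" using p by (simp add: abs_divide)
  qed
qed

text \<open>Subtracting from each factor its multiple of the comparison series leaves two products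
  covered by \<open>fps_mult_tendsto_0\<close> and one exact product.\<close>

lemma fps_mult_asymp:
  fixes f g :: "real fps"
  assumes \<beta>: "0 < \<beta>" and \<gamma>: "0 < \<gamma>"
    and f: "(\<lambda>n. fps_nth f n / neg_binomial \<beta> n) \<longlonglongrightarrow> c" and g: "(\<lambda>n. fps_nth g n / neg_binomial \<gamma> n) \<longlonglongrightarrow> c'"
  shows "(\<lambda>n. fps_nth (f * g) n / neg_binomial (\<beta> + \<gamma>) n) \<longlonglongrightarrow> c * c'"
proof -
  have p: "neg_binomial \<beta> n \<noteq> 0" "neg_binomial \<gamma> n \<noteq> 0" "neg_binomial (\<beta> + \<gamma>) n \<noteq> 0" for n
    using neg_binomial_pos[OF \<beta>, of n] neg_binomial_pos[OF \<gamma>, of n] neg_binomial_pos[of "\<beta> + \<gamma>" n] \<beta> \<gamma> by simp_all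
  have f0: "(\<lambda>n. fps_nth (f - fps_const c * neg_binomial_fps \<beta>) n / neg_binomial \<beta> n) \<longlonglongrightarrow> 0"
    using tendsto_diff[OF f tendsto_const[of c]] p by (simp add: neg_binomial_fps_def diff_divide_distrib)
  have g0: "(\<lambda>n. fps_nth (g - fps_const c' * neg_binomial_fps \<gamma>) n / neg_binomial \<gamma> n) \<longlonglongrightarrow> 0"
    using tendsto_diff[OF g tendsto_const[of c']] p by (simp add: neg_binomial_fps_def diff_divide_distrib)
  obtain C where C: "\<And>n. \<bar>fps_nth g n / neg_binomial \<gamma> n\<bar> \<le> C"
    using convergent_imp_Bseq[OF convergentI[OF g]] by (auto simp: Bseq_def)
  have gC: "\<bar>fps_nth g n\<bar> \<le> C * neg_binomial \<gamma> n" for n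
    using C[of n] neg_binomial_pos[OF \<gamma>, of n] by (simp add: abs_divide divide_le_eq)
  have rC: "\<bar>fps_nth (neg_binomial_fps \<beta>) n\<bar> \<le> 1 * neg_binomial \<beta> n" for n
    using neg_binomial_pos[OF \<beta>, of n] by (simp add: neg_binomial_fps_def)
  have eq: "f * g = (f - fps_const c * neg_binomial_fps \<beta>) * g + fps_const c * ((g - fps_const c' * neg_binomial_fps \<gamma>) * neg_binomial_fps \<beta>)
      + fps_const (c * c') * neg_binomial_fps (\<beta> + \<gamma>)"
    by (simp add: neg_binomial_fps_mult[symmetric] algebra_simps flip: fps_const_mult)
  have "(\<lambda>n. fps_nth ((f - fps_const c * neg_binomial_fps \<beta>) * g) n / neg_binomial (\<beta> + \<gamma>) n
      + c * (fps_nth ((g - fps_const c' * neg_binomial_fps \<gamma>) * neg_binomial_fps \<beta>) n / neg_binomial (\<gamma> + \<beta>) n) + c * c') \<longlonglongrightarrow> 0 + c * 0 + c * c'"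
    by (intro tendsto_intros fps_mult_tendsto_0[OF \<beta> \<gamma> f0 gC] fps_mult_tendsto_0[OF \<gamma> \<beta> g0 rC])
  moreover have "fps_nth (f * g) n / neg_binomial (\<beta> + \<gamma>) n = fps_nth ((f - fps_const c * neg_binomial_fps \<beta>) * g) n / neg_binomial (\<beta> + \<gamma>) n
      + c * (fps_nth ((g - fps_const c' * neg_binomial_fps \<gamma>) * neg_binomial_fps \<beta>) n / neg_binomial (\<gamma> + \<beta>) n) + c * c'" for n
    using p(3)[of n] by (subst eq) (simp add: add_divide_distrib neg_binomial_fps_def add.commute[of \<gamma>])
  ultimately show ?thesis by simp
qed

definition ones_fps :: "real fps" where
  "ones_fps = Abs_fps (\<lambda>_. 1)"

text \<open>The polylogarithm of order \<open>1 - \<beta>\<close>. Applying \<open>z d/dz\<close> to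
  it gives the series with the weights \<open>k powr \<beta>\<close> of the recursion.\<close>

definition powr_fps :: "real \<Rightarrow> real fps" where
  "powr_fps \<beta> = Abs_fps (\<lambda>k. if k = 0 then 0 else real k powr (\<beta> - 1))"

definition hull_coeff :: "real \<Rightarrow> nat \<Rightarrow> nat \<Rightarrow> real" where
  "hull_coeff \<beta> j n = fps_nth (ones_fps * powr_fps \<beta> ^ j) n / fact j"

text \<open>The series \<open>ones_fps\<close> has comparison exponent 1, and each factor
  \<open>powr_fps \<beta>\<close> adds \<open>\<beta>\<close> to the exponent and a factor
  \<open>Gamma \<beta>\<close>. The comparison sequence of exponent \<open>1 + j * \<beta>\<close>
  then supplies the power of \<open>n\<close> and the Gamma value in the denominator.\<close>

lemma hull_coeff_asymp:
  assumes \<beta>: "0 < \<beta>"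
  shows "(\<lambda>n. fact j * hull_coeff \<beta> j n / real n powr (real j * \<beta>)) \<longlonglongrightarrow> Gamma \<beta> ^ j / Gamma (real j * \<beta> + 1)"
proof -
  have G: "Gamma \<beta> \<noteq> 0" using Gamma_real_pos[OF \<beta>] by simp
  have one: "(\<lambda>n. fps_nth ones_fps n / neg_binomial 1 n) \<longlonglongrightarrow> 1" by (simp add: ones_fps_def neg_binomial_one)
  have pow: "(\<lambda>n. fps_nth (powr_fps \<beta>) n / neg_binomial \<beta> n) \<longlonglongrightarrow> Gamma \<beta>"
  proof -
    have "(\<lambda>n. inverse (neg_binomial \<beta> n / real n powr (\<beta> - 1))) \<longlonglongrightarrow> inverse (1 / Gamma \<beta>)"
      using G by (intro tendsto_inverse neg_binomial_asymp \<beta>) simp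
    moreover have "\<forall>\<^sub>F n in sequentially. inverse (neg_binomial \<beta> n / real n powr (\<beta> - 1)) = fps_nth (powr_fps \<beta>) n / neg_binomial \<beta> n"
      using eventually_gt_at_top[of 0] by eventually_elim (simp add: powr_fps_def)
    ultimately have "(\<lambda>n. fps_nth (powr_fps \<beta>) n / neg_binomial \<beta> n) \<longlonglongrightarrow> inverse (1 / Gamma \<beta>)"
      by (rule Lim_transform_eventually)
    then show ?thesis by simp
  qed
  have pos: "0 < 1 + real j * \<beta>" for j using \<beta> by (simp add: add_pos_nonneg)
  have lim: "(\<lambda>n. fps_nth (ones_fps * powr_fps \<beta> ^ j) n / neg_binomial (1 + real j * \<beta>) n) \<longlonglongrightarrow> Gamma \<beta> ^ j" for j
  proof (induction j)
    case 0
    then show ?case using one by simp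
  next
    case (Suc j)
    have "(\<lambda>n. fps_nth ((ones_fps * powr_fps \<beta> ^ j) * powr_fps \<beta>) n / neg_binomial ((1 + real j * \<beta>) + \<beta>) n)
        \<longlonglongrightarrow> Gamma \<beta> ^ j * Gamma \<beta>"
      by (rule fps_mult_asymp[OF pos \<beta> Suc pow])
    moreover have "(ones_fps * powr_fps \<beta> ^ j) * powr_fps \<beta> = ones_fps * powr_fps \<beta> ^ Suc j"
      by (simp add: mult_ac)
    moreover have "1 + real j * \<beta> + \<beta> = 1 + real (Suc j) * \<beta>" by (simp add: algebra_simps)
    moreover have "Gamma \<beta> ^ j * Gamma \<beta> = Gamma \<beta> ^ Suc j" by simp
    ultimately show ?case by (simp only:)
  qed
  have "(\<lambda>n. (fps_nth (ones_fps * powr_fps \<beta> ^ j) n / neg_binomial (1 + real j * \<beta>) n) *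
      (neg_binomial (1 + real j * \<beta>) n / real n powr (1 + real j * \<beta> - 1))) \<longlonglongrightarrow> Gamma \<beta> ^ j * (1 / Gamma (1 + real j * \<beta>))"
    by (intro tendsto_mult lim neg_binomial_asymp pos)
  moreover have "(fps_nth (ones_fps * powr_fps \<beta> ^ j) n / neg_binomial (1 + real j * \<beta>) n) *
      (neg_binomial (1 + real j * \<beta>) n / real n powr (1 + real j * \<beta> - 1)) = fact j * hull_coeff \<beta> j n / real n powr (real j * \<beta>)" for n
    using neg_binomial_pos[OF pos[of j], of n] by (simp add: hull_coeff_def)
  ultimately have "(\<lambda>n. fact j * hull_coeff \<beta> j n / real n powr (real j * \<beta>)) \<longlonglongrightarrow>
      Gamma \<beta> ^ j * (1 / Gamma (1 + real j * \<beta>))" by (simp only:)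
  then show ?thesis by (simp add: add.commute)
qed

lemma fps_deriv_ones: "fps_deriv ones_fps = ones_fps * ones_fps"
  by (rule fps_ext) (simp add: ones_fps_def fps_mult_nth)

lemma sum_shift_Suc_0: "(\<Sum>k=1..n. g k) = (\<Sum>i=0..n. if i = 0 then 0 else g i)" for g :: "nat \<Rightarrow> real"
  by (rule sum.mono_neutral_cong_left) auto

text \<open>With \<open>B j\<close> the generating function of \<open>hull_coeff \<beta> j\<close>,
  this is the coefficient form of
  \<open>z (B j)' = z / (1 - z) B j + z (powr_fps \<beta>)' B (j - 1)\<close>, which is the product
  rule.\<close>

lemma hull_coeff_recursion:
  "real n * hull_coeff \<beta> j n = (\<Sum>k=1..n. hull_coeff \<beta> j (n - k) +
     (if j = 0 then 0 else real k powr \<beta> * hull_coeff \<beta> (j - 1) (n - k)))"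
proof -
  let ?O = ones_fps and ?L = "powr_fps \<beta>"
  define B where "B j = fps_const (1 / fact j) * (?O * ?L ^ j)" for j
  have B: "fps_nth (B j) n = hull_coeff \<beta> j n" for j n by (simp add: B_def hull_coeff_def)
  have "fps_X * fps_deriv (B j) = (fps_X * ?O) * B j + (if j = 0 then 0 else (fps_X * fps_deriv ?L) * B (j - 1))"
  proof (cases j)
    case 0
    then show ?thesis by (simp add: B_def fps_deriv_ones mult_ac)
  next
    case (Suc m)
    have "fps_const (1 / fact (Suc m)) * of_nat (Suc m) = (fps_const (1 / fact m) :: real fps)"
      by (simp flip: fps_of_nat)
    then have *: "fps_const (1 / fact (Suc m)) * (of_nat (Suc m) * F) = fps_const (1 / fact m) * F" for F :: "real fps"
      by (simp only: mult.assoc[symmetric])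
    have "fps_deriv (B (Suc m)) = fps_const (1 / fact (Suc m)) * (?O * ?O * ?L ^ Suc m)
        + fps_const (1 / fact (Suc m)) * (of_nat (Suc m) * (?O * fps_deriv ?L * ?L ^ m))"
      unfolding B_def by (simp add: fps_deriv_ones fps_deriv_power' algebra_simps del: of_nat_Suc power_Suc)
    then show ?thesis unfolding * Suc by (simp add: B_def algebra_simps)
  qed
  from arg_cong[OF this, of "\<lambda>F. fps_nth F n"]
  have "real n * hull_coeff \<beta> j n = fps_nth ((fps_X * ?O) * B j) n + (if j = 0 then 0 else fps_nth ((fps_X * fps_deriv ?L) * B (j - 1)) n)"
    by (cases n) (auto simp: B)
  also have "fps_nth ((fps_X * ?O) * B j) n = (\<Sum>k=1..n. hull_coeff \<beta> j (n - k))"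
    unfolding fps_mult_nth[of "fps_X * ?O"] sum_shift_Suc_0
    by (intro sum.cong) (auto simp: B ones_fps_def)
  also have "fps_nth ((fps_X * fps_deriv ?L) * B (j - 1)) n = (\<Sum>k=1..n. real k powr \<beta> * hull_coeff \<beta> (j - 1) (n - k))"
    unfolding fps_mult_nth[of "fps_X * fps_deriv ?L"] sum_shift_Suc_0
  proof (intro sum.cong refl)
    fix k
    have "real k * real k powr (\<beta> - 1) = real k powr \<beta>" if "k \<noteq> 0" using that by (simp add: powr_diff)
    then show "fps_nth (fps_X * fps_deriv ?L) k * fps_nth (B (j - 1)) (n - k) =
        (if k = 0 then 0 else real k powr \<beta> * hull_coeff \<beta> (j - 1) (n - k))"
      by (cases k) (auto simp: B powr_fps_def)
  qed
  finally show ?thesis by (simp add: sum.distrib)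
qed

lemma hull_coeff_0: "hull_coeff \<beta> j 0 = (if j = 0 then 1 else 0)"
  by (simp add: hull_coeff_def ones_fps_def powr_fps_def power_0_left fps_power_zeroth_eq_one fps_nth_power_0)

subsection \<open>Random walks whose steps have a common zonoid\<close>

lemma walk_hull_subset:
  fixes y z :: "nat \<Rightarrow> 'a::euclidean_space"
  shows "walk_hull xs y \<subseteq> walk_hull xs z + cball 0 (\<Sum>i\<in>set xs. dist (y i) (z i))"
proof
  fix p assume "p \<in> walk_hull xs y"
  then obtain t where t: "t \<in> walk_simplex xs" "p = (\<Sum>i\<in>set xs. t i *\<^sub>R y i)" by (auto simp: walk_hull_def)
  have p: "p = (\<Sum>i\<in>set xs. t i *\<^sub>R z i) + (\<Sum>i\<in>set xs. t i *\<^sub>R (y i - z i))"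
    unfolding t(2) by (simp add: sum.distrib[symmetric] scaleR_diff_right)
  have "norm (\<Sum>i\<in>set xs. t i *\<^sub>R (y i - z i)) \<le> (\<Sum>i\<in>set xs. norm (t i *\<^sub>R (y i - z i)))"
    by (rule norm_sum)
  also have "\<dots> \<le> (\<Sum>i\<in>set xs. dist (y i) (z i))"
    using t(1) by (intro sum_mono) (auto simp: walk_simplex_def cube_def dist_norm intro!: mult_left_le_one_le)
  finally have "(\<Sum>i\<in>set xs. t i *\<^sub>R (y i - z i)) \<in> cball 0 (\<Sum>i\<in>set xs. dist (y i) (z i))" by simp
  moreover have "(\<Sum>i\<in>set xs. t i *\<^sub>R z i) \<in> walk_hull xs z" using t(1) by (auto simp: walk_hull_def)
  ultimately show "p \<in> walk_hull xs z + cball 0 (\<Sum>i\<in>set xs. dist (y i) (z i))" unfolding p by (intro set_plus_intro)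
qed

lemma seg_sum_subset:
  fixes y z :: "nat \<Rightarrow> 'a::euclidean_space"
  shows "seg (\<Sum>i\<in>B. y i) \<subseteq> seg (\<Sum>i\<in>B. z i) + cball 0 (\<Sum>i\<in>B. dist (y i) (z i))"
proof -
  have "dist (\<Sum>i\<in>B. y i) (\<Sum>i\<in>B. z i) \<le> (\<Sum>i\<in>B. dist (y i) (z i))"
    using norm_sum[of "\<lambda>i. y i - z i" B] by (simp add: dist_norm sum_subtractf)
  then have "seg (\<Sum>i\<in>B. z i) + cball 0 (dist (\<Sum>i\<in>B. y i) (\<Sum>i\<in>B. z i)) \<subseteq>
      seg (\<Sum>i\<in>B. z i) + cball 0 (\<Sum>i\<in>B. dist (y i) (z i))"
    by (intro set_plus_mono2 subset_cball order_refl)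
  with seg_subset_plus_cball[of "\<Sum>i\<in>B. y i" "\<Sum>i\<in>B. z i"] show ?thesis by (rule order_trans)
qed

lemma continuous_vol_walk_hull:
  fixes Q :: "'a::euclidean_space set"
  assumes Q: "convex_body Q" "cball 0 t \<subseteq> Q" "0 < t"
  shows "continuous_on UNIV (\<lambda>y :: nat \<Rightarrow> 'a. vol (walk_hull xs y + seg (\<Sum>i\<in>B. y i) + Q))"
proof (rule continuous_at_imp_continuous_on, rule ballI)
  fix z :: "nat \<Rightarrow> 'a"
  let ?W = "\<lambda>y. walk_hull xs y + seg (\<Sum>i\<in>B. y i) + Q"
  let ?e1 = "\<lambda>y. \<Sum>i\<in>set xs. dist (y i) (z i)" and ?e2 = "\<lambda>y. \<Sum>i\<in>B. dist (y i) (z i)"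
  have e0: "0 \<le> ?e1 y" "0 \<le> ?e2 y" for y by (simp_all add: sum_nonneg)
  have sub: "?W y \<subseteq> ?W y' + cball 0 ((\<Sum>i\<in>set xs. dist (y i) (y' i)) + (\<Sum>i\<in>B. dist (y i) (y' i)))" for y y'
  proof -
    have "?W y \<subseteq> (walk_hull xs y' + cball 0 (\<Sum>i\<in>set xs. dist (y i) (y' i))) +
        (seg (\<Sum>i\<in>B. y' i) + cball 0 (\<Sum>i\<in>B. dist (y i) (y' i))) + Q"
      by (intro set_plus_mono2 walk_hull_subset seg_sum_subset order_refl)
    also have "\<dots> = ?W y' + (cball 0 (\<Sum>i\<in>set xs. dist (y i) (y' i)) + cball 0 (\<Sum>i\<in>B. dist (y i) (y' i)))"
      by (simp only: ac_simps)
    also have "cball 0 (\<Sum>i\<in>set xs. dist (y i) (y' i)) + cball 0 (\<Sum>i\<in>B. dist (y i) (y' i)) =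
        (cball 0 ((\<Sum>i\<in>set xs. dist (y i) (y' i)) + (\<Sum>i\<in>B. dist (y i) (y' i))) :: 'a set)"
      by (intro cball_plus sum_nonneg) auto
    finally show ?thesis .
  qed
  have tQ: "cball 0 t \<subseteq> ?W y" for y
  proof -
    have "0 + 0 \<in> walk_hull xs y + seg (\<Sum>i\<in>B. y i)" by (intro set_plus_intro zero_mem_walk_hull) simp
    then have "cball 0 t \<subseteq> Q + (walk_hull xs y + seg (\<Sum>i\<in>B. y i))" by (intro subset_plus_left Q) simp
    then show ?thesis by (simp only: ac_simps)
  qed
  have cb: "convex_body (?W y)" for y by (intro convex_body_plus convex_body_walk_hull convex_body_seg Q)
  have "((\<lambda>y. vol (?W y)) \<longlongrightarrow> vol (?W z)) (at z)"
  proof (rule tendsto_vol_hausdorff[where t = t and e = "\<lambda>y. ?e1 y + ?e2 y"])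
    show "\<forall>\<^sub>F y in at z. convex_body (?W y) \<and> cball 0 t \<subseteq> ?W y \<and> ?W y \<subseteq> ?W z + cball 0 (?e1 y + ?e2 y) \<and>
        ?W z \<subseteq> ?W y + cball 0 (?e1 y + ?e2 y) \<and> 0 \<le> ?e1 y + ?e2 y"
    proof (intro always_eventually allI conjI cb tQ sub add_nonneg_nonneg e0)
      fix y
      show "?W z \<subseteq> ?W y + cball 0 (?e1 y + ?e2 y)" using sub[of z y] by (simp only: dist_commute)
    qed
    have "continuous_on UNIV (\<lambda>y. ?e1 y + ?e2 y)"
      by (intro continuous_intros continuous_on_product_coordinates)
    then have "isCont (\<lambda>y. ?e1 y + ?e2 y) z" by (simp add: continuous_on_eq_continuous_at)
    then show "((\<lambda>y. ?e1 y + ?e2 y) \<longlongrightarrow> 0) (at z)" by (simp add: isCont_def)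
  qed (intro cb tQ Q)+
  then show "isCont (\<lambda>y. vol (?W y)) z" by (simp add: isCont_def)
qed

lemma borel_measurable_vol_walk_hull:
  fixes Q :: "'a::euclidean_space set"
  assumes Q: "convex_body Q" "cball 0 t \<subseteq> Q" "0 < t" and \<nu>: "sets \<nu> = sets borel"
    and sub: "set xs \<subseteq> A" "B \<subseteq> A"
  shows "(\<lambda>y. vol (walk_hull xs y + seg (\<Sum>i\<in>B. y i) + Q)) \<in> borel_measurable (\<Pi>\<^sub>M i\<in>A. \<nu>)"
proof -
  let ?F = "\<lambda>y. vol (walk_hull xs y + seg (\<Sum>i\<in>B. y i) + Q)"
  \<comment> \<open>Continuity is known on the full product over \<open>nat\<close>. Extension by 0
    maps the product over \<open>A\<close> measurably into it and changes neither the hull nor the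
    sum, which only involve indices in \<open>A\<close>.\<close>
  let ?ext = "\<lambda>y i. if i \<in> A then y i else 0 :: 'a"
  have coord: "(\<lambda>y. y i) \<in> borel_measurable (\<Pi>\<^sub>M i\<in>A. \<nu>)" if "i \<in> A" for i
    using measurable_component_singleton[OF that, of "\<lambda>_. \<nu>"] unfolding measurable_cong_sets[OF refl \<nu>] .
  have "?ext \<in> borel_measurable (\<Pi>\<^sub>M i\<in>A. \<nu>)"
  proof (rule measurable_coordinatewise_then_product)
    show "(\<lambda>y. ?ext y i) \<in> borel_measurable (\<Pi>\<^sub>M i\<in>A. \<nu>)" for i
      using coord[of i] by (cases "i \<in> A") simp_all
  qed
  then have "(\<lambda>y. ?F (?ext y)) \<in> borel_measurable (\<Pi>\<^sub>M i\<in>A. \<nu>)"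
    by (rule measurable_compose) (intro borel_measurable_continuous_onI continuous_vol_walk_hull[OF Q])
  moreover have "?F (?ext y) = ?F y" for y
  proof -
    have "walk_hull xs (?ext y) = walk_hull xs y"
      unfolding walk_hull_def using sub by (intro image_cong refl sum.cong) auto
    moreover have "(\<Sum>i\<in>B. ?ext y i) = (\<Sum>i\<in>B. y i)" using sub by (intro sum.cong) auto
    ultimately show ?thesis by simp
  qed
  ultimately show ?thesis by simp
qed

text \<open>The arbitrary values \<open>w i\<close> absorb the default value that a restricted
  function takes outside its index set.\<close>

lemma walk_hull_reindex:
  fixes y :: "nat \<Rightarrow> 'a::euclidean_space"
  assumes "distinct xs" and n: "n = length xs"
  shows "walk_hull [0..<n] (\<lambda>i. if i < n then y (xs ! i) else w i) = walk_hull xs y"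
proof -
  have bij: "bij_betw ((!) xs) {..<n} (set xs)" using assms by (simp add: bij_betw_nth)
  have inj: "inj_on ((!) xs) {..<n}" using bij by (rule bij_betw_imp_inj_on)
  have sum: "(\<Sum>i\<in>set xs. t i *\<^sub>R y i) = (\<Sum>i\<in>set [0..<n]. t (xs ! i) *\<^sub>R y (xs ! i))" for t
    using sum.reindex_bij_betw[OF bij, of "\<lambda>i. t i *\<^sub>R y i"] by (simp add: lessThan_atLeast0)
  show ?thesis
  proof (intro equalityI subsetI)
    fix p assume "p \<in> walk_hull [0..<n] (\<lambda>i. if i < n then y (xs ! i) else w i)"
    then obtain s where s: "s \<in> walk_simplex [0..<n]" "p = (\<Sum>i\<in>set [0..<n]. s i *\<^sub>R (if i < n then y (xs ! i) else w i))"
      by (auto simp: walk_hull_def)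
    define t where "t x = (if x \<in> set xs then s (inv_into {..<n} ((!) xs) x) else 0)" for x
    have t: "t (xs ! i) = s i" if "i < n" for i
      using that n inv_into_f_f[OF inj, of i] by (simp add: t_def)
    have "t \<in> walk_simplex xs"
      unfolding walk_simplex_def cube_def mem_Collect_eq
    proof (intro conjI ballI allI impI)
      fix x assume "x \<in> set xs"
      then obtain i where "i < n" "x = xs ! i" using n by (auto simp: in_set_conv_nth)
      then show "0 \<le> t x" "t x \<le> 1" using t s(1) by (auto simp: walk_simplex_def cube_def)
    next
      show "desc t xs" using s(1) t n by (auto simp: walk_simplex_def desc_def sorted_wrt_iff_nth_less)
    qed (simp add: t_def)
    moreover have "p = (\<Sum>i\<in>set xs. t i *\<^sub>R y i)"
      unfolding sum s(2) by (intro sum.cong) (auto simp: t)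
    ultimately show "p \<in> walk_hull xs y" by (auto simp: walk_hull_def)
  next
    fix p assume "p \<in> walk_hull xs y"
    then obtain t where t: "t \<in> walk_simplex xs" "p = (\<Sum>i\<in>set xs. t i *\<^sub>R y i)" by (auto simp: walk_hull_def)
    define s where "s i = (if i < n then t (xs ! i) else 0)" for i
    have "s \<in> walk_simplex [0..<n]"
      using t(1) n by (auto simp: walk_simplex_def cube_def desc_def sorted_wrt_iff_nth_less s_def)
    moreover have "p = (\<Sum>i\<in>set [0..<n]. s i *\<^sub>R (if i < n then y (xs ! i) else w i))"
      unfolding t(2) sum by (intro sum.cong) (auto simp: s_def)
    ultimately show "p \<in> walk_hull [0..<n] (\<lambda>i. if i < n then y (xs ! i) else w i)" by (auto simp: walk_hull_def)
  qed
qed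

lemma walk_hull_Nil: "walk_hull [] y = {0}"
  using zero_mem_walk_simplex[of "[]"] by (auto simp: walk_hull_def)

text \<open>Interpolation applied to the shifted polynomial, whose linear coefficient is the
  derivative at \<open>s\<close>.\<close>

lemma poly_pderiv_interpolation:
  fixes q :: "real poly"
  assumes "degree q \<le> d"
  shows "poly (pderiv q) s = (\<Sum>i\<le>d. coeff (interp_basis d i) 1 * poly q (s + real i))"
proof -
  let ?r = "pcompose q [:s, 1:]"
  have "degree ?r \<le> d" using assms by (simp add: degree_pcompose)
  from coeff_interpolation[OF this, of 1]
  have "coeff ?r 1 = (\<Sum>i\<le>d. coeff (interp_basis d i) 1 * poly q (s + real i))" by (simp add: poly_pcompose)
  moreover have "coeff ?r 1 = poly (pderiv ?r) 0" by (simp add: poly_0_coeff_0 coeff_pderiv)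
  moreover have "poly (pderiv ?r) 0 = poly (pderiv q) s"
    by (simp add: pderiv_pcompose poly_pcompose pderiv_pCons)
  ultimately show ?thesis by simp
qed

text \<open>The form of stability on which the recursion runs: on average, a sum of
  \<open>card B\<close> independent steps spans the segment body of one step, dilated by
  \<open>card B powr \<beta>\<close>.\<close>

locale zonoid_walk =
  fixes \<nu> :: "'a::euclidean_space measure" and L :: "'a set" and \<beta> :: real
  assumes prob_\<nu>: "prob_space \<nu>" and sets_\<nu>: "sets \<nu> = sets borel" and L: "convex_body L"
    and zonoid_sum: "\<And>B. finite B \<Longrightarrow> B \<noteq> {} \<Longrightarrow>
      zonoid_of (\<Pi>\<^sub>M i\<in>(B::nat set). \<nu>) (\<lambda>y. \<Sum>i\<in>B. y i) (dil (real (card B) powr \<beta>) L)"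
begin

sublocale prob_space \<nu> by (rule prob_\<nu>)

sublocale product_sigma_finite "\<lambda>_ :: nat. \<nu>" ..

text \<open>The test bodies for which volumes vary continuously; the class is stable under adding
  walk hulls and dilates of \<open>L\<close>.\<close>

definition good :: "'a set \<Rightarrow> bool" where
  "good Q \<longleftrightarrow> convex_body Q \<and> (\<exists>t>0. cball 0 t \<subseteq> Q)"

lemma zonoid_L: "zonoid_of (\<Pi>\<^sub>M i\<in>{0::nat}. \<nu>) (\<lambda>y. y 0) L"
  using zonoid_sum[of "{0}"] by simp

lemma zero_mem_L: "0 \<in> L"
proof -
  have "{0} \<subseteq> L"
    by (rule subset_of_support_fun_le) (use zonoid_L L in \<open>auto simp: zonoid_of_def support_fun_zero\<close>)
  then show ?thesis by simp
qed

lemma good_plus: "good Q \<Longrightarrow> convex_body S \<Longrightarrow> 0 \<in> S \<Longrightarrow> good (S + Q)"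
  unfolding good_def using convex_body_plus subset_plus_left by (metis add.commute)

lemma good_dil: "good Q \<Longrightarrow> good (Q + dil s L)"
  using good_plus[of Q "dil s L"] zero_mem_L L by (simp add: convex_body_dil add.commute image_iff) (metis scaleR_zero_right)

lemma good_walk: "good Q \<Longrightarrow> good (walk_hull xs y + Q)"
  by (intro good_plus convex_body_walk_hull zero_mem_walk_hull)

text \<open>The derivative at 0 of \<open>s \<mapsto> vol (Q + dil s L)\<close>, written as a finite
  combination of volumes so that it is measurable in random \<open>Q\<close> and commutes with
  expectation.\<close>

definition D :: "'a set \<Rightarrow> real" where
  "D Q = (\<Sum>i\<le>DIM('a). coeff (interp_basis DIM('a) i) 1 * vol (Q + dil (real i) L))"

lemma vol_dil_polynomial:
  assumes "good Q"
  shows "\<exists>p. degree p \<le> DIM('a) \<and> (\<forall>s\<ge>0. vol (Q + dil s L) = poly p s)"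
  using assms vol_zonoid_of[OF zonoid_L, of Q] unfolding good_def by metis

lemma vol_seg_sum:
  fixes B :: "nat set"
  assumes Q: "good Q" and B: "finite B" "B \<noteq> {}"
  shows "integrable (\<Pi>\<^sub>M i\<in>B. \<nu>) (\<lambda>y. vol (Q + seg (\<Sum>i\<in>B. y i)))"
    "(\<integral>y. vol (Q + seg (\<Sum>i\<in>B. y i)) \<partial>(\<Pi>\<^sub>M i\<in>B. \<nu>)) = vol Q + real (card B) powr \<beta> * D Q"
proof -
  let ?r = "real (card B) powr \<beta>"
  obtain t where t: "0 < t" "cball 0 t \<subseteq> Q" and cQ: "convex_body Q" using Q by (auto simp: good_def)
  obtain p where p: "degree p \<le> DIM('a)" "\<And>s. 0 \<le> s \<Longrightarrow> vol (Q + dil s (dil ?r L)) = poly p s"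
    and int: "integrable (\<Pi>\<^sub>M i\<in>B. \<nu>) (\<lambda>y. vol (Q + seg (\<Sum>i\<in>B. y i)))"
      "(\<integral>y. vol (Q + seg (\<Sum>i\<in>B. y i)) \<partial>(\<Pi>\<^sub>M i\<in>B. \<nu>)) = vol Q + coeff p 1"
    using vol_zonoid_of[OF zonoid_sum[OF B] cQ t(2,1)] by blast
  obtain q where q: "degree q \<le> DIM('a)" "\<And>s. 0 \<le> s \<Longrightarrow> vol (Q + dil s L) = poly q s"
    using vol_dil_polynomial[OF Q] by blast
  \<comment> \<open>The zonoid of the sum is that of one step dilated by \<open>?r\<close>, so the
    volume polynomial is \<open>q\<close> with rescaled argument, and its linear coefficient gains
    the factor \<open>?r\<close>.\<close>
  have "p = pcompose q [:0, ?r:]"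
  proof (rule poly_eqI_degree[where A = "real ` {..DIM('a)}"])
    have card: "card (real ` {..DIM('a)}) = DIM('a) + 1" by (subst card_image) auto
    show "degree p < card (real ` {..DIM('a)})" using p(1) card by simp
    show "degree (pcompose q [:0, ?r:]) < card (real ` {..DIM('a)})"
      using q(1) card by (simp add: degree_pcompose)
    fix x assume "x \<in> real ` {..DIM('a)}"
    then have x: "0 \<le> x" by auto
    have "dil x (dil ?r L) = dil (?r * x) L" by (simp add: image_image mult.commute)
    then show "poly p x = poly (pcompose q [:0, ?r:]) x"
      using p(2)[OF x] q(2)[of "?r * x"] x by (simp add: poly_pcompose mult.commute)
  qed
  then have "coeff p 1 = ?r * coeff q 1" by (simp add: coeff_pcompose_linear)
  also have "coeff q 1 = D Q" using coeff_interpolation[OF q(1), of 1] q(2) by (simp add: D_def)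
  finally show "integrable (\<Pi>\<^sub>M i\<in>B. \<nu>) (\<lambda>y. vol (Q + seg (\<Sum>i\<in>B. y i)))"
    "(\<integral>y. vol (Q + seg (\<Sum>i\<in>B. y i)) \<partial>(\<Pi>\<^sub>M i\<in>B. \<nu>)) = vol Q + ?r * D Q"
    using int by simp_all
qed

definition G :: "nat \<Rightarrow> 'a set \<Rightarrow> real" where
  "G n Q = (\<integral>y. vol (walk_hull [0..<n] y + Q) \<partial>(\<Pi>\<^sub>M i\<in>{..<n}. \<nu>))"

lemma measurable_vol_walk:
  assumes "good Q" "set xs \<subseteq> A"
  shows "(\<lambda>y. vol (walk_hull xs y + Q)) \<in> borel_measurable (\<Pi>\<^sub>M i\<in>A. \<nu>)"
proof -
  obtain t where t: "convex_body Q" "cball 0 t \<subseteq> Q" "0 < t" using assms(1) by (auto simp: good_def)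
  show ?thesis
    using borel_measurable_vol_walk_hull[OF t sets_\<nu> assms(2), of "{}"] by (simp add: set_plus_zero_right)
qed

lemma measurable_vol_walk_seg:
  assumes "good Q" "set xs \<subseteq> A" "B \<subseteq> A"
  shows "(\<lambda>y. vol (walk_hull xs y + seg (\<Sum>i\<in>B. y i) + Q)) \<in> borel_measurable (\<Pi>\<^sub>M i\<in>A. \<nu>)"
  using borel_measurable_vol_walk_hull[OF _ _ _ sets_\<nu> assms(2,3)] assms(1) by (auto simp: good_def)

text \<open>The steps are independent and identically distributed, so their joint law is invariant
  under relabelling, and all orderings of \<open>A\<close> have the same expectation.\<close>

lemma G_reindex:
  assumes xs: "xs \<in> permutations_of_set A" and A: "finite A" and Q: "good Q"
  shows "integrable (\<Pi>\<^sub>M i\<in>{..<card A}. \<nu>) (\<lambda>y. vol (walk_hull [0..<card A] y + Q)) \<longleftrightarrow>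
      integrable (\<Pi>\<^sub>M i\<in>A. \<nu>) (\<lambda>y. vol (walk_hull xs y + Q))"
    "(\<integral>y. vol (walk_hull xs y + Q) \<partial>(\<Pi>\<^sub>M i\<in>A. \<nu>)) = G (card A) Q"
proof -
  let ?n = "card A" and ?f = "\<lambda>y. vol (walk_hull [0..<card A] y + Q)"
  have dist: "distinct xs" and set: "set xs = A" using permutations_of_setD[OF xs] by auto
  have n: "?n = length xs" using xs by (simp add: length_finite_permutations_of_set)
  let ?T = "\<lambda>y. \<lambda>i\<in>{..<?n}. y (xs ! i)"
  have inj: "inj_on ((!) xs) {..<?n}" using dist n by (simp add: inj_on_nth)
  have mem: "(!) xs \<in> {..<?n} \<rightarrow> A" using n set by auto
  have d: "distr (\<Pi>\<^sub>M i\<in>A. \<nu>) (\<Pi>\<^sub>M i\<in>{..<?n}. \<nu>) ?T = (\<Pi>\<^sub>M i\<in>{..<?n}. \<nu>)"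
    by (rule distr_PiM_reindex[OF prob_\<nu> inj mem])
  have T: "?T \<in> measurable (\<Pi>\<^sub>M i\<in>A. \<nu>) (\<Pi>\<^sub>M i\<in>{..<?n}. \<nu>)"
    using mem by (intro measurable_restrict measurable_component_singleton) auto
  have f: "?f \<in> borel_measurable (\<Pi>\<^sub>M i\<in>{..<?n}. \<nu>)" by (rule measurable_vol_walk[OF Q]) auto
  have eq: "?f (?T y) = vol (walk_hull xs y + Q)" for y
    using walk_hull_reindex[OF dist n, of y "\<lambda>_. undefined"] by (simp add: restrict_def)
  show "integrable (\<Pi>\<^sub>M i\<in>{..<?n}. \<nu>) ?f \<longleftrightarrow> integrable (\<Pi>\<^sub>M i\<in>A. \<nu>) (\<lambda>y. vol (walk_hull xs y + Q))"
    using integrable_distr_eq[OF T f] unfolding d eq .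
  show "(\<integral>y. vol (walk_hull xs y + Q) \<partial>(\<Pi>\<^sub>M i\<in>A. \<nu>)) = G ?n Q"
    using integral_distr[OF T f] unfolding d eq by (simp add: G_def)
qed

text \<open>The expectation of \<open>D (walk_hull [0..<n] y + Q)\<close>, with the finite
  combination taken outside the integral.\<close>

definition H :: "nat \<Rightarrow> 'a set \<Rightarrow> real" where
  "H n Q = (\<Sum>i\<le>DIM('a). coeff (interp_basis DIM('a) i) 1 * G n (Q + dil (real i) L))"

text \<open>Fubini over the steps outside and inside \<open>B\<close>: with the former fixed,
  \<open>vol_seg_sum\<close> evaluates the mean over the latter. The argument runs through
  nonnegative integrals because integrability is part of the claim.\<close>

lemma vol_walk_seg:
  assumes A: "finite A" and Q: "good Q" and B: "B \<subseteq> A" "B \<noteq> {}" and zs: "zs \<in> permutations_of_set (A - B)"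
    and int: "\<And>Q. good Q \<Longrightarrow> integrable (\<Pi>\<^sub>M i\<in>A - B. \<nu>) (\<lambda>y. vol (walk_hull zs y + Q))"
  shows "integrable (\<Pi>\<^sub>M i\<in>A. \<nu>) (\<lambda>y. vol (walk_hull zs y + seg (\<Sum>i\<in>B. y i) + Q))"
    "(\<integral>y. vol (walk_hull zs y + seg (\<Sum>i\<in>B. y i) + Q) \<partial>(\<Pi>\<^sub>M i\<in>A. \<nu>)) =
      G (card (A - B)) Q + real (card B) powr \<beta> * H (card (A - B)) Q"
proof -
  let ?f = "\<lambda>y. vol (walk_hull zs y + seg (\<Sum>i\<in>B. y i) + Q)" and ?r = "real (card B) powr \<beta>"
  have fin: "finite B" "finite (A - B)" using A B finite_subset by auto
  have set: "set zs = A - B" using permutations_of_setD[OF zs] by simp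
  have A': "A = (A - B) \<union> B" using B by auto
  have f: "?f \<in> borel_measurable (\<Pi>\<^sub>M i\<in>A. \<nu>)" using set B by (intro measurable_vol_walk_seg Q) auto
  let ?I = "G (card (A - B)) Q + ?r * H (card (A - B)) Q"
  let ?g = "\<lambda>x. vol (walk_hull zs x + Q) + ?r * D (walk_hull zs x + Q)"
  have inner: "(\<integral>\<^sup>+y. ennreal (?f (merge (A - B) B (x, y))) \<partial>(\<Pi>\<^sub>M i\<in>B. \<nu>)) = ennreal (?g x)" and g0: "0 \<le> ?g x" for x
  proof -
    have "walk_hull zs (merge (A - B) B (x, y)) = walk_hull zs x" for y
      unfolding walk_hull_def set by (intro image_cong refl sum.cong) (auto simp: merge_def)
    moreover have "(\<Sum>i\<in>B. merge (A - B) B (x, y) i) = (\<Sum>i\<in>B. y i)" for y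
      by (intro sum.cong) (auto simp: merge_def)
    ultimately have eq: "?f (merge (A - B) B (x, y)) = vol (walk_hull zs x + Q + seg (\<Sum>i\<in>B. y i))" for y
      by (simp add: ac_simps)
    note v = vol_seg_sum[OF good_walk[OF Q, of zs x] fin(1) B(2)]
    show "0 \<le> ?g x" unfolding v(2)[symmetric] by (intro integral_nonneg_AE) simp
    show "(\<integral>\<^sup>+y. ennreal (?f (merge (A - B) B (x, y))) \<partial>(\<Pi>\<^sub>M i\<in>B. \<nu>)) = ennreal (?g x)"
      unfolding eq v(2)[symmetric] by (intro nn_integral_eq_integral v(1)) simp
  qed
  have gi: "integrable (\<Pi>\<^sub>M i\<in>A - B. \<nu>) ?g" and gI: "(\<integral>x. ?g x \<partial>(\<Pi>\<^sub>M i\<in>A - B. \<nu>)) = ?I"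
  proof -
    have i: "integrable (\<Pi>\<^sub>M i\<in>A - B. \<nu>) (\<lambda>x. vol (walk_hull zs x + Q + dil (real i) L))" for i
      using int[OF good_dil[OF Q, of "real i"]] by (simp add: add.assoc)
    have v: "(\<integral>x. vol (walk_hull zs x + Q + dil (real i) L) \<partial>(\<Pi>\<^sub>M i\<in>A - B. \<nu>)) = G (card (A - B)) (Q + dil (real i) L)" for i
      using G_reindex(2)[OF zs fin(2) good_dil[OF Q, of "real i"]] by (simp add: add.assoc)
    have Di: "integrable (\<Pi>\<^sub>M i\<in>A - B. \<nu>) (\<lambda>x. D (walk_hull zs x + Q))" unfolding D_def using i by simp
    show "integrable (\<Pi>\<^sub>M i\<in>A - B. \<nu>) ?g" using int[OF Q] Di by simp
    have "(\<integral>x. D (walk_hull zs x + Q) \<partial>(\<Pi>\<^sub>M i\<in>A - B. \<nu>)) = H (card (A - B)) Q"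
      unfolding D_def H_def using i by (simp add: v)
    then show "(\<integral>x. ?g x \<partial>(\<Pi>\<^sub>M i\<in>A - B. \<nu>)) = ?I"
      using int[OF Q] Di G_reindex(2)[OF zs fin(2) Q] by simp
  qed
  have I0: "0 \<le> ?I" unfolding gI[symmetric] using g0 by simp
  have "(\<integral>\<^sup>+y. ennreal (?f y) \<partial>(\<Pi>\<^sub>M i\<in>A. \<nu>)) = (\<integral>\<^sup>+y. ennreal (?f y) \<partial>(\<Pi>\<^sub>M i\<in>(A - B) \<union> B. \<nu>))"
    using A' by simp
  also have "\<dots> = (\<integral>\<^sup>+x. (\<integral>\<^sup>+y. ennreal (?f (merge (A - B) B (x, y))) \<partial>(\<Pi>\<^sub>M i\<in>B. \<nu>)) \<partial>(\<Pi>\<^sub>M i\<in>A - B. \<nu>))"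
    using fin f A' by (intro product_nn_integral_fold) auto
  also have "\<dots> = (\<integral>\<^sup>+x. ennreal (?g x) \<partial>(\<Pi>\<^sub>M i\<in>A - B. \<nu>))" unfolding inner ..
  also have "\<dots> = ennreal ?I" unfolding gI[symmetric] by (intro nn_integral_eq_integral gi) (simp add: g0)
  finally have "(\<integral>\<^sup>+y. ennreal (?f y) \<partial>(\<Pi>\<^sub>M i\<in>A. \<nu>)) = ennreal ?I" .
  then have "integrable (\<Pi>\<^sub>M i\<in>A. \<nu>) ?f \<and> integral\<^sup>L (\<Pi>\<^sub>M i\<in>A. \<nu>) ?f = ?I"
    using nn_integral_eq_integrable[OF f _ I0] by simp
  then show "integrable (\<Pi>\<^sub>M i\<in>A. \<nu>) ?f" "integral\<^sup>L (\<Pi>\<^sub>M i\<in>A. \<nu>) ?f = ?I" by auto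
qed

text \<open>Expectation of \<open>walk_hull_vol\<close>: orderings contribute equally, and the
  factorials cancel by \<open>sum_nonempty_Pow_card\<close>. As \<open>B\<close> is nonempty, the
  right-hand side only involves hulls of fewer than \<open>n\<close> steps, so integrability is
  inherited by induction.\<close>

lemma G_integrable_recursion:
  assumes "good Q"
  shows "integrable (\<Pi>\<^sub>M i\<in>{..<n}. \<nu>) (\<lambda>y. vol (walk_hull [0..<n] y + Q)) \<and>
    real n * G n Q = (\<Sum>k=1..n. G (n - k) Q + real k powr \<beta> * H (n - k) Q)"
  using assms
proof (induction n arbitrary: Q rule: less_induct)
  case (less n)
  have int': "integrable (\<Pi>\<^sub>M i\<in>S. \<nu>) (\<lambda>y. vol (walk_hull zs y + Q))"
    if "finite S" "zs \<in> permutations_of_set S" "card S < n" "good Q" for S zs Q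
    using less.IH[OF that(3,4)] G_reindex(1)[OF that(2,1,4)] by simp
  show ?case
  proof (cases "n = 0")
    case True
    interpret P: prob_space "\<Pi>\<^sub>M i\<in>({}::nat set). \<nu>" by (rule prob_space_PiM[OF prob_\<nu>])
    show ?thesis using True by (simp add: walk_hull_Nil)
  next
    case False
    let ?A = "{..<n}" and ?M = "\<Pi>\<^sub>M i\<in>{..<n}. \<nu>"
    let ?f = "\<lambda>B zs y. vol (walk_hull zs y + seg (\<Sum>i\<in>B. y i) + Q)"
    have cQ: "convex_body Q" using less.prems by (simp add: good_def)
    have f: "integrable ?M (?f B zs)"
      "integral\<^sup>L ?M (?f B zs) = G (n - card B) Q + real (card B) powr \<beta> * H (n - card B) Q"
      if B: "B \<in> Pow ?A - {{}}" and zs: "zs \<in> permutations_of_set (?A - B)" for B zs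
    proof -
      have fB: "finite B" using B finite_subset by auto
      have c: "card (?A - B) = n - card B" using B fB by (subst card_Diff_subset) auto
      have "0 < card B" using B fB by (auto simp: card_gt_0_iff)
      then have "card (?A - B) < n" using c False by simp
      then have i: "integrable (\<Pi>\<^sub>M i\<in>?A - B. \<nu>) (\<lambda>y. vol (walk_hull zs y + Q))" if "good Q" for Q
        using zs that by (intro int') auto
      show "integrable ?M (?f B zs)"
        "integral\<^sup>L ?M (?f B zs) = G (n - card B) Q + real (card B) powr \<beta> * H (n - card B) Q"
        using vol_walk_seg[OF _ less.prems _ _ zs i] B c by auto
    qed
    have id: "real n * (\<Sum>xs\<in>permutations_of_set ?A. vol (walk_hull xs y + Q)) =
        (\<Sum>B\<in>Pow ?A - {{}}. \<Sum>zs\<in>permutations_of_set (?A - B). fact (card B) * ?f B zs y)" for y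
      using walk_hull_vol[of ?A Q y] cQ by simp
    have R: "integrable ?M (\<lambda>y. \<Sum>B\<in>Pow ?A - {{}}. \<Sum>zs\<in>permutations_of_set (?A - B). fact (card B) * ?f B zs y)"
      by (intro Bochner_Integration.integrable_sum integrable_mult_right f)
    have mem: "[0..<n] \<in> permutations_of_set ?A" by (auto simp: permutations_of_set_def)
    \<comment> \<open>Domination by the right-hand side of the identity: the volume is one
      nonnegative term of the sum on the left, and the factor \<open>real n\<close> is at least
      1.\<close>
    have i: "integrable ?M (\<lambda>y. vol (walk_hull xs y + Q))" if xs: "xs \<in> permutations_of_set ?A" for xs
    proof (rule Bochner_Integration.integrable_bound[OF R])
      show "(\<lambda>y. vol (walk_hull xs y + Q)) \<in> borel_measurable ?M"
        using permutations_of_setD[OF xs] less.prems by (intro measurable_vol_walk) auto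
      show "AE y in ?M. norm (vol (walk_hull xs y + Q)) \<le>
          norm (\<Sum>B\<in>Pow ?A - {{}}. \<Sum>zs\<in>permutations_of_set (?A - B). fact (card B) * ?f B zs y)"
      proof (rule AE_I2)
        fix y
        have "vol (walk_hull xs y + Q) \<le> (\<Sum>xs\<in>permutations_of_set ?A. vol (walk_hull xs y + Q))"
          using xs by (intro member_le_sum) auto
        also have "\<dots> \<le> real n * (\<Sum>xs\<in>permutations_of_set ?A. vol (walk_hull xs y + Q))"
          using False mult_right_mono[of 1 "real n" "\<Sum>xs\<in>permutations_of_set ?A. vol (walk_hull xs y + Q)"]
          by (simp add: sum_nonneg)
        finally show "norm (vol (walk_hull xs y + Q)) \<le>
            norm (\<Sum>B\<in>Pow ?A - {{}}. \<Sum>zs\<in>permutations_of_set (?A - B). fact (card B) * ?f B zs y)"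
          unfolding id by simp
      qed
    qed
    have "fact n * (real n * G n Q) = (\<integral>y. real n * (\<Sum>xs\<in>permutations_of_set ?A. vol (walk_hull xs y + Q)) \<partial>?M)"
    proof -
      have "(\<integral>y. (\<Sum>xs\<in>permutations_of_set ?A. vol (walk_hull xs y + Q)) \<partial>?M) = (\<Sum>xs\<in>permutations_of_set ?A. G n Q)"
        using i G_reindex(2)[of _ ?A Q] less.prems by (subst Bochner_Integration.integral_sum) auto
      then show ?thesis by simp
    qed
    also have "\<dots> = (\<integral>y. (\<Sum>B\<in>Pow ?A - {{}}. \<Sum>zs\<in>permutations_of_set (?A - B). fact (card B) * ?f B zs y) \<partial>?M)"
      unfolding id ..
    also have "\<dots> = (\<Sum>B\<in>Pow ?A - {{}}. \<integral>y. (\<Sum>zs\<in>permutations_of_set (?A - B). fact (card B) * ?f B zs y) \<partial>?M)"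
      by (intro Bochner_Integration.integral_sum Bochner_Integration.integrable_sum integrable_mult_right f)
    also have "\<dots> = (\<Sum>B\<in>Pow ?A - {{}}. fact (card B) * fact (card ?A - card B) *
        (G (n - card B) Q + real (card B) powr \<beta> * H (n - card B) Q))"
    proof (intro sum.cong refl)
      fix B assume B: "B \<in> Pow ?A - {{}}"
      then have fB: "finite B" using finite_subset by auto
      have "(\<integral>y. (\<Sum>zs\<in>permutations_of_set (?A - B). fact (card B) * ?f B zs y) \<partial>?M) =
          (\<Sum>zs\<in>permutations_of_set (?A - B). fact (card B) * (G (n - card B) Q + real (card B) powr \<beta> * H (n - card B) Q))"
        using f[OF B] by (subst Bochner_Integration.integral_sum) auto
      also have "card (?A - B) = card ?A - card B" using B fB by (intro card_Diff_subset) auto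
      then have "card (permutations_of_set (?A - B)) = fact (card ?A - card B)" by simp
      then have "(\<Sum>zs\<in>permutations_of_set (?A - B). fact (card B) * (G (n - card B) Q + real (card B) powr \<beta> * H (n - card B) Q)) =
          fact (card B) * fact (card ?A - card B) * (G (n - card B) Q + real (card B) powr \<beta> * H (n - card B) Q)"
        by (simp only: sum_constant) simp
      finally show "(\<integral>y. (\<Sum>zs\<in>permutations_of_set (?A - B). fact (card B) * ?f B zs y) \<partial>?M) =
          fact (card B) * fact (card ?A - card B) * (G (n - card B) Q + real (card B) powr \<beta> * H (n - card B) Q)" .
    qed
    also have "\<dots> = fact (card ?A) * (\<Sum>k=1..card ?A. G (n - k) Q + real k powr \<beta> * H (n - k) Q)"
      by (rule sum_nonempty_Pow_card[of ?A "\<lambda>k. G (n - k) Q + real k powr \<beta> * H (n - k) Q"]) simp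
    finally have "real n * G n Q = (\<Sum>k=1..n. G (n - k) Q + real k powr \<beta> * H (n - k) Q)" by simp
    then show ?thesis using i[OF mem] by simp
  qed
qed

text \<open>\<open>P m\<close> is the claimed polynomial for \<open>m\<close> steps. With
  \<open>s\<close> arbitrary, the induction hypothesis covers the points \<open>s + i\<close> at
  which \<open>H\<close> samples, so \<open>H\<close> becomes the derivative of \<open>P\<close>.
  Matching the coefficients of the higher derivatives of \<open>p\<close> is
  \<open>hull_coeff_recursion\<close>.\<close>

lemma G_polynomial:
  assumes Q: "good Q" and p: "degree p \<le> DIM('a)" "\<And>s. 0 \<le> s \<Longrightarrow> vol (Q + dil s L) = poly p s" and s: "0 \<le> s"
  shows "G n (Q + dil s L) = (\<Sum>j\<le>DIM('a). hull_coeff \<beta> j n * poly ((pderiv ^^ j) p) s)"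
  using s
proof (induction n arbitrary: s rule: less_induct)
  case (less n)
  let ?d = "DIM('a)"
  define P where "P m = (\<Sum>j\<le>?d. smult (hull_coeff \<beta> j m) ((pderiv ^^ j) p))" for m
  have polyP: "poly (P m) s = (\<Sum>j\<le>?d. hull_coeff \<beta> j m * poly ((pderiv ^^ j) p) s)" for m s
    by (simp add: P_def poly_sum)
  have deg: "degree ((pderiv ^^ j) p) \<le> ?d - j" for j
    using p(1) by (induction j) (auto simp: degree_pderiv)
  have degP: "degree (P m) \<le> ?d" for m unfolding P_def
    by (intro degree_sum_le order_trans[OF degree_smult_le] order_trans[OF deg]) auto
  \<comment> \<open>Differentiation shifts the index \<open>j\<close> by one; since this derivative
    vanishes, the sum still ends at the dimension.\<close>
  have "(pderiv ^^ Suc ?d) p = 0"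
  proof -
    have "degree ((pderiv ^^ ?d) p) = 0" using deg[of ?d] by simp
    then show ?thesis by (simp add: pderiv_eq_0_iff)
  qed
  note last = this
  show ?case
  proof (cases "n = 0")
    case True
    interpret PS: prob_space "\<Pi>\<^sub>M i\<in>({}::nat set). \<nu>" by (rule prob_space_PiM[OF prob_\<nu>])
    have "G 0 (Q + dil s L) = vol (Q + dil s L)"
      using PS.prob_space by (simp add: G_def walk_hull_Nil add.commute[of "{0}"] set_plus_zero_right)
    moreover have "(\<Sum>j\<le>?d. hull_coeff \<beta> j 0 * poly ((pderiv ^^ j) p) s) = (\<Sum>j\<le>?d. if j = 0 then poly p s else 0)"
      by (intro sum.cong) (auto simp: hull_coeff_0)
    ultimately show ?thesis using p(2)[OF less.prems] True by simp
  next
    case False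
    have G: "G (n - k) (Q + dil s' L) = poly (P (n - k)) s'" if "k \<in> {1..n}" "0 \<le> s'" for k s'
      using less.IH[of "n - k" s'] that False by (simp add: polyP)
    have H: "H (n - k) (Q + dil s L) = poly (pderiv (P (n - k))) s" if k: "k \<in> {1..n}" for k
    proof -
      have "G (n - k) (Q + dil s L + dil (real i) L) = poly (P (n - k)) (s + real i)" for i
      proof -
        have "Q + dil s L + dil (real i) L = Q + dil (s + real i) L"
          using L less.prems by (simp add: add.assoc dil_add convex_body_def)
        then show ?thesis using G[OF k, of "s + real i"] less.prems by simp
      qed
      then show ?thesis by (simp add: H_def poly_pderiv_interpolation[OF degP])
    qed
    have "real n * G n (Q + dil s L) = (\<Sum>k=1..n. G (n - k) (Q + dil s L) + real k powr \<beta> * H (n - k) (Q + dil s L))"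
      using G_integrable_recursion[OF good_dil[OF Q]] by blast
    also have "\<dots> = (\<Sum>k=1..n. poly (P (n - k)) s + real k powr \<beta> * poly (pderiv (P (n - k))) s)"
      using less.prems by (intro sum.cong refl) (simp add: G H)
    also have "\<dots> = (\<Sum>k=1..n. \<Sum>j\<le>?d. (hull_coeff \<beta> j (n - k) +
        (if j = 0 then 0 else real k powr \<beta> * hull_coeff \<beta> (j - 1) (n - k))) * poly ((pderiv ^^ j) p) s)"
    proof (intro sum.cong refl)
      fix k
      have "poly (pderiv (P (n - k))) s = (\<Sum>j\<le>?d. hull_coeff \<beta> j (n - k) * poly ((pderiv ^^ Suc j) p) s)"
        by (simp add: P_def higher_pderiv_sum[where n = 1, simplified] pderiv_smult poly_sum)
      also have "\<dots> = (\<Sum>j\<le>Suc ?d. if j = 0 then 0 else hull_coeff \<beta> (j - 1) (n - k) * poly ((pderiv ^^ j) p) s)"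
        by (subst sum.atMost_Suc_shift) simp
      also have "\<dots> = (\<Sum>j\<le>?d. if j = 0 then 0 else hull_coeff \<beta> (j - 1) (n - k) * poly ((pderiv ^^ j) p) s)"
        using last by simp
      finally have e: "poly (pderiv (P (n - k))) s =
          (\<Sum>j\<le>?d. if j = 0 then 0 else hull_coeff \<beta> (j - 1) (n - k) * poly ((pderiv ^^ j) p) s)" .
      show "poly (P (n - k)) s + real k powr \<beta> * poly (pderiv (P (n - k))) s =
          (\<Sum>j\<le>?d. (hull_coeff \<beta> j (n - k) + (if j = 0 then 0 else real k powr \<beta> * hull_coeff \<beta> (j - 1) (n - k))) *
            poly ((pderiv ^^ j) p) s)"
        unfolding e polyP sum_distrib_left sum.distrib[symmetric] by (intro sum.cong refl) (simp add: algebra_simps)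
    qed
    also have "\<dots> = (\<Sum>j\<le>?d. real n * hull_coeff \<beta> j n * poly ((pderiv ^^ j) p) s)"
      by (subst sum.swap) (simp add: hull_coeff_recursion[of n \<beta>] flip: sum_distrib_right)
    also have "\<dots> = real n * (\<Sum>j\<le>?d. hull_coeff \<beta> j n * poly ((pderiv ^^ j) p) s)"
      by (simp add: sum_distrib_left mult.assoc)
    finally show ?thesis using False by simp
  qed
qed

lemma expected_vol_walk_hull:
  assumes Q: "good Q" and p: "degree p \<le> DIM('a)" "\<And>s. 0 \<le> s \<Longrightarrow> vol (Q + dil s L) = poly p s"
  shows "integrable (\<Pi>\<^sub>M i\<in>{..<n}. \<nu>) (\<lambda>y. vol (walk_hull [0..<n] y + Q))"
    "(\<integral>y. vol (walk_hull [0..<n] y + Q) \<partial>(\<Pi>\<^sub>M i\<in>{..<n}. \<nu>)) =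
      (\<Sum>j\<le>DIM('a). hull_coeff \<beta> j n * (fact j * coeff p j))"
proof -
  show "integrable (\<Pi>\<^sub>M i\<in>{..<n}. \<nu>) (\<lambda>y. vol (walk_hull [0..<n] y + Q))"
    using G_integrable_recursion[OF Q] by blast
  have "dil 0 L = {0}" using L dil_zero[of L] by (simp add: convex_body_def)
  then have "G n Q = (\<Sum>j\<le>DIM('a). hull_coeff \<beta> j n * poly ((pderiv ^^ j) p) 0)"
    using G_polynomial[OF Q p, of 0 n] by (simp add: set_plus_zero_right)
  also have "\<dots> = (\<Sum>j\<le>DIM('a). hull_coeff \<beta> j n * (fact j * coeff p j))"
    by (simp add: poly_0_coeff_0 coeff_higher_pderiv pochhammer_fact)
  finally show "(\<integral>y. vol (walk_hull [0..<n] y + Q) \<partial>(\<Pi>\<^sub>M i\<in>{..<n}. \<nu>)) =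
      (\<Sum>j\<le>DIM('a). hull_coeff \<beta> j n * (fact j * coeff p j))" by (simp add: G_def)
qed

end

subsection \<open>Closed convex hulls of paths\<close>

text \<open>One-sided limits bound the path near each point, and finitely many such neighbourhoods
  cover the unit interval.\<close>

lemma bounded_cadlag:
  fixes x :: "real \<Rightarrow> 'a::euclidean_space"
  assumes right: "\<And>t. 0 \<le> t \<Longrightarrow> continuous (at_right t) x"
    and left: "\<And>t. 0 < t \<Longrightarrow> \<exists>l. (x \<longlongrightarrow> l) (at_left t)"
  shows "bounded (x ` {0..1})"
proof -
  have loc: "\<exists>d>0. bounded (x ` (ball s d \<inter> {0..1}))" if s: "0 \<le> s" for s
  proof -
    have "(x \<longlongrightarrow> x s) (at_right s)" using right[OF s] by (simp add: continuous_within)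
    then have "\<forall>\<^sub>F u in at_right s. dist (x u) (x s) < 1" by (rule tendstoD) simp
    then obtain b where b: "s < b" "\<And>u. s < u \<Longrightarrow> u < b \<Longrightarrow> dist (x u) (x s) < 1"
      by (auto simp: eventually_at_right_field)
    obtain l b' where b': "b' < s" "\<And>u. b' < u \<Longrightarrow> u < s \<Longrightarrow> 0 \<le> u \<Longrightarrow> dist (x u) l < 1"
    proof (cases "s = 0")
      case True
      \<comment> \<open>At time 0 there is no left limit: the condition on \<open>u\<close> is
        vacuous for negative \<open>u\<close>, so any negative \<open>b'\<close> serves.\<close>
      then show ?thesis using that[of "- 1"] by auto
    next
      case False
      then obtain l where "(x \<longlongrightarrow> l) (at_left s)" using left[of s] s by auto
      then have "\<forall>\<^sub>F u in at_left s. dist (x u) l < 1" by (rule tendstoD) simp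
      then show ?thesis using that by (auto simp: eventually_at_left_field)
    qed
    define d where "d = min (b - s) (s - b')"
    have d: "0 < d" using b(1) b'(1) by (simp add: d_def)
    have "x ` (ball s d \<inter> {0..1}) \<subseteq> cball (x s) 1 \<union> cball l 1"
    proof
      fix z assume "z \<in> x ` (ball s d \<inter> {0..1})"
      then obtain u where u: "z = x u" "\<bar>s - u\<bar> < d" "0 \<le> u" by (auto simp: dist_real_def)
      have "d \<le> b - s" "d \<le> s - b'" by (simp_all add: d_def)
      then have "u = s \<or> s < u \<and> u < b \<or> b' < u \<and> u < s" using u(2) by linarith
      then consider "u = s" | "s < u" "u < b" | "b' < u" "u < s" by blast
      then show "z \<in> cball (x s) 1 \<union> cball l 1"
        using b(2)[of u] b'(2)[of u] u by cases (auto simp: dist_commute less_imp_le)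
    qed
    then have "bounded (x ` (ball s d \<inter> {0..1}))" by (rule bounded_subset[rotated]) simp
    then show ?thesis using d by blast
  qed
  then obtain d where d: "\<And>s. 0 \<le> s \<Longrightarrow> 0 < d s" "\<And>s. 0 \<le> s \<Longrightarrow> bounded (x ` (ball s (d s) \<inter> {0..1}))"
    by metis
  have "{0..1::real} \<subseteq> (\<Union>s\<in>{0..1}. ball s (d s))" using d(1) by force
  then obtain F where F: "F \<subseteq> {0..1}" "finite F" "{0..1} \<subseteq> (\<Union>s\<in>F. ball s (d s))"
    by (rule compactE_image[OF compact_Icc, rotated]) auto
  have "x ` {0..1} \<subseteq> (\<Union>s\<in>F. x ` (ball s (d s) \<inter> {0..1}))" using F(3) by blast
  moreover have "bounded (\<Union>s\<in>F. x ` (ball s (d s) \<inter> {0..1}))" using F d(2) by (intro bounded_UN) auto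
  ultimately show ?thesis by (rule bounded_subset[rotated])
qed

text \<open>\<open>Z + cball 0 t\<close> lies between the union \<open>U\<close> of the enlarged
  bodies and its closure. The two differ within the frontier of a convex set, which is negligible,
  so continuity of measure from below already gives the limit.\<close>

lemma tendsto_vol_closure_Union:
  fixes C :: "nat \<Rightarrow> 'a::euclidean_space set"
  assumes C: "\<And>m. convex_body (C m)" "\<And>m. C m \<subseteq> C (Suc m)" and Z: "Z = closure (\<Union>m. C m)" "bounded Z"
    and t: "0 \<le> t"
  shows "(\<lambda>m. vol (C m + cball 0 t)) \<longlonglongrightarrow> vol (Z + cball 0 t)" "convex_body Z"
proof -
  have inc: "incseq C" by (rule incseq_SucI) (rule C(2))
  have "convex (\<Union>m. C m)"
  proof (rule convexI)
    fix p q and u v :: real assume "p \<in> (\<Union>m. C m)" "q \<in> (\<Union>m. C m)" and uv: "0 \<le> u" "0 \<le> v" "u + v = 1"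
    then obtain i j where "p \<in> C i" "q \<in> C j" by auto
    then have "p \<in> C (max i j)" "q \<in> C (max i j)"
      using incseqD[OF inc max.cobounded1[of i j]] incseqD[OF inc max.cobounded2[of j i]] by blast+
    then have "u *\<^sub>R p + v *\<^sub>R q \<in> C (max i j)" using C(1)[of "max i j"] uv by (intro convexD) (auto simp: convex_body_def)
    then show "u *\<^sub>R p + v *\<^sub>R q \<in> (\<Union>m. C m)" by blast
  qed
  then have cU: "convex (\<Union>m. C m)" .
  have "C 0 \<subseteq> (\<Union>m. C m)" by blast
  also have "\<dots> \<subseteq> Z" unfolding Z(1) by (rule closure_subset)
  finally have "Z \<noteq> {}" using C(1)[of 0] by (auto simp: convex_body_def)
  then show cZ: "convex_body Z"
    unfolding convex_body_def using Z cU by (auto simp: compact_eq_bounded_closed convex_closure)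
  define U where "U = (\<Union>m. C m + cball 0 t)"
  have U: "U = (\<Union>m. C m) + cball 0 t" unfolding U_def by (auto simp: set_plus_def)
  have convU: "convex U" unfolding U by (intro convex_set_plus cU) simp
  have cb: "convex_body (C m + cball 0 t)" for m using C(1) t by (simp add: convex_body_plus)
  have sub1: "U \<subseteq> Z + cball 0 t" unfolding U Z by (intro set_plus_mono2 closure_subset order_refl)
  have "Z + cball 0 t \<subseteq> closure (\<Union>m. C m) + closure (cball 0 t)" by (simp add: Z(1))
  also have "\<dots> \<subseteq> closure U" unfolding U by (rule closure_sum)
  finally have sub2: "Z + cball 0 t \<subseteq> closure U" .
  have ZB: "convex_body (Z + cball 0 t)" using cZ t by (simp add: convex_body_plus)
  have Us: "U \<in> sets borel" unfolding U_def using cb convex_body_borel by (intro sets.countable_UN) auto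
  have "emeasure lborel U \<le> emeasure lborel (Z + cball 0 t)"
    using sub1 convex_body_borel[OF ZB] by (intro emeasure_mono) auto
  also have "\<dots> < \<infinity>" using convex_body_fmeasurable[OF ZB] by (simp add: fmeasurable_def)
  finally have fin: "emeasure lborel U < \<infinity>" .
  have "measure lebesgue (Z + cball 0 t) = measure lebesgue U"
  proof (rule measure_negligible_symdiff)
    show "U \<in> lmeasurable" using Us fin by (auto simp: fmeasurable_def)
    have "U - (Z + cball 0 t) \<union> (Z + cball 0 t - U) \<subseteq> frontier U"
      using sub1 sub2 interior_subset[of U] by (auto simp: frontier_def)
    then show "negligible (U - (Z + cball 0 t) \<union> (Z + cball 0 t - U))"
      using negligible_convex_frontier[OF convU] by (rule negligible_subset[rotated])
  qed
  then have eq: "vol (Z + cball 0 t) = vol U" using Us convex_body_borel[OF ZB] by simp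
  have "(\<lambda>m. vol (C m + cball 0 t)) \<longlonglongrightarrow> vol (\<Union>m. C m + cball 0 t)"
  proof (rule Lim_measure_incseq)
    show "range (\<lambda>m. C m + cball 0 t) \<subseteq> sets lborel" using cb convex_body_borel by auto
    show "incseq (\<lambda>m. C m + cball 0 t)" by (intro incseq_SucI set_plus_mono2 C(2) order_refl)
    show "emeasure lborel (\<Union>m. C m + cball 0 t) \<noteq> \<infinity>" using fin by (simp add: U_def)
  qed
  then show "(\<lambda>m. vol (C m + cball 0 t)) \<longlonglongrightarrow> vol (Z + cball 0 t)" by (simp add: eq U_def)
qed

text \<open>By right-continuity every value of the path is a limit of values at dyadic times, so
  nested hulls over finitely many times exhaust the path hull up to closure.\<close>

lemma dyadic_hulls:
  fixes x :: "real \<Rightarrow> 'a::euclidean_space"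
  assumes right: "\<And>t. 0 \<le> t \<Longrightarrow> continuous (at_right t) x"
    and left: "\<And>t. 0 < t \<Longrightarrow> \<exists>l. (x \<longlongrightarrow> l) (at_left t)"
  defines "C \<equiv> \<lambda>m. convex hull ((\<lambda>k. x (real k / 2 ^ m)) ` {..2 ^ m})"
    and "Z \<equiv> closure (convex hull (x ` {0..1}))"
  shows "convex_body (C m)" "C m \<subseteq> C (Suc m)" "Z = closure (\<Union>m. C m)" "bounded Z"
proof -
  show cb: "convex_body (C m)" for m
    unfolding C_def convex_body_def by (simp add: compact_convex_hull finite_imp_compact)
  show inc: "C m \<subseteq> C (Suc m)" for m
    unfolding C_def
  proof (intro hull_mono image_subsetI)
    fix k :: nat assume "k \<in> {..2 ^ m}"
    then have "2 * k \<in> {..2 ^ Suc m}" by simp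
    moreover have "x (real k / 2 ^ m) = x (real (2 * k) / 2 ^ Suc m)" by simp
    ultimately show "x (real k / 2 ^ m) \<in> (\<lambda>k. x (real k / 2 ^ Suc m)) ` {..2 ^ Suc m}" by (rule image_eqI[rotated])
  qed
  show "bounded Z" unfolding Z_def
    by (intro bounded_closure bounded_convex_hull bounded_cadlag right left)
  show "Z = closure (\<Union>m. C m)"
  proof
    have "C m \<subseteq> convex hull (x ` {0..1})" for m
      unfolding C_def by (intro hull_mono) (auto intro!: imageI simp: divide_le_eq_1)
    then show "closure (\<Union>m. C m) \<subseteq> Z" unfolding Z_def by (intro closure_mono) auto
    have pts: "x (real k / 2 ^ m) \<in> (\<Union>m. C m)" if "k \<le> 2 ^ m" for k m
      using that unfolding C_def by (intro UN_I[of m]) (auto intro!: hull_inc)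
    have "x t \<in> closure (\<Union>m. C m)" if t: "0 \<le> t" "t \<le> 1" for t
    proof (cases "t = 1")
      case True
      \<comment> \<open>Time 1 cannot be approached from the right within the unit interval, but it
        is itself a node.\<close>
      have "x (real 1 / 2 ^ 0) \<in> closure (\<Union>m. C m)" by (intro closure_subset[THEN subsetD] pts) simp
      then show ?thesis using True by simp
    next
      case False
      \<comment> \<open>The first dyadic time of level \<open>m\<close> strictly to the right of
        \<open>t\<close>: strictness is required by the filter \<open>at_right t\<close>, and
        \<open>t < 1\<close> keeps it within the unit interval.\<close>
      define k where "k m = nat \<lfloor>t * 2 ^ m\<rfloor> + 1" for m :: nat
      have k: "t < real (k m) / 2 ^ m" "real (k m) / 2 ^ m \<le> t + 1 / 2 ^ m" "k m \<le> 2 ^ m" for m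
      proof -
        have 0: "0 \<le> t * 2 ^ m" using t by simp
        have km: "real (k m) = of_int \<lfloor>t * 2 ^ m\<rfloor> + 1" using 0 by (simp add: k_def)
        then have "t * 2 ^ m < real (k m)" "real (k m) \<le> t * 2 ^ m + 1" by linarith+
        then show "t < real (k m) / 2 ^ m" "real (k m) / 2 ^ m \<le> t + 1 / 2 ^ m" by (simp_all add: field_simps)
        have "t * 2 ^ m < 1 * 2 ^ m" using False t by (intro mult_strict_right_mono) auto
        then have "\<lfloor>t * 2 ^ m\<rfloor> < 2 ^ m" by (simp add: floor_less_iff)
        then have "nat \<lfloor>t * 2 ^ m\<rfloor> < 2 ^ m" by (simp add: nat_less_iff 0)
        then show "k m \<le> 2 ^ m" unfolding k_def by linarith
      qed
      have "(\<lambda>m. t + (1 / 2) ^ m) \<longlonglongrightarrow> t + 0" by (intro tendsto_intros LIMSEQ_power_zero) auto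
      then have up: "(\<lambda>m. t + 1 / 2 ^ m) \<longlonglongrightarrow> t" by (simp add: power_one_over)
      have "(\<lambda>m. real (k m) / 2 ^ m) \<longlonglongrightarrow> t"
        by (rule tendsto_sandwich[OF _ _ tendsto_const up]) (use k in \<open>auto simp: less_imp_le\<close>)
      then have "filterlim (\<lambda>m. real (k m) / 2 ^ m) (at_right t) sequentially"
        unfolding filterlim_at using k(1) by (simp add: less_imp_neq[THEN not_sym])
      moreover have "(x \<longlongrightarrow> x t) (at_right t)" using right[OF t(1)] by (simp add: continuous_within)
      ultimately have "(\<lambda>m. x (real (k m) / 2 ^ m)) \<longlonglongrightarrow> x t" by (rule filterlim_compose[rotated])
      then show ?thesis unfolding closure_sequential
        by (intro exI[of _ "\<lambda>m. x (real (k m) / 2 ^ m)"] conjI allI pts k(3))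
    qed
    then have "x ` {0..1} \<subseteq> closure (\<Union>m. C m)" by auto
    moreover have "convex (closure (\<Union>m. C m))"
    proof -
      have "convex_body (closure (\<Union>m. C m))"
      proof (rule tendsto_vol_closure_Union(2)[where C = C and t = 0, OF cb inc refl])
        have "closure (\<Union>m. C m) \<subseteq> Z" by fact
        then show "bounded (closure (\<Union>m. C m))" using \<open>bounded Z\<close> by (rule bounded_subset[rotated])
      qed (rule order_refl)
      then show ?thesis by (simp add: convex_body_def)
    qed
    ultimately show "Z \<subseteq> closure (\<Union>m. C m)" unfolding Z_def by (intro closure_minimal hull_minimal) auto
  qed
qed

text \<open>Needed because the path hull is defined for every outcome, while the properties of the
  paths that identify its volume with a limit of measurable functions hold only almost
  surely.\<close>

lemma measurable_completion_AE:
  fixes f g :: "'w \<Rightarrow> real"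
  assumes g: "g \<in> borel_measurable (completion M)" and eq: "AE x in completion M. f x = g x"
  shows "f \<in> borel_measurable (completion M)"
proof (rule measurableI)
  fix A :: "real set" assume A: "A \<in> sets borel"
  obtain N where N: "N \<in> null_sets (completion M)" "{x \<in> space M. f x \<noteq> g x} \<subseteq> N"
    using eq unfolding eventually_ae_filter by auto
  have e: "f -` A \<inter> space M = ((g -` A \<inter> space M) - N) \<union> (f -` A \<inter> space M \<inter> N)"
    using N(2) by auto
  have 1: "(g -` A \<inter> space M) - N \<in> sets (completion M)"
    using measurable_sets[OF g A] N(1) by (intro sets.Diff) auto
  have 2: "f -` A \<inter> space M \<inter> N \<in> sets (completion M)"
    using null_sets_completion_subset[of "f -` A \<inter> space M \<inter> N" N M] N(1) by auto
  show "f -` A \<inter> space (completion M) \<in> sets (completion M)"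
    unfolding space_completion by (subst e) (rule sets.Un[OF 1 2])
qed auto

text \<open>The nodes are \<open>1, \<dots>, d + 1\<close> rather than \<open>0, \<dots>, d\<close>, since the volume of \<open>A + t B\<close> is computed
only for \<open>t > 0\<close>.\<close>

definition steiner_interp :: "nat \<Rightarrow> nat \<Rightarrow> nat \<Rightarrow> real" where
  "steiner_interp d i j = coeff (pcompose (interp_basis d i) [:- 1, 1:]) (d - j)"

text \<open>Lagrange interpolation after shifting the argument by 1, which moves the nodes
  \<open>1, ..., d + 1\<close> to those of \<open>interp_basis\<close>.\<close>

lemma steiner_interp:
  assumes j: "j \<le> d"
  shows "unit_ball_vol (real (d - j)) * v j =
    (\<Sum>i\<le>d. steiner_interp d i j * (\<Sum>l\<le>d. real (Suc i) ^ (d - l) * unit_ball_vol (real (d - l)) * v l))"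
proof -
  define w where "w = (\<Sum>l\<le>d. monom (unit_ball_vol (real (d - l)) * v l) (d - l))"
  have poly: "poly w t = (\<Sum>l\<le>d. t ^ (d - l) * unit_ball_vol (real (d - l)) * v l)" for t
    by (simp add: w_def poly_sum poly_monom mult_ac)
  have "coeff w (d - j) = (\<Sum>l\<le>d. if l = j then unit_ball_vol (real (d - l)) * v l else 0)"
    unfolding w_def coeff_sum using j by (intro sum.cong) auto
  then have coeff: "coeff w (d - j) = unit_ball_vol (real (d - j)) * v j" using j by simp
  have "degree w \<le> d" unfolding w_def by (intro degree_sum_le order_trans[OF degree_monom_le]) auto
  then have "degree (pcompose w [:1, 1:]) \<le> d" by (simp add: degree_pcompose)
  from interpolation[OF this]
  have "pcompose w [:1, 1:] = (\<Sum>i\<le>d. smult (poly w (real (Suc i))) (interp_basis d i))"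
    by (simp add: poly_pcompose add.commute)
  then have "pcompose (pcompose w [:1, 1:]) [:- 1, 1:] = (\<Sum>i\<le>d. smult (poly w (real (Suc i))) (pcompose (interp_basis d i) [:- 1, 1:]))"
    by (simp add: pcompose_sum pcompose_smult)
  moreover have "pcompose (pcompose w [:1, 1:]) [:- 1, 1:] = w"
    by (simp add: pcompose_assoc[symmetric] pcompose_pCons)
  ultimately have "coeff w (d - j) = (\<Sum>i\<le>d. poly w (real (Suc i)) * coeff (pcompose (interp_basis d i) [:- 1, 1:]) (d - j))"
    by (metis (no_types, lifting) coeff_smult coeff_sum sum.cong)
  then show ?thesis unfolding coeff poly steiner_interp_def by (simp add: mult.commute)
qed

subsection \<open>Convex hulls of symmetric stable processes\<close>

locale levy_process_with_zonoid = levy_process M X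
  for M :: "'w measure" and X :: "real \<Rightarrow> 'w \<Rightarrow> 'a::euclidean_space" +
  fixes \<alpha> :: real and K :: "'a set"
  assumes \<alpha>: "1 < \<alpha>" and zonoid: "associated_zonoid M X \<alpha> K"
begin

definition step_law :: "nat \<Rightarrow> 'a measure" where
  "step_law N = distr M borel (\<lambda>\<omega>. X (1 / real N) \<omega> - X 0 \<omega>)"

definition step :: "nat \<Rightarrow> nat \<Rightarrow> 'w \<Rightarrow> 'a" where
  "step N i \<omega> = X (real (Suc i) / real N) \<omega> - X (real i / real N) \<omega>"

definition mean_factor :: real where
  "mean_factor = Gamma (1 - 1 / \<alpha>) / pi"

text \<open>The factor from \<open>K\<close> to the zonoid of one of \<open>N\<close> steps: an
  increment over time \<open>1 / N\<close> is stable with scale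
  \<open>N powr (- 1 / \<alpha>) * support_fun K u\<close> in direction \<open>u\<close>.\<close>

definition scale :: "nat \<Rightarrow> real" where
  "scale N = real N powr (- (1 / \<alpha>)) * mean_factor"

lemma mean_factor_pos: "0 < mean_factor"
  using \<alpha> by (simp add: mean_factor_def Gamma_real_pos)

lemma scale_pos: "0 < N \<Longrightarrow> 0 < scale N"
  by (simp add: scale_def mean_factor_pos)

lemma K: "convex_body K" "0 \<le> support_fun K u"
  using zonoid by (auto simp: associated_zonoid_def)

lemma step_measurable [measurable]: "step N i \<in> borel_measurable M"
  unfolding step_def using random_variable_X by (intro borel_measurable_diff) auto

lemma prob_space_step_law: "prob_space (step_law N)"
  unfolding step_law_def using random_variable_X by (intro prob_space_distr borel_measurable_diff) auto

lemma distr_step: "distr M borel (step N i) = step_law N"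
  using stationary_increments[of "real i / real N" "1 / real N"]
  by (simp add: step_def[abs_def] step_law_def add_divide_distrib add.commute)

lemma chf_step_law:
  "(CLINT x|step_law N. iexp (x \<bullet> u)) = complex_of_real (exp (- (1 / real N) * support_fun K u powr \<alpha>))"
proof -
  have m [measurable]: "X (1 / real N) \<in> borel_measurable M" "X 0 \<in> borel_measurable M"
    using random_variable_X by auto
  have "(CLINT x|step_law N. iexp (x \<bullet> u)) = (CLINT \<omega>|M. iexp ((X (1 / real N) \<omega> - X 0 \<omega>) \<bullet> u))"
    unfolding step_law_def by (rule integral_distr) measurable
  also have "\<dots> = (CLINT \<omega>|M. iexp (X (1 / real N) \<omega> \<bullet> u))"
  proof (rule integral_cong_AE)
    show "AE \<omega> in M. iexp ((X (1 / real N) \<omega> - X 0 \<omega>) \<bullet> u) = iexp (X (1 / real N) \<omega> \<bullet> u)"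
      using starts_at_origin by eventually_elim simp
  qed measurable
  also have "\<dots> = complex_of_real (exp (- (1 / real N) * support_fun K u powr \<alpha>))"
    using zonoid by (simp add: associated_zonoid_def)
  finally show ?thesis .
qed

text \<open>A sum of \<open>card B\<close> independent steps has the characteristic function of the
  process at time \<open>card B / N\<close>, so \<open>zonoid_of_stable\<close> applies with the
  factor \<open>?c\<close>.\<close>

lemma zonoid_walk_step_law:
  assumes N: "0 < N"
  shows "zonoid_walk (step_law N) (dil (scale N) K) (1 / \<alpha>)"
proof (rule zonoid_walk.intro)
  show "prob_space (step_law N)" by (rule prob_space_step_law)
  show sets: "sets (step_law N) = sets borel" by (simp add: step_law_def)
  show "convex_body (dil (scale N) K)" using K by (intro convex_body_dil)
  fix B :: "nat set" assume B: "finite B" "B \<noteq> {}"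
  let ?c = "(real (card B) / real N) powr (1 / \<alpha>)"
  have "zonoid_of (\<Pi>\<^sub>M i\<in>B. step_law N) (\<lambda>y. \<Sum>i\<in>B. y i) (dil (?c * Gamma (1 - 1 / \<alpha>) / pi) K)"
  proof (rule zonoid_of_stable)
    show "prob_space (\<Pi>\<^sub>M i\<in>B. step_law N)" by (intro prob_space_PiM prob_space_step_law)
    have "(\<lambda>y. y i) \<in> borel_measurable (\<Pi>\<^sub>M i\<in>B. step_law N)" if "i \<in> B" for i
      using measurable_component_singleton[OF that, of "\<lambda>_. step_law N"]
      unfolding measurable_cong_sets[OF refl sets] .
    then show "(\<lambda>y. \<Sum>i\<in>B. y i) \<in> borel_measurable (\<Pi>\<^sub>M i\<in>B. step_law N)" by (intro borel_measurable_sum)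
    fix u :: 'a
    have "(CLINT y|(\<Pi>\<^sub>M i\<in>B. step_law N). iexp ((\<Sum>i\<in>B. y i) \<bullet> u)) = (\<Prod>i\<in>B. CLINT x|step_law N. iexp (x \<bullet> u))"
    proof -
      have m: "(\<lambda>x. x \<bullet> u) \<in> borel_measurable (step_law N)"
        unfolding measurable_cong_sets[OF sets refl] by measurable
      show ?thesis using chf_sum_PiM[OF B(1) prob_space_step_law, of "\<lambda>_ x. x \<bullet> u" N] m by (simp add: inner_sum_left)
    qed
    also have "\<dots> = complex_of_real (exp (- (1 / real N) * support_fun K u powr \<alpha>) ^ card B)"
      by (simp add: chf_step_law)
    also have "exp (- (1 / real N) * support_fun K u powr \<alpha>) ^ card B = exp (real (card B) * (- (1 / real N) * support_fun K u powr \<alpha>))"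
      by (simp only: exp_of_nat_mult)
    also have "real (card B) * (- (1 / real N) * support_fun K u powr \<alpha>) = - ((?c * support_fun K u) powr \<alpha>)"
      using \<alpha> K(2)[of u] by (simp add: powr_mult powr_powr)
    finally show "(CLINT y|(\<Pi>\<^sub>M i\<in>B. step_law N). iexp ((\<Sum>i\<in>B. y i) \<bullet> u)) =
        complex_of_real (exp (- ((?c * support_fun K u) powr \<alpha>)))" .
  qed (use K \<alpha> in auto)
  also have "?c * Gamma (1 - 1 / \<alpha>) / pi = real (card B) powr (1 / \<alpha>) * scale N"
    by (simp add: scale_def mean_factor_def powr_divide powr_minus field_simps)
  also have "dil (real (card B) powr (1 / \<alpha>) * scale N) K = dil (real (card B) powr (1 / \<alpha>)) (dil (scale N) K)"
    by (simp add: image_image)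
  finally show "zonoid_of (\<Pi>\<^sub>M i\<in>B. step_law N) (\<lambda>y. \<Sum>i\<in>B. y i) (dil (real (card B) powr (1 / \<alpha>)) (dil (scale N) K))" .
qed

definition walk_vol :: "nat \<Rightarrow> real \<Rightarrow> 'w \<Rightarrow> real" where
  "walk_vol N t \<omega> = vol (walk_hull [0..<N] (\<lambda>i. step N i \<omega>) + cball 0 t)"

text \<open>\<open>expected_vol_walk_hull\<close> for a ball \<open>Q\<close> of radius
  \<open>t\<close>. Its coefficients are intrinsic volumes of \<open>K\<close>, and the powers of
  \<open>N\<close> in \<open>scale N ^ j\<close> normalise the growth of
  \<open>hull_coeff\<close>.\<close>

lemma expected_walk_vol:
  assumes N: "0 < N" and t: "0 < t"
  shows "integrable M (walk_vol N t)"
    "(\<integral>\<omega>. walk_vol N t \<omega> \<partial>M) = (\<Sum>j\<le>DIM('a). t ^ (DIM('a) - j) * unit_ball_vol (real (DIM('a) - j)) *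
      (fact j * hull_coeff (1 / \<alpha>) j N / real N powr (real j * (1 / \<alpha>)) * (mean_factor ^ j * intrinsic_volume j K)))"
proof -
  let ?d = "DIM('a)" and ?\<kappa> = "\<lambda>j. unit_ball_vol (real (DIM('a) - j))" and ?L = "dil (scale N) K"
  let ?F = "\<lambda>y :: nat \<Rightarrow> 'a. vol (walk_hull [0..<N] y + cball 0 t)"
  interpret W: zonoid_walk "step_law N" ?L "1 / \<alpha>" by (rule zonoid_walk_step_law[OF N])
  have good: "W.good (cball 0 t)" using t by (auto simp: W.good_def)
  obtain p where p: "degree p \<le> ?d" "\<And>s. 0 \<le> s \<Longrightarrow> vol (cball 0 t + dil s ?L) = poly p s"
    using W.vol_dil_polynomial[OF good] by blast
  \<comment> \<open>The Steiner formula with exchanged roles: the radius \<open>t\<close> is fixed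
    and the dilation of \<open>K\<close> varies, so by homogeneity the \<open>j\<close>-th intrinsic
    volume becomes the coefficient of degree \<open>j\<close>.\<close>
  define q where "q = (\<Sum>j\<le>?d. monom (t ^ (?d - j) * ?\<kappa> j * (scale N ^ j * intrinsic_volume j K)) j)"
  \<comment> \<open>Compared at \<open>1, ..., d + 1\<close>, since
    \<open>intrinsic_volume_dil\<close> requires a positive factor.\<close>
  have "p = q"
  proof (rule poly_eqI_degree[where A = "(\<lambda>i. real (Suc i)) ` {..?d}"])
    have card: "card ((\<lambda>i. real (Suc i)) ` {..?d}) = ?d + 1" by (subst card_image) (auto simp: inj_on_def)
    show "degree p < card ((\<lambda>i. real (Suc i)) ` {..?d})" using p(1) card by simp
    have "degree q \<le> ?d" unfolding q_def by (intro degree_sum_le order_trans[OF degree_monom_le]) auto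
    then show "degree q < card ((\<lambda>i. real (Suc i)) ` {..?d})" using card by simp
    fix s assume "s \<in> (\<lambda>i. real (Suc i)) ` {..?d}"
    then have s: "0 < s" by auto
    have "poly p s = vol (dil (s * scale N) K + cball 0 t)"
      using p(2)[of s] s by (simp add: image_image add.commute)
    also have "\<dots> = (\<Sum>j\<le>?d. t ^ (?d - j) * ?\<kappa> j * intrinsic_volume j (dil (s * scale N) K))"
      using K t by (intro steiner convex_body_dil) auto
    also have "\<dots> = (\<Sum>j\<le>?d. t ^ (?d - j) * ?\<kappa> j * ((s * scale N) ^ j * intrinsic_volume j K))"
      using K s scale_pos[OF N] by (intro sum.cong) (auto simp: intrinsic_volume_dil)
    also have "\<dots> = poly q s"
      by (simp add: q_def poly_sum poly_monom power_mult_distrib mult_ac)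
    finally show "poly p s = poly q s" .
  qed
  then have coeff: "coeff p j = t ^ (?d - j) * ?\<kappa> j * (scale N ^ j * intrinsic_volume j K)" if "j \<le> ?d" for j
    using that by (simp add: q_def coeff_sum)
  note E = W.expected_vol_walk_hull[OF good p, of N]
  let ?T = "\<lambda>\<omega>. \<lambda>i\<in>{..<N}. step N i \<omega>"
  have "indep_vars (\<lambda>_. borel) (step N) {..<N}"
    using indep_increments[of "\<lambda>i. real i / real N" N] by (auto simp: step_def[abs_def] divide_right_mono)
  then have "distr M (\<Pi>\<^sub>M i\<in>{..<N}. borel) ?T = (\<Pi>\<^sub>M i\<in>{..<N}. distr M borel (step N i))"
    using N by (subst (asm) indep_vars_iff_distr_eq_PiM') auto
  then have d: "distr M (\<Pi>\<^sub>M i\<in>{..<N}. borel) ?T = (\<Pi>\<^sub>M i\<in>{..<N}. step_law N)" by (simp add: distr_step)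
  have T: "?T \<in> measurable M (\<Pi>\<^sub>M i\<in>{..<N}. borel)" by (intro measurable_restrict step_measurable)
  have F0: "?F \<in> borel_measurable (\<Pi>\<^sub>M i\<in>{..<N}. step_law N)" by (rule W.measurable_vol_walk[OF good]) auto
  have s: "sets (\<Pi>\<^sub>M i\<in>{..<N}. step_law N) = sets (\<Pi>\<^sub>M i\<in>{..<N}. (borel :: 'a measure))"
    by (intro sets_PiM_cong) (auto simp: step_law_def)
  have F: "?F \<in> borel_measurable (\<Pi>\<^sub>M i\<in>{..<N}. borel)" 
    by (rule subsetD[OF equalityD1[OF measurable_cong_sets[OF s refl]] F0])
  have FT: "?F (?T \<omega>) = walk_vol N t \<omega>" for \<omega>
  proof -
    have "walk_hull [0..<N] (?T \<omega>) = walk_hull [0..<N] (\<lambda>i. step N i \<omega>)"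
      unfolding walk_hull_def by (intro image_cong refl sum.cong) auto
    then show ?thesis by (simp add: walk_vol_def)
  qed
  show "integrable M (walk_vol N t)"
    using integrable_distr_eq[OF T F] E(1) unfolding d FT by simp
  have "(\<integral>\<omega>. walk_vol N t \<omega> \<partial>M) = (\<Sum>j\<le>?d. hull_coeff (1 / \<alpha>) j N * (fact j * coeff p j))"
    using integral_distr[OF T F] E(2) unfolding d FT by simp
  also have "\<dots> = (\<Sum>j\<le>?d. t ^ (?d - j) * ?\<kappa> j *
      (fact j * hull_coeff (1 / \<alpha>) j N / real N powr (real j * (1 / \<alpha>)) * (mean_factor ^ j * intrinsic_volume j K)))"
  proof (intro sum.cong refl)
    fix j assume "j \<in> {..?d}"
    moreover have "scale N ^ j = mean_factor ^ j / real N powr (real j * (1 / \<alpha>))"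
    proof -
      have "(real N powr (- (1 / \<alpha>))) ^ j = real N powr (- (real j * (1 / \<alpha>)))"
        using N by (simp add: powr_power mult.commute)
      then show ?thesis by (simp add: scale_def power_mult_distrib powr_minus divide_inverse)
    qed
    ultimately show "hull_coeff (1 / \<alpha>) j N * (fact j * coeff p j) = t ^ (?d - j) * ?\<kappa> j *
      (fact j * hull_coeff (1 / \<alpha>) j N / real N powr (real j * (1 / \<alpha>)) * (mean_factor ^ j * intrinsic_volume j K))"
      using coeff[of j] by simp
  qed
  finally show "(\<integral>\<omega>. walk_vol N t \<omega> \<partial>M) = (\<Sum>j\<le>?d. t ^ (?d - j) * ?\<kappa> j *
      (fact j * hull_coeff (1 / \<alpha>) j N / real N powr (real j * (1 / \<alpha>)) * (mean_factor ^ j * intrinsic_volume j K)))" .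
qed

definition path_hull :: "'w \<Rightarrow> 'a set" where
  "path_hull \<omega> = closure (convex hull ((\<lambda>t. X t \<omega>) ` {0..1}))"

definition limit_coeff :: "nat \<Rightarrow> real" where
  "limit_coeff j = Gamma (1 / \<alpha>) ^ j / Gamma (real j * (1 / \<alpha>) + 1) * (mean_factor ^ j * intrinsic_volume j K)"

text \<open>The hull of the walk with \<open>2 ^ m\<close> steps is the hull of the path at the
  dyadic times of level \<open>m\<close>, because the increments telescope from the origin.\<close>

lemma AE_path_hull:
  "AE \<omega> in M. convex_body (path_hull \<omega>) \<and>
    (\<forall>t\<ge>0. mono (\<lambda>m. walk_vol (2 ^ m) t \<omega>) \<and> (\<lambda>m. walk_vol (2 ^ m) t \<omega>) \<longlonglongrightarrow> vol (path_hull \<omega> + cball 0 t))"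
  using starts_at_origin cadlag_paths
proof eventually_elim
  case (elim \<omega>)
  let ?x = "\<lambda>t. X t \<omega>" and ?C = "\<lambda>m. convex hull ((\<lambda>k. X (real k / 2 ^ m) \<omega>) ` {..2 ^ m})"
  have right: "\<And>t. 0 \<le> t \<Longrightarrow> continuous (at_right t) ?x" and left: "\<And>t. 0 < t \<Longrightarrow> \<exists>l. (?x \<longlongrightarrow> l) (at_left t)"
    using elim by auto
  note dy = dyadic_hulls[of ?x, OF right left]
  have C: "convex_body (?C m)" "?C m \<subseteq> ?C (Suc m)" for m using dy(1,2) by auto
  have Z: "path_hull \<omega> = closure (\<Union>m. ?C m)" "bounded (path_hull \<omega>)" unfolding path_hull_def using dy(3,4) by auto
  have walk: "walk_vol (2 ^ m) t \<omega> = vol (?C m + cball 0 t)" for m t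
  proof -
    have "(\<Sum>i<k. step (2 ^ m) i \<omega>) = X (real k / 2 ^ m) \<omega>" for k
      using elim sum_lessThan_telescope[of "\<lambda>i. X (real i / 2 ^ m) \<omega>" k] by (simp add: step_def)
    then show ?thesis by (simp add: walk_vol_def walk_hull_upt)
  qed
  have cb: "convex_body (?C m + cball 0 t)" if "0 \<le> t" for m t using C that by (simp add: convex_body_plus)
  show ?case
  proof (intro conjI allI impI)
    show "convex_body (path_hull \<omega>)" by (rule tendsto_vol_closure_Union(2)[OF C Z order_refl])
    fix t :: real assume t: "0 \<le> t"
    show "(\<lambda>m. walk_vol (2 ^ m) t \<omega>) \<longlonglongrightarrow> vol (path_hull \<omega> + cball 0 t)"
      unfolding walk by (rule tendsto_vol_closure_Union(1)[OF C Z t])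
    show "mono (\<lambda>m. walk_vol (2 ^ m) t \<omega>)"
      unfolding walk incseq_Suc_iff using C(2) cb[OF t] by (intro allI vol_mono set_plus_mono2 order_refl)
  qed
qed

text \<open>Monotone convergence along the dyadic walks. The expectations converge by
  \<open>hull_coeff_asymp\<close>, so the limit is integrable with the stated value.\<close>

lemma expected_vol_path_hull:
  assumes t: "0 < t"
  shows "integrable (completion M) (\<lambda>\<omega>. vol (path_hull \<omega> + cball 0 t))"
    "(\<integral>\<omega>. vol (path_hull \<omega> + cball 0 t) \<partial>completion M) =
      (\<Sum>j\<le>DIM('a). t ^ (DIM('a) - j) * unit_ball_vol (real (DIM('a) - j)) * limit_coeff j)"
proof -
  let ?u = "\<lambda>\<omega>. vol (path_hull \<omega> + cball 0 t)"
  have w: "integrable M (walk_vol (2 ^ m) t)" for m by (intro expected_walk_vol t) simp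
  then have [measurable]: "walk_vol (2 ^ m) t \<in> borel_measurable M" for m by auto
  have AE: "AE \<omega> in M. mono (\<lambda>m. walk_vol (2 ^ m) t \<omega>)" "AE \<omega> in M. (\<lambda>m. walk_vol (2 ^ m) t \<omega>) \<longlonglongrightarrow> ?u \<omega>"
    by (use AE_path_hull in \<open>eventually_elim, use t in simp\<close>)+
  have u: "?u \<in> borel_measurable (completion M)"
  proof (rule measurable_completion_AE)
    show "(\<lambda>\<omega>. lim (\<lambda>m. walk_vol (2 ^ m) t \<omega>)) \<in> borel_measurable (completion M)"
      by (intro measurable_completion) measurable
    show "AE \<omega> in completion M. ?u \<omega> = lim (\<lambda>m. walk_vol (2 ^ m) t \<omega>)"
      using AE(2)[THEN AE_completion] by eventually_elim (simp add: limI)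
  qed
  have w': "integrable (completion M) (walk_vol (2 ^ m) t)" "integral\<^sup>L (completion M) (walk_vol (2 ^ m) t) = integral\<^sup>L M (walk_vol (2 ^ m) t)" for m
    using w by (auto simp: integrable_completion integral_completion)
  have sub: "filterlim (\<lambda>m::nat. 2 ^ m :: nat) at_top sequentially"
    by (rule filterlim_subseq) (simp add: strict_mono_def)
  have lim: "(\<lambda>m. integral\<^sup>L (completion M) (walk_vol (2 ^ m) t)) \<longlonglongrightarrow>
      (\<Sum>j\<le>DIM('a). t ^ (DIM('a) - j) * unit_ball_vol (real (DIM('a) - j)) * limit_coeff j)"
    unfolding w'(2) limit_coeff_def
    using \<alpha> by (subst expected_walk_vol(2)[OF _ t], simp)
      (intro tendsto_intros filterlim_compose[OF hull_coeff_asymp sub]; simp)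
  note AE' = AE[THEN AE_completion]
  show "integrable (completion M) ?u" by (rule integrable_monotone_convergence[OF w'(1) AE' lim u])
  show "integral\<^sup>L (completion M) ?u = (\<Sum>j\<le>DIM('a). t ^ (DIM('a) - j) * unit_ball_vol (real (DIM('a) - j)) * limit_coeff j)"
    by (rule integral_monotone_convergence[OF w'(1) AE' lim u])
qed

text \<open>By \<open>steiner_interp\<close> the intrinsic volume is almost surely a fixed finite
  combination of parallel volumes at the radii \<open>1, ..., d + 1\<close>. Taking expectations
  turns it into the same combination for \<open>limit_coeff\<close>, which
  \<open>steiner_interp\<close> evaluates.\<close>

lemma expected_intrinsic_volume_path_hull:
  assumes j: "j \<le> DIM('a)"
  shows "integrable (completion M) (\<lambda>\<omega>. intrinsic_volume j (path_hull \<omega>))"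
    "(\<integral>\<omega>. intrinsic_volume j (path_hull \<omega>) \<partial>completion M) = limit_coeff j"
proof -
  let ?d = "DIM('a)" and ?\<kappa> = "unit_ball_vol (real (DIM('a) - j))"
  let ?g = "\<lambda>\<omega>. (\<Sum>i\<le>?d. steiner_interp ?d i j * vol (path_hull \<omega> + cball 0 (real (Suc i)))) / ?\<kappa>"
  have \<kappa>: "?\<kappa> \<noteq> 0" by (rule less_imp_neq[THEN not_sym]) simp
  have v: "integrable (completion M) (\<lambda>\<omega>. vol (path_hull \<omega> + cball 0 (real (Suc i))))" for i
    by (rule expected_vol_path_hull) simp
  then have g: "integrable (completion M) ?g" by simp
  have "AE \<omega> in completion M. convex_body (path_hull \<omega>)"
    by (rule AE_completion) (use AE_path_hull in \<open>auto elim!: eventually_mono\<close>)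
  then have eq: "AE \<omega> in completion M. intrinsic_volume j (path_hull \<omega>) = ?g \<omega>"
  proof eventually_elim
    case (elim \<omega>)
    show ?case
      using steiner_interp[OF j, of "\<lambda>l. intrinsic_volume l (path_hull \<omega>)"] \<kappa>
      by (simp add: steiner[OF elim] field_simps)
  qed
  have m: "(\<lambda>\<omega>. intrinsic_volume j (path_hull \<omega>)) \<in> borel_measurable (completion M)"
    by (rule measurable_completion_AE[OF borel_measurable_integrable[OF g] eq])
  show "integrable (completion M) (\<lambda>\<omega>. intrinsic_volume j (path_hull \<omega>))"
    using integrable_cong_AE[OF m borel_measurable_integrable[OF g] eq] g by simp
  have "(\<integral>\<omega>. intrinsic_volume j (path_hull \<omega>) \<partial>completion M) = integral\<^sup>L (completion M) ?g"
    by (rule integral_cong_AE[OF m borel_measurable_integrable[OF g] eq])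
  also have "\<dots> = (\<Sum>i\<le>?d. steiner_interp ?d i j *
      (\<Sum>l\<le>?d. real (Suc i) ^ (?d - l) * unit_ball_vol (real (?d - l)) * limit_coeff l)) / ?\<kappa>"
    using v expected_vol_path_hull(2) by simp
  also have "\<dots> = limit_coeff j" unfolding steiner_interp[OF j, of limit_coeff, symmetric] using \<kappa> by simp
  finally show "(\<integral>\<omega>. intrinsic_volume j (path_hull \<omega>) \<partial>completion M) = limit_coeff j" .
qed

end

theorem theorem2p3:
  fixes M :: "'w measure"
    and X :: "real \<Rightarrow> 'w \<Rightarrow> real ^ 'n"
    and \<alpha> :: real
    and K :: "(real ^ 'n) set"
    and Z :: "'w \<Rightarrow> (real ^ 'n) set"
    and j :: nat
  assumes "symmetric_stable_levy_process M X \<alpha>"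
    and "1 < \<alpha>"
    and "associated_zonoid M X \<alpha> K"
    and "\<And>\<omega>. Z \<omega> = closure (convex hull ((\<lambda>t. X t \<omega>) ` {0..1}))"
    and "j \<in> {1..CARD('n)}"
  shows "integrable (completion M) (\<lambda>\<omega>. intrinsic_volume j (Z \<omega>)) \<and>
         (\<integral>\<omega>. intrinsic_volume j (Z \<omega>) \<partial>completion M) =
           Gamma (1 - 1/\<alpha>) ^ j * Gamma (1/\<alpha>) ^ j / (pi ^ j * Gamma (real j / \<alpha> + 1))
             * intrinsic_volume j K"
proof -
  interpret symmetric_stable_levy_process M X \<alpha> by fact
  interpret H: levy_process_with_zonoid M X \<alpha> K
    using assms(2,3) by unfold_locales
  have Z: "Z \<omega> = H.path_hull \<omega>" for \<omega>
    by (simp add: assms(4) H.path_hull_def)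
  have j: "j \<le> DIM(real ^ 'n)"
    using assms(5) by simp
  show ?thesis
    using H.expected_intrinsic_volume_path_hull[OF j]
    by (simp add: Z H.limit_coeff_def H.mean_factor_def power_divide mult_ac)
qed

end
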